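(* Assume that: - every nontrivial $H\in\mathrm{Sub}_{G,D}$ is either a non-splitter or a factored splitter; - for every non-splitter $H\in\mathrm{Sub}_{G,D}$, there is at most one component of group $H$ of each degree. Then the strata $\gamma(H)$, for $H\in\mathrm{Sub}_{G,D}$, are described as follows: (i) $\gamma(1)=\{\varpi\}$. (ii) If $H$ is a non-splitter, then $\gamma(H)=V(A_H)\setminus\{\varpi\}$. (iii) Otherwise (i.e. if $H$ is nontrivial and not a non-splitter), $H$ is a factored splitter, and one can write $H=H_1\times\cdots\times H_s$ where the subgroups $H_1,\dots,H_s$ form a free factor family of $H$ consisting of non-splitters. Then $$\gamma(H)=V(J_H^* )\cap\bigcap_{i=1}^s\pi_{H_i}^{-1}\Big(\pi_{H_i}\big(V(A_{H_i})\setminus\{\varpi\}\big)\Big).$$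
   Context: Setup: $G$ is a finite group, $D$ is a nonempty set of nontrivial conjugacy classes of $G$, $\xi:D\to\mathbb{Z}_{>0}$ is a map, $|\xi|=\sum_{\gamma\in D}\xi(\gamma)$, and $k$ is a field whose characteristic does not divide $|G|$. The Artin braid group $\mathrm{B}_n$ (standard generators $\sigma_1,\dots,\sigma_{n-1}$) acts on $G^n$ by the Hurwitz action: $\sigma_i$ replaces the entries $(g_i,g_{i+1})$ in positions $i,i+1$ by $(g_ig_{i+1}g_i^{-1},g_i)$ and fixes the other entries. The product $g_1\cdots g_n$ and the subgroup $\langle g_1,\dots,g_n\rangle$ of $G$ are invariant under this action. A component of degree $n$ is an orbit, under $\mathrm{B}_{n|\xi|}$, of a tuple $(g_1,\dots,g_{n|\xi|})\in G^{n|\xi|}$ with $g_1\cdots g_{n|\xi|}=1$ and such that exactly $n\,\xi(\gamma)$ entries belong to $\gamma$, for each $\gamma\in D$. The group $\langle m\rangle$ of a component $m$ is the subgroup of $G$ generated by the entries of a representing tuple. Components of all degrees $n\ge 0$ form, under concatenation, a commutative finitely generated graded monoid $\mathrm{Comp}$, with identity the orbit of the empty tuple (the trivial component). A nontrivial component is non-factorizable if it is not a product of two nontrivial components. The ring of components is the monoid ring $R=k[\mathrm{Comp}]$, a finitely generated commutative graded $k$-algebra; $\varpi$ is its maximal ideal generated by the components of positive degree. For a subgroup $H\subseteq G$, define the following $k$-subspaces of $R$: $I_H$ (resp. $I_H^*$, $J_H^*$, $R^H$) is spanned by the components whose group contains $H$ (resp. properly contains $H$, is not contained in $H$, is contained in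 $H$). $I_H,I_H^*,J_H^*$ are homogeneous ideals, and $R^H$ is a subalgebra. For an ideal $I$ of $R$, $V(I)\subseteq\operatorname{Spec}R$ is the closed set of prime ideals containing $I$. The stratum of $H$ is $\gamma(H)=V(I_H^* )\setminus V(I_H)$. The map $\pi_H:\operatorname{Spec}R\to\operatorname{Spec}R^H$ is $p\mapsto p\cap R^H$. $A_H^\circ$ is the ideal of $R$ generated by the differences $m-m'$ for pairs of components $m,m'$ of the same degree whose groups are contained in $H$, and $A_H=A_H^\circ+J_H^*$. A subgroup $H$ of $G$ is $D$-generated if the sets $\gamma\cap H$ ($\gamma\in D$) are all nonempty and collectively generate $H$; $\mathrm{Sub}_{G,D}$ is the set of subgroups that are trivial or $D$-generated. A $D$-generated subgroup $H$ is a non-splitter if for every $\gamma\in D$ the set $\gamma\cap H$ is a single conjugacy class of $H$. A list $H_1,\dots,H_s$ of subgroups of $G$ is a free family if $\langle (H_i)_{i\in A}\rangle\cap\langle (H_j)_{j\in B}\rangle=1$ for all disjoint $A,B\subseteq\{1,\dots,s\}$, and elements of $H_i$ commute with elements of $H_j$ whenever $i\ne j$. A factor family of $H\in \mathrm{Sub}_{G,D}$ is a list $H_1,\dots,H_s$ of $D$-generated subgroups of $H$ such that every non-factorizable component whose group is contained in $H$ has its group contained in some $H_i$. A free factor family is a factor family that is a free family. $H\in\mathrm{Sub}_{G,D}$ is a factored splitter if it admits a free factor family of size at least $2$. *)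

theory Defs
  imports "HOL-Algebra.Algebra"
begin

section \<open>Braid groups and the Hurwitz action\<close>

text \<open>A letter \<open>(i, True)\<close> stands for the generator with (zero-based) index \<open>i\<close> of the braid group
  on \<open>n\<close> strands, \<open>i + 1 < n\<close>, and \<open>(i, False)\<close> for its inverse. Words are multiplied by
  concatenation.\<close>

type_synonym braid_word = "(nat \<times> bool) list"

definition braid_words :: "nat \<Rightarrow> braid_word set"
  where "braid_words n = lists ({i. Suc i < n} \<times> UNIV)"

inductive braid_equiv :: "nat \<Rightarrow> braid_word \<Rightarrow> braid_word \<Rightarrow> bool" for n
  where
    refl: "w \<in> braid_words n \<Longrightarrow> braid_equiv n w w"
  | sym: "braid_equiv n v w \<Longrightarrow> braid_equiv n w v"
  | trans: "braid_equiv n u v \<Longrightarrow> braid_equiv n v w \<Longrightarrow> braid_equiv n u w"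
  | append: "braid_equiv n v v' \<Longrightarrow> braid_equiv n w w' \<Longrightarrow> braid_equiv n (v @ w) (v' @ w')"
  | cancel: "Suc i < n \<Longrightarrow> braid_equiv n [(i, b), (i, \<not> b)] []"
  | commute: "Suc i < j \<Longrightarrow> Suc j < n \<Longrightarrow>
      braid_equiv n [(i, True), (j, True)] [(j, True), (i, True)]"
  | braid: "Suc (Suc i) < n \<Longrightarrow>
      braid_equiv n [(i, True), (Suc i, True), (i, True)]
                    [(Suc i, True), (i, True), (Suc i, True)]"

definition braid_rel :: "nat \<Rightarrow> (braid_word \<times> braid_word) set"
  where "braid_rel n = {(v, w). braid_equiv n v w}"

definition braid_group :: "nat \<Rightarrow> braid_word set monoid"
  where "braid_group n =
    \<lparr>carrier = braid_words n // braid_rel n,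
     monoid.mult = (\<lambda>P Q. \<Union>x\<in>P. \<Union>y\<in>Q. braid_rel n `` {x @ y}),
     one = braid_rel n `` {[]}\<rparr>"

definition tuples :: "('a, 'b) monoid_scheme \<Rightarrow> nat \<Rightarrow> 'a list set"
  where "tuples G n = {g. length g = n \<and> set g \<subseteq> carrier G}"

fun hurwitz_letter :: "('a, 'b) monoid_scheme \<Rightarrow> nat \<times> bool \<Rightarrow> 'a list \<Rightarrow> 'a list"
  where
    "hurwitz_letter G (i, True) g =
      g[i := g ! i \<otimes>\<^bsub>G\<^esub> g ! Suc i \<otimes>\<^bsub>G\<^esub> inv\<^bsub>G\<^esub> (g ! i), Suc i := g ! i]"
  | "hurwitz_letter G (i, False) g =
      g[i := g ! Suc i, Suc i := inv\<^bsub>G\<^esub> (g ! Suc i) \<otimes>\<^bsub>G\<^esub> g ! i \<otimes>\<^bsub>G\<^esub> g ! Suc i]"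

definition hurwitz_word :: "('a, 'b) monoid_scheme \<Rightarrow> braid_word \<Rightarrow> 'a list \<Rightarrow> 'a list"
  where "hurwitz_word G w = foldr (hurwitz_letter G) w"

text \<open>All words representing a braid \<open>P\<close> act in the same way on the tuples of length \<open>n\<close>
  (see \<open>group_action_hurwitz\<close> below), so the image under \<open>P\<close> is the single value they take.\<close>

definition hurwitz_action ::
    "('a, 'b) monoid_scheme \<Rightarrow> nat \<Rightarrow> braid_word set \<Rightarrow> 'a list \<Rightarrow> 'a list"
  where "hurwitz_action G n P =
    (\<lambda>g\<in>tuples G n. the_elem ((\<lambda>w. hurwitz_word G w g) ` P))"

definition hurwitz_orbit :: "('a, 'b) monoid_scheme \<Rightarrow> 'a list \<Rightarrow> 'a list set"
  where "hurwitz_orbit G g = orbit (braid_group (length g)) (hurwitz_action G (length g)) g"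


section \<open>The monoid of components\<close>

definition conj_class :: "('a, 'b) monoid_scheme \<Rightarrow> 'a \<Rightarrow> 'a set"
  where "conj_class G x = {g \<otimes>\<^bsub>G\<^esub> x \<otimes>\<^bsub>G\<^esub> inv\<^bsub>G\<^esub> g | g. g \<in> carrier G}"

definition conj_classes :: "('a, 'b) monoid_scheme \<Rightarrow> 'a set set"
  where "conj_classes G = conj_class G ` carrier G"

definition tuple_prod :: "('a, 'b) monoid_scheme \<Rightarrow> 'a list \<Rightarrow> 'a"
  where "tuple_prod G g = foldr (\<otimes>\<^bsub>G\<^esub>) g \<one>\<^bsub>G\<^esub>"

definition comp_tuples ::
    "('a, 'b) monoid_scheme \<Rightarrow> 'a set set \<Rightarrow> ('a set \<Rightarrow> nat) \<Rightarrow> nat \<Rightarrow> 'a list set"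
  where "comp_tuples G D \<xi> n =
    {g \<in> tuples G (n * (\<Sum>\<gamma>\<in>D. \<xi> \<gamma>)).
      tuple_prod G g = \<one>\<^bsub>G\<^esub> \<and> (\<forall>\<gamma>\<in>D. length (filter (\<lambda>x. x \<in> \<gamma>) g) = n * \<xi> \<gamma>)}"

definition components ::
    "('a, 'b) monoid_scheme \<Rightarrow> 'a set set \<Rightarrow> ('a set \<Rightarrow> nat) \<Rightarrow> nat \<Rightarrow> 'a list set set"
  where "components G D \<xi> n = hurwitz_orbit G ` comp_tuples G D \<xi> n"

text \<open>The unions over representatives in the next two definitions are unions of equal sets.\<close>

definition comp_group :: "('a, 'b) monoid_scheme \<Rightarrow> 'a list set \<Rightarrow> 'a set"
  where "comp_group G m = (\<Union>g\<in>m. generate G (set g))"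

definition Comp ::
    "('a, 'b) monoid_scheme \<Rightarrow> 'a set set \<Rightarrow> ('a set \<Rightarrow> nat) \<Rightarrow> 'a list set monoid"
  where "Comp G D \<xi> =
    \<lparr>carrier = (\<Union>n. components G D \<xi> n),
     monoid.mult = (\<lambda>m m'. \<Union>g\<in>m. \<Union>h\<in>m'. hurwitz_orbit G (g @ h)),
     one = hurwitz_orbit G []\<rparr>"

definition nonfactorizable :: "('m, 'b) monoid_scheme \<Rightarrow> 'm \<Rightarrow> bool"
  where "nonfactorizable M m \<longleftrightarrow> m \<in> carrier M \<and> m \<noteq> \<one>\<^bsub>M\<^esub> \<and>
    (\<nexists>a b. a \<in> carrier M - {\<one>\<^bsub>M\<^esub>} \<and> b \<in> carrier M - {\<one>\<^bsub>M\<^esub>} \<and> m = a \<otimes>\<^bsub>M\<^esub> b)"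


section \<open>The ring of components\<close>

definition delta :: "'m \<Rightarrow> 'm \<Rightarrow> 'k::field"
  where "delta m = (\<lambda>x. if x = m then 1 else 0)"

text \<open>The monoid ring consists of the finitely supported functions on the monoid, extended by zero;
  \<open>delta m\<close> is the basis element given by \<open>m\<close>.\<close>

definition monoid_ring :: "('m, 'b) monoid_scheme \<Rightarrow> ('m \<Rightarrow> 'k::field) ring"
  where "monoid_ring M =
    \<lparr>carrier = {f. finite {m. f m \<noteq> 0} \<and> {m. f m \<noteq> 0} \<subseteq> carrier M},
     monoid.mult = (\<lambda>f g x. \<Sum>(a, b) \<in> {(a, b). f a \<noteq> 0 \<and> g b \<noteq> 0 \<and> a \<otimes>\<^bsub>M\<^esub> b = x}. f a * g b),
     one = delta \<one>\<^bsub>M\<^esub>,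
     ring.zero = (\<lambda>x. 0),
     ring.add = (\<lambda>f g x. f x + g x)\<rparr>"

definition lin_span :: "'m set \<Rightarrow> ('m \<Rightarrow> 'k::field) set"
  where "lin_span S = {(\<lambda>x. \<Sum>m\<in>A. c m * delta m x) | A c. finite A \<and> A \<subseteq> S}"

definition Spec :: "('r, 'b) ring_scheme \<Rightarrow> 'r set set"
  where "Spec R = {p. primeideal p R}"

definition V :: "('r, 'b) ring_scheme \<Rightarrow> 'r set \<Rightarrow> 'r set set"
  where "V R I = {p \<in> Spec R. I \<subseteq> p}"

definition comp_ring ::
    "('a, 'b) monoid_scheme \<Rightarrow> 'a set set \<Rightarrow> ('a set \<Rightarrow> nat) \<Rightarrow> ('a list set \<Rightarrow> 'k::field) ring"
  where "comp_ring G D \<xi> = monoid_ring (Comp G D \<xi>)"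

definition varpi ::
    "('a, 'b) monoid_scheme \<Rightarrow> 'a set set \<Rightarrow> ('a set \<Rightarrow> nat) \<Rightarrow> ('a list set \<Rightarrow> 'k::field) set"
  where "varpi G D \<xi> =
    Idl\<^bsub>comp_ring G D \<xi>\<^esub> (delta ` (\<Union>n\<in>{0<..}. components G D \<xi> n))"

definition I_ideal ::
    "('a, 'b) monoid_scheme \<Rightarrow> 'a set set \<Rightarrow> ('a set \<Rightarrow> nat) \<Rightarrow> 'a set \<Rightarrow> ('a list set \<Rightarrow> 'k::field) set"
  where "I_ideal G D \<xi> H = lin_span {m \<in> carrier (Comp G D \<xi>). H \<subseteq> comp_group G m}"

definition I_star ::
    "('a, 'b) monoid_scheme \<Rightarrow> 'a set set \<Rightarrow> ('a set \<Rightarrow> nat) \<Rightarrow> 'a set \<Rightarrow> ('a list set \<Rightarrow> 'k::field) set"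
  where "I_star G D \<xi> H = lin_span {m \<in> carrier (Comp G D \<xi>). H \<subset> comp_group G m}"

definition J_star ::
    "('a, 'b) monoid_scheme \<Rightarrow> 'a set set \<Rightarrow> ('a set \<Rightarrow> nat) \<Rightarrow> 'a set \<Rightarrow> ('a list set \<Rightarrow> 'k::field) set"
  where "J_star G D \<xi> H = lin_span {m \<in> carrier (Comp G D \<xi>). \<not> comp_group G m \<subseteq> H}"

definition R_sub ::
    "('a, 'b) monoid_scheme \<Rightarrow> 'a set set \<Rightarrow> ('a set \<Rightarrow> nat) \<Rightarrow> 'a set \<Rightarrow> ('a list set \<Rightarrow> 'k::field) set"
  where "R_sub G D \<xi> H = lin_span {m \<in> carrier (Comp G D \<xi>). comp_group G m \<subseteq> H}"

definition A_circ ::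
    "('a, 'b) monoid_scheme \<Rightarrow> 'a set set \<Rightarrow> ('a set \<Rightarrow> nat) \<Rightarrow> 'a set \<Rightarrow> ('a list set \<Rightarrow> 'k::field) set"
  where "A_circ G D \<xi> H =
    Idl\<^bsub>comp_ring G D \<xi>\<^esub> {delta m \<ominus>\<^bsub>comp_ring G D \<xi>\<^esub> delta m' | m m' n.
      m \<in> components G D \<xi> n \<and> m' \<in> components G D \<xi> n \<and>
      comp_group G m \<subseteq> H \<and> comp_group G m' \<subseteq> H}"

definition A_ideal ::
    "('a, 'b) monoid_scheme \<Rightarrow> 'a set set \<Rightarrow> ('a set \<Rightarrow> nat) \<Rightarrow> 'a set \<Rightarrow> ('a list set \<Rightarrow> 'k::field) set"
  where "A_ideal G D \<xi> H = A_circ G D \<xi> H <+>\<^bsub>comp_ring G D \<xi>\<^esub> J_star G D \<xi> H"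

definition stratum ::
    "('a, 'b) monoid_scheme \<Rightarrow> 'a set set \<Rightarrow> ('a set \<Rightarrow> nat) \<Rightarrow> 'a set
      \<Rightarrow> ('a list set \<Rightarrow> 'k::field) set set"
  where "stratum G D \<xi> H =
    V (comp_ring G D \<xi>) (I_star G D \<xi> H) - V (comp_ring G D \<xi>) (I_ideal G D \<xi> H)"

text \<open>The map from \<open>Spec R\<close> to \<open>Spec R\<^sup>H\<close> given by contraction of prime ideals.\<close>

definition contract ::
    "('a, 'b) monoid_scheme \<Rightarrow> 'a set set \<Rightarrow> ('a set \<Rightarrow> nat) \<Rightarrow> 'a set
      \<Rightarrow> ('a list set \<Rightarrow> 'k::field) set \<Rightarrow> ('a list set \<Rightarrow> 'k) set"
  where "contract G D \<xi> H p = p \<inter> R_sub G D \<xi> H"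


section \<open>Splitters and factor families\<close>

definition D_generated :: "('a, 'b) monoid_scheme \<Rightarrow> 'a set set \<Rightarrow> 'a set \<Rightarrow> bool"
  where "D_generated G D H \<longleftrightarrow> subgroup H G \<and> (\<forall>\<gamma>\<in>D. \<gamma> \<inter> H \<noteq> {}) \<and>
    generate G (\<Union>\<gamma>\<in>D. \<gamma> \<inter> H) = H"

definition Sub_GD :: "('a, 'b) monoid_scheme \<Rightarrow> 'a set set \<Rightarrow> 'a set set"
  where "Sub_GD G D = {H. H = {\<one>\<^bsub>G\<^esub>} \<or> D_generated G D H}"

definition non_splitter :: "('a, 'b) monoid_scheme \<Rightarrow> 'a set set \<Rightarrow> 'a set \<Rightarrow> bool"
  where "non_splitter G D H \<longleftrightarrow> D_generated G D H \<and>
    (\<forall>\<gamma>\<in>D. \<gamma> \<inter> H \<in> conj_classes (G\<lparr>carrier := H\<rparr>))"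

definition free_family :: "('a, 'b) monoid_scheme \<Rightarrow> 'a set list \<Rightarrow> bool"
  where "free_family G Hs \<longleftrightarrow>
    (\<forall>H\<in>set Hs. subgroup H G) \<and>
    (\<forall>A B. A \<subseteq> {..<length Hs} \<longrightarrow> B \<subseteq> {..<length Hs} \<longrightarrow> A \<inter> B = {} \<longrightarrow>
      generate G (\<Union>i\<in>A. Hs ! i) \<inter> generate G (\<Union>j\<in>B. Hs ! j) = {\<one>\<^bsub>G\<^esub>}) \<and>
    (\<forall>i<length Hs. \<forall>j<length Hs. i \<noteq> j \<longrightarrow>
      (\<forall>x\<in>Hs ! i. \<forall>y\<in>Hs ! j. x \<otimes>\<^bsub>G\<^esub> y = y \<otimes>\<^bsub>G\<^esub> x))"

definition factor_family ::
    "('a, 'b) monoid_scheme \<Rightarrow> 'a set set \<Rightarrow> ('a set \<Rightarrow> nat) \<Rightarrow> 'a set \<Rightarrow> 'a set list \<Rightarrow> bool"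
  where "factor_family G D \<xi> H Hs \<longleftrightarrow>
    (\<forall>K\<in>set Hs. D_generated G D K \<and> K \<subseteq> H) \<and>
    (\<forall>m. nonfactorizable (Comp G D \<xi>) m \<longrightarrow> comp_group G m \<subseteq> H \<longrightarrow>
      (\<exists>K\<in>set Hs. comp_group G m \<subseteq> K))"

definition free_factor_family ::
    "('a, 'b) monoid_scheme \<Rightarrow> 'a set set \<Rightarrow> ('a set \<Rightarrow> nat) \<Rightarrow> 'a set \<Rightarrow> 'a set list \<Rightarrow> bool"
  where "free_factor_family G D \<xi> H Hs \<longleftrightarrow> factor_family G D \<xi> H Hs \<and> free_family G Hs"

definition factored_splitter ::
    "('a, 'b) monoid_scheme \<Rightarrow> 'a set set \<Rightarrow> ('a set \<Rightarrow> nat) \<Rightarrow> 'a set \<Rightarrow> bool"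
  where "factored_splitter G D \<xi> H \<longleftrightarrow> H \<in> Sub_GD G D \<and>
    (\<exists>Hs. free_factor_family G D \<xi> H Hs \<and> length Hs \<ge> 2)"

text \<open>\<open>H\<close> is the internal direct product of the subgroups in the list \<open>Hs\<close>.\<close>

definition internal_direct_product :: "('a, 'b) monoid_scheme \<Rightarrow> 'a set \<Rightarrow> 'a set list \<Rightarrow> bool"
  where "internal_direct_product G H Hs \<longleftrightarrow>
    (\<forall>K\<in>set Hs. subgroup K G) \<and> subgroup H G \<and>
    (\<lambda>h. tuple_prod G (map h [0..<length Hs]))
      \<in> iso (product_group {..<length Hs} (\<lambda>i. G\<lparr>carrier := Hs ! i\<rparr>)) (G\<lparr>carrier := H\<rparr>)"


section \<open>Well-definedness of the braid groups and of the Hurwitz action\<close>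

lemma braid_equiv_words: "braid_equiv n v w \<Longrightarrow> v \<in> braid_words n \<and> w \<in> braid_words n"
  by (induction rule: braid_equiv.induct) (auto simp: braid_words_def)

lemma equiv_braid_rel: "equiv (braid_words n) (braid_rel n)"
proof (rule equivI)
  show "braid_rel n \<subseteq> braid_words n \<times> braid_words n"
    using braid_equiv_words by (auto simp: braid_rel_def)
  show "refl_on (braid_words n) (braid_rel n)"
    by (auto simp: braid_rel_def refl_on_def intro: braid_equiv.refl)
  show "Relation.sym (braid_rel n)"
    by (auto simp: braid_rel_def sym_def intro: braid_equiv.sym)
  show "Relation.trans (braid_rel n)"
    by (auto simp: braid_rel_def trans_def intro: braid_equiv.trans)
qed

lemma braid_mult:
  assumes "v \<in> braid_words n" "w \<in> braid_words n"
  shows "(braid_rel n `` {v}) \<otimes>\<^bsub>braid_group n\<^esub> (braid_rel n `` {w}) = braid_rel n `` {v @ w}"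
proof -
  have *: "braid_rel n `` {x @ y} = braid_rel n `` {v @ w}"
    if x: "x \<in> braid_rel n `` {v}" and y: "y \<in> braid_rel n `` {w}" for x y
  proof -
    have "braid_equiv n (v @ w) (x @ y)"
      using x y by (intro braid_equiv.append) (auto simp: braid_rel_def)
    then have "braid_equiv n (x @ y) (v @ w)"
      by (rule braid_equiv.sym)
    then show ?thesis
      by (intro equiv_class_eq[OF equiv_braid_rel]) (simp add: braid_rel_def)
  qed
  have "v \<in> braid_rel n `` {v}" "w \<in> braid_rel n `` {w}"
    using assms by (auto simp: braid_rel_def intro: braid_equiv.refl)
  then have ne: "braid_rel n `` {v} \<noteq> {}" "braid_rel n `` {w} \<noteq> {}"
    by blast+
  have "(\<Union>x\<in>braid_rel n `` {v}. \<Union>y\<in>braid_rel n `` {w}. braid_rel n `` {x @ y}) =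
      (\<Union>x\<in>braid_rel n `` {v}. \<Union>y\<in>braid_rel n `` {w}. braid_rel n `` {v @ w})"
    by (intro SUP_cong HOL.refl *)
  also have "\<dots> = braid_rel n `` {v @ w}"
    using ne by simp
  finally have "(\<Union>x\<in>braid_rel n `` {v}. \<Union>y\<in>braid_rel n `` {w}. braid_rel n `` {x @ y}) =
      braid_rel n `` {v @ w}" .
  then show ?thesis
    by (simp add: braid_group_def)
qed

lemma braid_words_append: "v \<in> braid_words n \<Longrightarrow> w \<in> braid_words n \<Longrightarrow> v @ w \<in> braid_words n"
  by (auto simp: braid_words_def)

lemma braid_carrierE:
  assumes "P \<in> carrier (braid_group n)"
  obtains w where "w \<in> braid_words n" "P = braid_rel n `` {w}"
  using assms by (auto simp: braid_group_def elim: quotientE)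

lemma braid_carrierI: "w \<in> braid_words n \<Longrightarrow> braid_rel n `` {w} \<in> carrier (braid_group n)"
  by (auto simp: braid_group_def intro: quotientI)

lemma braid_left_inverse:
  assumes "w \<in> braid_words n"
  shows "\<exists>v\<in>braid_words n. braid_equiv n (v @ w) []"
  using assms
proof (induction w)
  case Nil
  then show ?case by (auto intro!: bexI[of _ "[]"] braid_equiv.refl)
next
  case (Cons a w)
  obtain i b where a: "a = (i, b)" by force
  have i: "Suc i < n" and w: "w \<in> braid_words n"
    using Cons.prems by (auto simp: braid_words_def a)
  obtain v where v: "v \<in> braid_words n" "braid_equiv n (v @ w) []"
    using Cons.IH w by blast
  have "braid_equiv n ([(i, \<not> b)] @ [(i, b)]) []"
    using braid_equiv.cancel[OF i, of "\<not> b"] by simp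
  then have "braid_equiv n (v @ ([(i, \<not> b)] @ [(i, b)]) @ w) (v @ [] @ w)"
    using v(1) w by (intro braid_equiv.append braid_equiv.refl)
  then have "braid_equiv n (v @ [(i, \<not> b), (i, b)] @ w) []"
    using braid_equiv.trans[OF _ v(2)] by simp
  moreover have "v @ [(i, \<not> b)] \<in> braid_words n"
    using v(1) i by (auto simp: braid_words_def)
  ultimately show ?case
    unfolding a by (intro bexI[of _ "v @ [(i, \<not> b)]"]) auto
qed

lemma group_braid_group: "Group.group (braid_group n)"
proof (rule groupI)
  show one: "\<one>\<^bsub>braid_group n\<^esub> \<in> carrier (braid_group n)"
    using braid_carrierI[of "[]"] by (simp add: braid_group_def braid_words_def)
  have one_eq: "\<one>\<^bsub>braid_group n\<^esub> = braid_rel n `` {[]}"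
    by (simp add: braid_group_def)
  have nil: "[] \<in> braid_words n" by (simp add: braid_words_def)
  fix P assume P: "P \<in> carrier (braid_group n)"
  then obtain w where w: "w \<in> braid_words n" "P = braid_rel n `` {w}"
    by (rule braid_carrierE)
  show "\<one>\<^bsub>braid_group n\<^esub> \<otimes>\<^bsub>braid_group n\<^esub> P = P"
    using braid_mult[OF nil w(1)] by (simp add: one_eq w(2))
  obtain v where v: "v \<in> braid_words n" "braid_equiv n (v @ w) []"
    using braid_left_inverse[OF w(1)] by blast
  have "(braid_rel n `` {v}) \<otimes>\<^bsub>braid_group n\<^esub> P = \<one>\<^bsub>braid_group n\<^esub>"
    unfolding one_eq w(2) braid_mult[OF v(1) w(1)]
    using v(2) by (intro equiv_class_eq[OF equiv_braid_rel]) (simp add: braid_rel_def)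
  then show "\<exists>Q\<in>carrier (braid_group n). Q \<otimes>\<^bsub>braid_group n\<^esub> P = \<one>\<^bsub>braid_group n\<^esub>"
    using braid_carrierI[OF v(1)] by blast
  fix Q assume "Q \<in> carrier (braid_group n)"
  then obtain v where v: "v \<in> braid_words n" "Q = braid_rel n `` {v}"
    by (rule braid_carrierE)
  show "P \<otimes>\<^bsub>braid_group n\<^esub> Q \<in> carrier (braid_group n)"
    unfolding v(2) w(2) braid_mult[OF w(1) v(1)]
    by (intro braid_carrierI braid_words_append w(1) v(1))
  fix S assume "S \<in> carrier (braid_group n)"
  then obtain u where u: "u \<in> braid_words n" "S = braid_rel n `` {u}"
    by (rule braid_carrierE)
  show "P \<otimes>\<^bsub>braid_group n\<^esub> Q \<otimes>\<^bsub>braid_group n\<^esub> S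
      = P \<otimes>\<^bsub>braid_group n\<^esub> (Q \<otimes>\<^bsub>braid_group n\<^esub> S)"
    unfolding u(2) v(2) w(2) using u(1) v(1) w(1)
    by (simp add: braid_mult braid_words_append)
qed

context Group.group
begin

lemma hurwitz_letter_tuples:
  assumes "g \<in> tuples G n" "Suc i < n"
  shows "hurwitz_letter G (i, b) g \<in> tuples G n"
proof -
  have *: "g ! i \<in> carrier G" "g ! Suc i \<in> carrier G"
    using assms by (auto simp: tuples_def)
  have len: "length g = n" and sub: "set g \<subseteq> carrier G"
    using assms(1) by (auto simp: tuples_def)
  have upd: "set (g[i := x, Suc i := y]) \<subseteq> carrier G" if "x \<in> carrier G" "y \<in> carrier G" for x y
    using that sub set_update_subset_insert[of "g[i := x]" "Suc i" y]
      set_update_subset_insert[of g i x] by blast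
  have "g[i := x, Suc i := y] \<in> tuples G n" if "x \<in> carrier G" "y \<in> carrier G" for x y
    using upd[OF that] len by (simp add: tuples_def)
  then show ?thesis
    using * by (cases b) simp_all
qed

lemma hurwitz_word_tuples:
  "w \<in> braid_words n \<Longrightarrow> g \<in> tuples G n \<Longrightarrow> hurwitz_word G w g \<in> tuples G n"
proof (induction w)
  case (Cons a w)
  then show ?case
    by (cases a) (auto simp: hurwitz_word_def braid_words_def hurwitz_letter_tuples
        simp del: hurwitz_letter.simps)
qed (simp add: hurwitz_word_def)

lemma hurwitz_word_append: "hurwitz_word G (v @ w) g = hurwitz_word G v (hurwitz_word G w g)"
  by (simp add: hurwitz_word_def)

lemma hurwitz_word_equiv:
  assumes "braid_equiv n v w" "g \<in> tuples G n"
  shows "hurwitz_word G v g = hurwitz_word G w g"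
  using assms
proof (induction arbitrary: g rule: braid_equiv.induct)
  case (append v v' w w')
  moreover have "hurwitz_word G w g \<in> tuples G n"
    using append.hyps(2) append.prems hurwitz_word_tuples braid_equiv_words by blast
  ultimately show ?case
    by (simp only: hurwitz_word_append)
next
  case (cancel i b)
  then have c: "g ! i \<in> carrier G" "g ! Suc i \<in> carrier G" "length g = n"
    by (auto simp: tuples_def)
  have inv1: "x \<otimes> (inv x \<otimes> y) = y" "inv x \<otimes> (x \<otimes> y) = y"
    if "x \<in> carrier G" "y \<in> carrier G" for x y
    using that by (simp_all flip: m_assoc)
  have "hurwitz_word G [(i, b), (i, \<not> b)] g ! k = g ! k" if "k < n" for k
    using c cancel(1) that
    by (cases b) (auto simp: hurwitz_word_def nth_list_update m_assoc inv1)
  moreover have "length (hurwitz_word G [(i, b), (i, \<not> b)] g) = n"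
    using c by (cases b) (auto simp: hurwitz_word_def)
  ultimately show ?case
    using c(3) by (intro nth_equalityI) (auto simp: hurwitz_word_def)
next
  case (commute i j)
  then have c: "length g = n" by (auto simp: tuples_def)
  show ?case
    using c commute(1,2)
    by (intro nth_equalityI) (auto simp: hurwitz_word_def nth_list_update)
next
  case (braid i)
  then have c: "g ! i \<in> carrier G" "g ! Suc i \<in> carrier G" "g ! Suc (Suc i) \<in> carrier G"
      "length g = n"
    by (auto simp: tuples_def)
  have inv1: "x \<otimes> (inv x \<otimes> y) = y" "inv x \<otimes> (x \<otimes> y) = y"
    if "x \<in> carrier G" "y \<in> carrier G" for x y
    using that by (simp_all flip: m_assoc)
  have ne: "Suc i \<noteq> i" "i \<noteq> Suc i" "Suc (Suc i) \<noteq> i" "i \<noteq> Suc (Suc i)"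
    "Suc (Suc i) \<noteq> Suc i" "Suc i \<noteq> Suc (Suc i)"
    by simp_all
  have lt: "i < n" "Suc i < n" using braid(1) by simp_all
  define l r where "l = hurwitz_word G [(i, True), (Suc i, True), (i, True)] g"
    and "r = hurwitz_word G [(Suc i, True), (i, True), (Suc i, True)] g"
  have len: "length l = n" "length r = n"
    using c(4) by (simp_all add: l_def r_def hurwitz_word_def)
  have "l ! k = r ! k" if "k < n" for k
  proof -
    consider "k = i" | "k = Suc i" | "k = Suc (Suc i)" | "k \<noteq> i" "k \<noteq> Suc i" "k \<noteq> Suc (Suc i)"
      by blast
    then show ?thesis
      by cases (use c lt braid(1) in \<open>simp_all add: l_def r_def hurwitz_word_def m_assoc
          inv_mult_group inv1 ne\<close>)
  qed
  then show ?case
    unfolding l_def[symmetric] r_def[symmetric] using len by (intro nth_equalityI) auto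
qed auto

lemma hurwitz_action_class:
  assumes "w \<in> braid_words n" "g \<in> tuples G n"
  shows "hurwitz_action G n (braid_rel n `` {w}) g = hurwitz_word G w g"
proof -
  have "(\<lambda>v. hurwitz_word G v g) ` (braid_rel n `` {w}) = {hurwitz_word G w g}"
  proof
    show "(\<lambda>v. hurwitz_word G v g) ` (braid_rel n `` {w}) \<subseteq> {hurwitz_word G w g}"
      using hurwitz_word_equiv[OF _ assms(2)] by (auto simp: braid_rel_def)
    show "{hurwitz_word G w g} \<subseteq> (\<lambda>v. hurwitz_word G v g) ` (braid_rel n `` {w})"
      using assms(1) by (auto simp: braid_rel_def intro: braid_equiv.refl)
  qed
  then show ?thesis
    using assms(2) by (simp add: hurwitz_action_def)
qed

lemma hurwitz_action_mult:
  assumes "P \<in> carrier (braid_group n)" "Q \<in> carrier (braid_group n)" "g \<in> tuples G n"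
  shows "hurwitz_action G n (P \<otimes>\<^bsub>braid_group n\<^esub> Q) g =
    hurwitz_action G n P (hurwitz_action G n Q g)"
proof -
  obtain v where v: "v \<in> braid_words n" "P = braid_rel n `` {v}"
    using assms(1) by (rule braid_carrierE)
  obtain w where w: "w \<in> braid_words n" "Q = braid_rel n `` {w}"
    using assms(2) by (rule braid_carrierE)
  show ?thesis
    unfolding v(2) w(2) using v(1) w(1) assms(3)
    by (simp add: braid_mult braid_words_append hurwitz_action_class hurwitz_word_append
        hurwitz_word_tuples)
qed

theorem group_action_hurwitz: "group_action (braid_group n) (tuples G n) (hurwitz_action G n)"
proof -
  interpret B: Group.group "braid_group n" by (rule group_braid_group)
  have one: "hurwitz_action G n \<one>\<^bsub>braid_group n\<^esub> g = g" if "g \<in> tuples G n" for g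
    using hurwitz_action_class[of "[]" n g] that
    by (simp add: braid_group_def braid_words_def hurwitz_word_def)
  have closed: "hurwitz_action G n P g \<in> tuples G n"
    if "P \<in> carrier (braid_group n)" "g \<in> tuples G n" for P g
    using that by (auto elim!: braid_carrierE simp: hurwitz_action_class hurwitz_word_tuples)
  have bij: "hurwitz_action G n P \<in> Bij (tuples G n)" if P: "P \<in> carrier (braid_group n)" for P
  proof -
    have "bij_betw (hurwitz_action G n P) (tuples G n) (tuples G n)"
    proof (rule bij_betwI[where g = "hurwitz_action G n (inv\<^bsub>braid_group n\<^esub> P)"])
      fix g assume g: "g \<in> tuples G n"
      show "hurwitz_action G n (inv\<^bsub>braid_group n\<^esub> P) (hurwitz_action G n P g) = g"
        using hurwitz_action_mult[of "inv\<^bsub>braid_group n\<^esub> P" n P g] P g one by simp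
      show "hurwitz_action G n P (hurwitz_action G n (inv\<^bsub>braid_group n\<^esub> P) g) = g"
        using hurwitz_action_mult[of P n "inv\<^bsub>braid_group n\<^esub> P" g] P g one by simp
    qed (use P closed in auto)
    then show ?thesis
      by (simp add: Bij_def hurwitz_action_def)
  qed
  have "hurwitz_action G n (P \<otimes>\<^bsub>braid_group n\<^esub> Q) =
      compose (tuples G n) (hurwitz_action G n P) (hurwitz_action G n Q)"
    if "P \<in> carrier (braid_group n)" "Q \<in> carrier (braid_group n)" for P Q
  proof
    fix g
    show "hurwitz_action G n (P \<otimes>\<^bsub>braid_group n\<^esub> Q) g =
        compose (tuples G n) (hurwitz_action G n P) (hurwitz_action G n Q) g"
      using hurwitz_action_mult[OF that]
      by (cases "g \<in> tuples G n") (auto simp: compose_def hurwitz_action_def)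
  qed
  then have "hurwitz_action G n \<in> hom (braid_group n) (BijGroup (tuples G n))"
    using bij by (auto simp: hom_def BijGroup_def)
  then show ?thesis
    by (intro group_action.intro group_hom.intro group_hom_axioms.intro
        group_braid_group group_BijGroup)
qed

end

end

theory Submission
  imports Defs
begin

text \<open>A prime \<open>p\<close> is studied through the set of components it does not contain, which is closed under
  products and under factors. If \<open>m\<^sub>0 \<notin> p\<close> has group \<open>H\<close>, then multiplication by \<open>m\<^sub>0\<close> moves components
  with group inside \<open>H\<close> to components of group exactly \<open>H\<close>, and all other components to components whose
  group strictly contains \<open>H\<close>; if the former are determined by their degree,
  \<open>m\<^sub>0 (m - m') = 0\<close> forces \<open>m - m' \<in> p\<close>. Conversely, for \<open>p \<noteq> \<varpi>\<close> containing \<open>A\<^sub>H\<close>, a nontrivial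
  \<open>m \<notin> p\<close> has a power with the same degree as a power of some component of group \<open>H\<close>, and so the
  latter is not in \<open>p\<close> either. For a free factor family, a component of group \<open>H = H\<^sub>1 \<times> \<dots> \<times> H\<^sub>s\<close> is a
  product of components of groups \<open>H\<^sub>1, \<dots>, H\<^sub>s\<close>, which reduces the stratum of \<open>H\<close> to those of the
  \<open>H\<^sub>i\<close>.\<close>

section \<open>The monoid ring of a commutative monoid\<close>

text \<open>The ideals in the statement come from components and from differences of components of
  equal degree, so whether a prime contains them is decided on such elements; this moves the
  argument into \<open>Comp\<close>, where degrees and groups are visible. The obstacle in the
  factored case is that the description for a non-splitter K asks for \<open>J_star\<close> of K
  inside the prime, whereas a prime in the stratum of a larger H is only known to contain
  \<open>J_star\<close> of H. Contraction to R^K forgets the components outside K: p is replaced by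
  another prime q with the same trace on R^K. Splitting a component along a free family rests on
  factorization into non-factorizable components, which exists because degrees add up and only the
  trivial component has degree 0; directness of the product then prevents the part collected in one
  member from generating less than that member. Since the classes in D avoid \<one>, D-generated
  subgroups are nontrivial, so the members of a free factor family of size at least 2 are proper,
  and repeated splitting ends in non-splitters.\<close>

lemma monoid_ring_carrier:
  "f \<in> carrier (monoid_ring M) \<longleftrightarrow> finite {m. f m \<noteq> 0} \<and> {m. f m \<noteq> 0} \<subseteq> carrier M"
  by (simp add: monoid_ring_def)

lemma monoid_ring_simps:
  "\<zero>\<^bsub>monoid_ring M\<^esub> = (\<lambda>x. 0)"
  "\<one>\<^bsub>monoid_ring M\<^esub> = delta \<one>\<^bsub>M\<^esub>"
  "f \<oplus>\<^bsub>monoid_ring M\<^esub> g = (\<lambda>x. f x + g x)"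
  by (simp_all add: monoid_ring_def)

lemma delta_closed [simp]: "m \<in> carrier M \<Longrightarrow> delta m \<in> carrier (monoid_ring M)"
  by (auto simp: monoid_ring_carrier delta_def split: if_splits)

text \<open>Convolution sums are never manipulated directly: elements of the monoid ring are compared
  through their pairings with all functions, and the pairing of a product is an iterated pairing.\<close>

definition pairing :: "('m \<Rightarrow> 'k::field) \<Rightarrow> ('m \<Rightarrow> 'k) \<Rightarrow> 'k"
  where "pairing f \<phi> = (\<Sum>a | f a \<noteq> 0. f a * \<phi> a)"

lemma pairing_eq:
  assumes "finite S" "{a. f a \<noteq> 0} \<subseteq> S"
  shows "pairing f \<phi> = (\<Sum>a\<in>S. f a * \<phi> a)"
  unfolding pairing_def using assms by (intro sum.mono_neutral_left) auto

lemma pairing_delta_left [simp]: "pairing (delta m) \<phi> = \<phi> m"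
  by (subst pairing_eq[of "{m}"]) (auto simp: delta_def)

lemma pairing_delta_right:
  assumes "finite {a. f a \<noteq> 0}"
  shows "pairing f (delta m) = f m"
proof -
  have "pairing f (delta m) = (\<Sum>a\<in>insert m {a. f a \<noteq> 0}. f a * delta m a)"
    using assms by (intro pairing_eq) auto
  also have "\<dots> = (\<Sum>a\<in>{m}. f a * delta m a)"
    using assms by (intro sum.mono_neutral_right) (auto simp: delta_def)
  finally show ?thesis by (simp add: delta_def)
qed

lemma pairing_cong:
  assumes "f \<in> carrier (monoid_ring M)" "\<And>a. a \<in> carrier M \<Longrightarrow> \<phi> a = \<psi> a"
  shows "pairing f \<phi> = pairing f \<psi>"
  unfolding pairing_def using assms by (intro sum.cong) (auto simp: monoid_ring_carrier)

lemma pairing_swap: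
  assumes "f \<in> carrier (monoid_ring M)" "g \<in> carrier (monoid_ring M)"
  shows "pairing f (\<lambda>a. pairing g (\<lambda>b. \<phi> a b)) = pairing g (\<lambda>b. pairing f (\<lambda>a. \<phi> a b))"
  unfolding pairing_def sum_distrib_left by (subst sum.swap) (simp add: mult.left_commute)

lemma pairing_add_left:
  assumes "finite {a. f a \<noteq> 0}" "finite {a. g a \<noteq> 0}"
  shows "pairing (\<lambda>x. f x + g x) \<phi> = pairing f \<phi> + pairing g \<phi>"
proof -
  let ?S = "{a. f a \<noteq> 0} \<union> {a. g a \<noteq> 0}"
  have S: "finite ?S" using assms by simp
  have "pairing (\<lambda>x. f x + g x) \<phi> = (\<Sum>a\<in>?S. (f a + g a) * \<phi> a)"
    using S by (intro pairing_eq) auto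
  also have "\<dots> = pairing f \<phi> + pairing g \<phi>"
    by (subst (1 2) pairing_eq[OF S]) (auto simp: sum.distrib distrib_right)
  finally show ?thesis .
qed

text \<open>Testing against \<open>delta m\<close> recovers the coefficient at \<open>m\<close>, so
  pairings separate the elements of the ring.\<close>

lemma monoid_ring_eqI:
  assumes "f \<in> carrier (monoid_ring M)" "g \<in> carrier (monoid_ring M)"
    "\<And>\<phi>. pairing f \<phi> = pairing g \<phi>"
  shows "f = g"
proof
  fix m show "f m = g m"
    using assms(3)[of "delta m"] assms(1,2) by (simp add: pairing_delta_right monoid_ring_carrier)
qed

context monoid
begin

text \<open>Everything is a sum over the finite rectangle of the two supports. The convolution
  groups its points by the fibres of the multiplication, and \<open>sum.group\<close> undoes this
  grouping.\<close>

lemma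
  assumes "f \<in> carrier (monoid_ring G)" "g \<in> carrier (monoid_ring G)"
  shows monoid_ring_mult_closed: "f \<otimes>\<^bsub>monoid_ring G\<^esub> g \<in> carrier (monoid_ring G)"
    and pairing_mult: "pairing (f \<otimes>\<^bsub>monoid_ring G\<^esub> g) \<phi> = pairing f (\<lambda>a. pairing g (\<lambda>b. \<phi> (a \<otimes> b)))"
proof -
  let ?S = "{a. f a \<noteq> 0} \<times> {b. g b \<noteq> 0}"
  let ?m = "\<lambda>(a, b). a \<otimes> b"
  have S: "finite ?S" "?m ` ?S \<subseteq> carrier G"
    using assms by (auto simp: monoid_ring_carrier)
  have val: "(f \<otimes>\<^bsub>monoid_ring G\<^esub> g) x = (\<Sum>s\<in>{s \<in> ?S. ?m s = x}. f (fst s) * g (snd s))" for x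
    unfolding monoid_ring_def by (auto simp: case_prod_unfold intro!: sum.cong)
  have supp: "{x. (f \<otimes>\<^bsub>monoid_ring G\<^esub> g) x \<noteq> 0} \<subseteq> ?m ` ?S"
  proof
    fix x assume "x \<in> {x. (f \<otimes>\<^bsub>monoid_ring G\<^esub> g) x \<noteq> 0}"
    then have "(\<Sum>s\<in>{s \<in> ?S. ?m s = x}. f (fst s) * g (snd s)) \<noteq> 0"
      unfolding mem_Collect_eq val .
    then obtain s where "s \<in> {s \<in> ?S. ?m s = x}"
      by (rule sum.not_neutral_contains_not_neutral)
    then show "x \<in> ?m ` ?S" by blast
  qed
  then show "f \<otimes>\<^bsub>monoid_ring G\<^esub> g \<in> carrier (monoid_ring G)"
    using S finite_subset[OF supp] unfolding monoid_ring_carrier by blast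
  have "pairing (f \<otimes>\<^bsub>monoid_ring G\<^esub> g) \<phi> = (\<Sum>x\<in>?m ` ?S. (f \<otimes>\<^bsub>monoid_ring G\<^esub> g) x * \<phi> x)"
    using S supp by (intro pairing_eq) auto
  also have "\<dots> = (\<Sum>x\<in>?m ` ?S. \<Sum>s\<in>{s \<in> ?S. ?m s = x}. f (fst s) * g (snd s) * \<phi> (?m s))"
    by (intro sum.cong HOL.refl) (simp only: val sum_distrib_right, rule sum.cong, auto)
  also have "\<dots> = (\<Sum>s\<in>?S. f (fst s) * g (snd s) * \<phi> (?m s))"
    using S(1) by (intro sum.group) auto
  also have "\<dots> = pairing f (\<lambda>a. pairing g (\<lambda>b. \<phi> (a \<otimes> b)))"
    unfolding pairing_def sum_distrib_left by (simp add: sum.cartesian_product case_prod_unfold mult.assoc)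
  finally show "pairing (f \<otimes>\<^bsub>monoid_ring G\<^esub> g) \<phi> = pairing f (\<lambda>a. pairing g (\<lambda>b. \<phi> (a \<otimes> b)))" .
qed

lemma delta_mult:
  assumes "a \<in> carrier G" "b \<in> carrier G"
  shows "delta a \<otimes>\<^bsub>monoid_ring G\<^esub> delta b = (delta (a \<otimes> b) :: 'a \<Rightarrow> 'k::field)"
  using assms by (intro monoid_ring_eqI[of _ G]) (auto simp: monoid_ring_mult_closed pairing_mult)

end

text \<open>After pairing with a test function, each multiplicative law becomes the same law of the
  monoid inside the argument of that function; commutativity also needs the exchange of the two
  summations.\<close>

lemma (in comm_monoid) cring_monoid_ring: "cring (monoid_ring G :: ('a \<Rightarrow> 'k::field) ring)"
proof (rule cringI)
  let ?R = "monoid_ring G :: ('a \<Rightarrow> 'k) ring"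
  have add: "f \<oplus>\<^bsub>?R\<^esub> g \<in> carrier ?R" if "f \<in> carrier ?R" "g \<in> carrier ?R" for f g
  proof -
    have "{x. (f \<oplus>\<^bsub>?R\<^esub> g) x \<noteq> 0} \<subseteq> {x. f x \<noteq> 0} \<union> {x. g x \<noteq> 0}"
      by (auto simp: monoid_ring_simps)
    then show ?thesis
      using that finite_subset unfolding monoid_ring_carrier by blast
  qed
  show "abelian_group ?R"
  proof (rule abelian_groupI)
    fix f assume f: "f \<in> carrier ?R"
    then have "(\<lambda>x. - f x) \<in> carrier ?R" by (simp add: monoid_ring_carrier)
    then show "\<exists>g\<in>carrier ?R. g \<oplus>\<^bsub>?R\<^esub> f = \<zero>\<^bsub>?R\<^esub>"
      by (intro bexI[of _ "\<lambda>x. - f x"]) (auto simp: monoid_ring_simps)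
  qed (use add in \<open>auto simp: monoid_ring_simps add_ac\<close>, simp add: monoid_ring_carrier)
  have add_pair: "pairing (f \<oplus>\<^bsub>?R\<^esub> g) \<phi> = pairing f \<phi> + pairing g \<phi>"
    if "f \<in> carrier ?R" "g \<in> carrier ?R" for f g \<phi>
    using that by (simp add: monoid_ring_simps monoid_ring_carrier pairing_add_left)
  note mult = monoid_ring_mult_closed
  show "comm_monoid ?R"
  proof (rule comm_monoidI)
    fix f g h assume f: "f \<in> carrier ?R" and g: "g \<in> carrier ?R" and h: "h \<in> carrier ?R"
    show "f \<otimes>\<^bsub>?R\<^esub> g \<in> carrier ?R" using f g by (rule mult)
    show "f \<otimes>\<^bsub>?R\<^esub> g \<otimes>\<^bsub>?R\<^esub> h = f \<otimes>\<^bsub>?R\<^esub> (g \<otimes>\<^bsub>?R\<^esub> h)"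
    proof (rule monoid_ring_eqI[of _ G])
      fix \<phi> :: "'a \<Rightarrow> 'k"
      show "pairing (f \<otimes>\<^bsub>?R\<^esub> g \<otimes>\<^bsub>?R\<^esub> h) \<phi> = pairing (f \<otimes>\<^bsub>?R\<^esub> (g \<otimes>\<^bsub>?R\<^esub> h)) \<phi>"
        using f g h by (simp add: pairing_mult mult)
          (intro pairing_cong[of _ G], auto simp: m_assoc)
    qed (use f g h mult in auto)
    show "f \<otimes>\<^bsub>?R\<^esub> g = g \<otimes>\<^bsub>?R\<^esub> f"
    proof (rule monoid_ring_eqI[of _ G])
      fix \<phi> :: "'a \<Rightarrow> 'k"
      show "pairing (f \<otimes>\<^bsub>?R\<^esub> g) \<phi> = pairing (g \<otimes>\<^bsub>?R\<^esub> f) \<phi>"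
        using f g by (simp add: pairing_mult pairing_swap[of f G g])
          (intro pairing_cong[of _ G], auto simp: m_comm)
    qed (use f g mult in auto)
    show "\<one>\<^bsub>?R\<^esub> \<otimes>\<^bsub>?R\<^esub> f = f"
    proof (rule monoid_ring_eqI[of _ G])
      fix \<phi> :: "'a \<Rightarrow> 'k"
      show "pairing (\<one>\<^bsub>?R\<^esub> \<otimes>\<^bsub>?R\<^esub> f) \<phi> = pairing f \<phi>"
        using f by (simp add: monoid_ring_simps pairing_mult)
          (intro pairing_cong[of _ G], auto)
    qed (use f mult[of "delta \<one>" f] in \<open>auto simp: monoid_ring_simps\<close>)
  qed (simp add: monoid_ring_simps)
  fix f g h assume f: "f \<in> carrier ?R" and g: "g \<in> carrier ?R" and h: "h \<in> carrier ?R"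
  show "(f \<oplus>\<^bsub>?R\<^esub> g) \<otimes>\<^bsub>?R\<^esub> h = f \<otimes>\<^bsub>?R\<^esub> h \<oplus>\<^bsub>?R\<^esub> g \<otimes>\<^bsub>?R\<^esub> h"
    using f g h by (intro monoid_ring_eqI[of _ G]) (auto simp: mult add pairing_mult add_pair)
qed

text \<open>Linear combinations are traded for a condition on supports, from which membership of
  \<open>delta m\<close> and the effect of \<open>restr\<close> are immediate.\<close>

lemma lin_span_eq: "lin_span S = {f. finite {m. f m \<noteq> 0} \<and> {m. f m \<noteq> 0} \<subseteq> S}"
proof (intro subset_antisym subsetI)
  fix f :: "'a \<Rightarrow> 'b::field" assume "f \<in> lin_span S"
  then obtain A c where A: "finite A" "A \<subseteq> S" "f = (\<lambda>x. \<Sum>m\<in>A. c m * delta m x)"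
    by (auto simp: lin_span_def)
  have "f x = 0" if "x \<notin> A" for x
    using that unfolding A(3) by (intro sum.neutral) (auto simp: delta_def)
  then have "{m. f m \<noteq> 0} \<subseteq> A" by blast
  then show "f \<in> {f. finite {m. f m \<noteq> 0} \<and> {m. f m \<noteq> 0} \<subseteq> S}"
    using A(1,2) finite_subset by blast
next
  fix f :: "'a \<Rightarrow> 'b::field" assume f: "f \<in> {f. finite {m. f m \<noteq> 0} \<and> {m. f m \<noteq> 0} \<subseteq> S}"
  have "f x = (\<Sum>m | f m \<noteq> 0. f m * delta m x)" for x
  proof -
    have "(\<Sum>m | f m \<noteq> 0. f m * delta m x) = pairing f (delta x)"
      unfolding pairing_def delta_def by (intro sum.cong) auto
    then show ?thesis using f by (simp add: pairing_delta_right)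
  qed
  then show "f \<in> lin_span S"
    using f unfolding lin_span_def by blast
qed

lemma monoid_ring_eq_lin_span: "carrier (monoid_ring M) = lin_span (carrier M)"
  by (auto simp: lin_span_eq monoid_ring_carrier)

lemma delta_in_lin_span [simp]: "(delta m :: _ \<Rightarrow> 'k::field) \<in> lin_span S \<longleftrightarrow> m \<in> S"
  by (auto simp: lin_span_eq delta_def)

lemma zero_in_lin_span [simp]: "(\<lambda>x. 0) \<in> lin_span S"
  by (simp add: lin_span_eq)

lemma (in comm_monoid) lin_span_subset_ideal_iff:
  assumes p: "ideal p (monoid_ring G :: ('a \<Rightarrow> 'k::field) ring)" and S: "S \<subseteq> carrier G"
  shows "lin_span S \<subseteq> p \<longleftrightarrow> (\<forall>m\<in>S. delta m \<in> p)"
proof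
  let ?R = "monoid_ring G :: ('a \<Rightarrow> 'k) ring"
  interpret p: ideal p ?R by (rule p)
  show "\<forall>m\<in>S. delta m \<in> p" if "lin_span S \<subseteq> p"
    using that by auto
  assume del: "\<forall>m\<in>S. delta m \<in> p"
  show "lin_span S \<subseteq> p"
  proof
    fix f :: "'a \<Rightarrow> 'k" assume "f \<in> lin_span S"
    then obtain A and c :: "'a \<Rightarrow> 'k" where A: "finite A" "A \<subseteq> S" "f = (\<lambda>x. \<Sum>m\<in>A. c m * delta m x)"
      by (auto simp: lin_span_def)
    have "(\<lambda>x. \<Sum>m\<in>A. c m * delta m x) \<in> p"
      using A(1,2)
    proof (induction rule: finite_induct)
      case empty
      then show ?case using additive_subgroup.zero_closed[OF p.additive_subgroup_axioms] by (simp add: monoid_ring_simps)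
    next
      case (insert m A)
      \<comment> \<open>An ideal is closed under multiplication by ring elements, not by scalars, so
        the coefficient \<open>c m\<close> is realised as the ring element concentrated at the
        identity.\<close>
      define s :: "'a \<Rightarrow> 'k" where "s = (\<lambda>x. c m * delta \<one> x)"
      have s: "s \<in> carrier ?R"
        by (auto simp: s_def monoid_ring_carrier delta_def split: if_splits)
      have m: "m \<in> carrier G" using insert.prems S by auto
      have "(\<lambda>x. c m * delta m x) = s \<otimes>\<^bsub>?R\<^esub> delta m"
      proof (rule monoid_ring_eqI[of _ G])
        show "(\<lambda>x. c m * delta m x) \<in> carrier ?R"
          using m by (auto simp: monoid_ring_carrier delta_def split: if_splits)
        have "pairing (\<lambda>x. c m * delta m x) \<phi> = c m * \<phi> m" for \<phi> :: "'a \<Rightarrow> 'k"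
          by (subst pairing_eq[of "{m}"]) (auto simp: delta_def)
        moreover have "pairing s \<phi> = c m * \<phi> \<one>" for \<phi> :: "'a \<Rightarrow> 'k"
          by (subst pairing_eq[of "{\<one>}"]) (auto simp: delta_def s_def)
        ultimately show "pairing (\<lambda>x. c m * delta m x) \<phi> = pairing (s \<otimes>\<^bsub>?R\<^esub> delta m) \<phi>" for \<phi>
          using m s by (simp add: pairing_mult)
      qed (use m s monoid_ring_mult_closed in auto)
      also have "\<dots> \<in> p"
        using insert.prems del s by (intro p.I_l_closed) auto
      finally have "(\<lambda>x. c m * delta m x) \<oplus>\<^bsub>?R\<^esub> (\<lambda>x. \<Sum>m\<in>A. c m * delta m x) \<in> p"
        using insert by (intro additive_subgroup.a_closed[OF p.additive_subgroup_axioms]) auto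
      then show ?case
        using insert.hyps by (simp add: monoid_ring_simps)
    qed
    then show "f \<in> p" by (simp add: A(3))
  qed
qed

subsection \<open>Restriction to a face\<close>

text \<open>A face is a submonoid that is closed under factors; its complement is a prime ideal of
  the monoid. This is what makes the projection \<open>restr\<close>, which kills all basis elements
  outside N, multiplicative.\<close>

definition face :: "('m, 'b) monoid_scheme \<Rightarrow> 'm set \<Rightarrow> bool"
  where "face M N \<longleftrightarrow> N \<subseteq> carrier M \<and> \<one>\<^bsub>M\<^esub> \<in> N \<and>
    (\<forall>a\<in>carrier M. \<forall>b\<in>carrier M. a \<otimes>\<^bsub>M\<^esub> b \<in> N \<longleftrightarrow> a \<in> N \<and> b \<in> N)"

definition restr :: "'m set \<Rightarrow> ('m \<Rightarrow> 'k::field) \<Rightarrow> 'm \<Rightarrow> 'k"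
  where "restr N f = (\<lambda>x. if x \<in> N then f x else 0)"

lemma restr_closed: "f \<in> carrier (monoid_ring M) \<Longrightarrow> restr N f \<in> carrier (monoid_ring M)"
  by (auto simp: monoid_ring_carrier restr_def split: if_splits elim: rev_finite_subset)

lemma pairing_restr:
  assumes "finite {a. f a \<noteq> 0}"
  shows "pairing (restr N f) \<phi> = pairing f (\<lambda>a. if a \<in> N then \<phi> a else 0)"
  by (subst (1 2) pairing_eq[OF assms]) (auto simp: restr_def intro!: sum.cong)

lemma pairing_zero_right [simp]: "pairing f (\<lambda>a. 0) = 0"
  by (simp add: pairing_def)

text \<open>On a face, the test whether a product lies in N separates into one test for each factor,
  and each test can be absorbed into the restriction of that factor.\<close>

lemma (in comm_monoid) restr_mult:
  fixes f g :: "'a \<Rightarrow> 'k::field"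
  assumes "face G N" and fg: "f \<in> carrier (monoid_ring G)" "g \<in> carrier (monoid_ring G)"
  shows "restr N (f \<otimes>\<^bsub>monoid_ring G\<^esub> g) = restr N f \<otimes>\<^bsub>monoid_ring G\<^esub> restr N g"
proof (rule monoid_ring_eqI[of _ G])
  fix \<phi> :: "'a \<Rightarrow> 'k"
  note fin = fg[unfolded monoid_ring_carrier, THEN conjunct1]
  have fin': "finite {x. (f \<otimes>\<^bsub>monoid_ring G\<^esub> g) x \<noteq> 0}"
    using monoid_ring_mult_closed[OF fg] by (simp add: monoid_ring_carrier)
  have "pairing (restr N (f \<otimes>\<^bsub>monoid_ring G\<^esub> g)) \<phi>
      = pairing f (\<lambda>a. pairing g (\<lambda>b. if a \<otimes> b \<in> N then \<phi> (a \<otimes> b) else 0))"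
    by (simp add: pairing_restr[OF fin'] pairing_mult[OF fg])
  also have "\<dots> = pairing f (\<lambda>a. if a \<in> N then pairing g (\<lambda>b. if b \<in> N then \<phi> (a \<otimes> b) else 0) else 0)"
  proof (rule pairing_cong[OF fg(1)])
    fix a assume a: "a \<in> carrier G"
    have "pairing g (\<lambda>b. if a \<otimes> b \<in> N then \<phi> (a \<otimes> b) else 0)
        = pairing g (\<lambda>b. if a \<in> N then if b \<in> N then \<phi> (a \<otimes> b) else 0 else 0)"
      using assms(1) a by (intro pairing_cong[OF fg(2)]) (auto simp: face_def)
    then show "pairing g (\<lambda>b. if a \<otimes> b \<in> N then \<phi> (a \<otimes> b) else 0)
        = (if a \<in> N then pairing g (\<lambda>b. if b \<in> N then \<phi> (a \<otimes> b) else 0) else 0)"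
      by simp
  qed
  also have "\<dots> = pairing (restr N f \<otimes>\<^bsub>monoid_ring G\<^esub> restr N g) \<phi>"
    using fg by (simp add: pairing_mult restr_closed pairing_restr[OF fin(1)] pairing_restr[OF fin(2)])
  finally show "pairing (restr N (f \<otimes>\<^bsub>monoid_ring G\<^esub> g)) \<phi>
      = pairing (restr N f \<otimes>\<^bsub>monoid_ring G\<^esub> restr N g) \<phi>" .
qed (use fg in \<open>simp_all add: restr_closed monoid_ring_mult_closed\<close>)

text \<open>This is the preimage of p under the ring endomorphism \<open>restr N\<close>, which
  fixes the unit because the identity lies in N. In contrast to p, it contains every basis element
  outside N, since these are sent to zero.\<close>

lemma (in comm_monoid) primeideal_restr:
  assumes N: "face G N" and p: "primeideal p (monoid_ring G :: ('a \<Rightarrow> 'k::field) ring)"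
  shows "primeideal {f \<in> carrier (monoid_ring G). restr N f \<in> p} (monoid_ring G)"
proof -
  interpret R: cring "monoid_ring G :: ('a \<Rightarrow> 'k) ring" by (rule cring_monoid_ring)
  have "restr N (\<one>\<^bsub>monoid_ring G\<^esub>) = (\<one>\<^bsub>monoid_ring G\<^esub> :: 'a \<Rightarrow> 'k)"
    using N by (auto simp: restr_def monoid_ring_simps delta_def face_def)
  then have "ring_hom_ring (monoid_ring G) (monoid_ring G) (restr N :: ('a \<Rightarrow> 'k) \<Rightarrow> 'a \<Rightarrow> 'k)"
    using restr_mult[OF N] restr_closed
    by (intro ring_hom_ringI R.ring_axioms) (auto simp: restr_def monoid_ring_simps)
  then show ?thesis
    by (rule ring_hom_ring.primeideal_vimage) (use R.is_cring p in auto)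
qed

text \<open>If no two nontrivial elements of the monoid are inverse to each other, \<open>f \<mapsto> f 1\<close> is a ring
  homomorphism onto the field of coefficients.\<close>

lemma (in comm_monoid) augmentation_ideal:
  assumes N: "face G {\<one>}"
  shows "Idl\<^bsub>monoid_ring G\<^esub> (delta ` (carrier G - {\<one>})) = {f \<in> carrier (monoid_ring G :: ('a \<Rightarrow> 'k::field) ring). f \<one> = 0}"
    and "primeideal {f \<in> carrier (monoid_ring G :: ('a \<Rightarrow> 'k) ring). f \<one> = 0} (monoid_ring G)"
    and "\<And>p. \<lbrakk>primeideal p (monoid_ring G :: ('a \<Rightarrow> 'k) ring); \<forall>m\<in>carrier G - {\<one>}. delta m \<in> p\<rbrakk>
      \<Longrightarrow> p = {f \<in> carrier (monoid_ring G). f \<one> = 0}"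
proof -
  let ?R = "monoid_ring G :: ('a \<Rightarrow> 'k) ring"
  interpret R: cring ?R by (rule cring_monoid_ring)
  let ?I = "{f \<in> carrier ?R. f \<one> = 0}"
  have mult: "(f \<otimes>\<^bsub>?R\<^esub> g) \<one> = f \<one> * g \<one>" if "f \<in> carrier ?R" "g \<in> carrier ?R" for f g
  proof -
    have fin: "finite {x. h x \<noteq> 0}" if "h \<in> carrier ?R" for h
      using that by (simp add: monoid_ring_carrier)
    have "(f \<otimes>\<^bsub>?R\<^esub> g) \<one> = pairing f (\<lambda>a. pairing g (\<lambda>b. delta \<one> (a \<otimes> b)))"
      using that by (simp flip: pairing_mult add: pairing_delta_right fin)
    also have "\<dots> = pairing f (\<lambda>a. if a = \<one> then pairing g (\<lambda>b. delta \<one> b) else 0)"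
    proof (rule pairing_cong[OF that(1)])
      fix a assume a: "a \<in> carrier G"
      have "pairing g (\<lambda>b. delta \<one> (a \<otimes> b)) = pairing g (\<lambda>b. if a = \<one> then delta \<one> b else 0)"
        using N a by (intro pairing_cong[OF that(2)]) (auto simp: delta_def face_def)
      then show "pairing g (\<lambda>b. delta \<one> (a \<otimes> b)) = (if a = \<one> then pairing g (\<lambda>b. delta \<one> b) else 0)"
        by simp
    qed
    also have "\<dots> = pairing f (\<lambda>a. delta \<one> a * g \<one>)"
      using pairing_delta_right[OF fin[OF that(2)], of \<one>]
      by (intro pairing_cong[OF that(1)]) (simp add: delta_def)
    also have "\<dots> = pairing f (delta \<one>) * g \<one>"
      by (simp add: pairing_def sum_distrib_right mult.assoc)
    finally show ?thesis using that(1) by (simp add: pairing_delta_right fin)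
  qed
  have I: "ideal ?I ?R"
  proof (intro idealI R.ring_axioms)
    show "subgroup ?I (add_monoid ?R)"
    proof (rule R.add.subgroupI)
      fix f assume "f \<in> ?I"
      then have f: "f \<in> carrier ?R" "f \<one> = 0" by auto
      then have "(\<ominus>\<^bsub>?R\<^esub> f \<oplus>\<^bsub>?R\<^esub> f) \<one> = 0"
        by (simp only: R.l_neg) (simp add: monoid_ring_simps)
      then show "\<ominus>\<^bsub>?R\<^esub> f \<in> ?I"
        using f by (simp add: monoid_ring_simps)
    next
      show "?I \<noteq> {}"
        using R.zero_closed by (auto simp: monoid_ring_simps)
    next
      fix f g assume "f \<in> ?I" "g \<in> ?I"
      then show "f \<oplus>\<^bsub>?R\<^esub> g \<in> ?I"
        using R.a_closed[of f g] by (simp add: monoid_ring_simps)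
    qed auto
  qed (auto simp: mult)
  show prime: "primeideal ?I ?R"
  proof (rule primeidealI[OF I R.is_cring])
    have "\<one>\<^bsub>?R\<^esub> \<notin> ?I" by (simp add: monoid_ring_simps delta_def)
    then show "carrier ?R \<noteq> ?I" using R.one_closed by blast
  qed (auto simp: mult)
  have span: "?I = lin_span (carrier G - {\<one>})"
    by (auto simp: lin_span_eq monoid_ring_carrier)
  have sub: "delta ` (carrier G - {\<one>}) \<subseteq> carrier ?R" by auto
  show "Idl\<^bsub>?R\<^esub> (delta ` (carrier G - {\<one>})) = ?I"
  proof
    show "Idl\<^bsub>?R\<^esub> (delta ` (carrier G - {\<one>})) \<subseteq> ?I"
      by (rule R.genideal_minimal[OF I]) (auto simp: fun_cong[OF delta_def])
    show "?I \<subseteq> Idl\<^bsub>?R\<^esub> (delta ` (carrier G - {\<one>}))"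
      unfolding span using R.genideal_self[OF sub]
      by (subst lin_span_subset_ideal_iff[OF R.genideal_ideal[OF sub]]) auto
  qed
  fix p assume p: "primeideal p ?R" and del: "\<forall>m\<in>carrier G - {\<one>}. delta m \<in> p"
  interpret p: primeideal p ?R by (rule p)
  have sub: "?I \<subseteq> p"
    unfolding span using del by (subst lin_span_subset_ideal_iff[OF p.is_ideal]) auto
  moreover have "f \<one> = 0" if f: "f \<in> p" for f
  proof (rule ccontr)
    assume ne: "f \<one> \<noteq> 0"
    have fc: "f \<in> carrier ?R" using f p.a_subset by blast
    \<comment> \<open>Coefficients form a field, so f can be scaled to have coefficient 1 at the
      identity. Then \<open>\<one> \<ominus> ?g\<close> has coefficient 0 there and lies in p
      together with \<open>?g\<close>, which puts the unit into p.\<close>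
    define s :: "'a \<Rightarrow> 'k" where "s = (\<lambda>x. inverse (f \<one>) * delta \<one> x)"
    have s: "s \<in> carrier ?R"
      by (auto simp: s_def monoid_ring_carrier delta_def split: if_splits)
    let ?g = "s \<otimes>\<^bsub>?R\<^esub> f"
    have gp: "?g \<in> p" using f s by (rule p.I_l_closed)
    have "\<one>\<^bsub>?R\<^esub> \<ominus>\<^bsub>?R\<^esub> ?g \<in> carrier ?R" using s fc by simp
    moreover have "(\<one>\<^bsub>?R\<^esub> \<ominus>\<^bsub>?R\<^esub> ?g \<oplus>\<^bsub>?R\<^esub> ?g) \<one> = 1"
    proof -
      have "\<one>\<^bsub>?R\<^esub> \<ominus>\<^bsub>?R\<^esub> ?g \<oplus>\<^bsub>?R\<^esub> ?g = \<one>\<^bsub>?R\<^esub>"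
        using s fc by (simp add: R.minus_eq R.a_assoc R.l_neg)
      then show ?thesis by (simp add: monoid_ring_simps delta_def)
    qed
    then have "(\<one>\<^bsub>?R\<^esub> \<ominus>\<^bsub>?R\<^esub> ?g) \<one> = 0"
      using ne by (simp add: monoid_ring_simps mult[OF s fc]) (simp add: s_def delta_def)
    ultimately have "\<one>\<^bsub>?R\<^esub> \<ominus>\<^bsub>?R\<^esub> ?g \<in> p" using sub by blast
    then have "\<one>\<^bsub>?R\<^esub> \<ominus>\<^bsub>?R\<^esub> ?g \<oplus>\<^bsub>?R\<^esub> ?g \<in> p" using gp by (rule additive_subgroup.a_closed[OF p.additive_subgroup_axioms])
    then have "\<one>\<^bsub>?R\<^esub> \<in> p"
      using s fc by (simp add: R.minus_eq R.a_assoc R.l_neg)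
    then show False using p.one_imp_carrier p.I_notcarr by blast
  qed
  ultimately show "p = ?I" using p.a_subset by blast
qed

section \<open>Hurwitz orbits\<close>

lemma hurwitz_letter_length [simp]: "length (hurwitz_letter G a g) = length g"
  by (cases "(G, a, g)" rule: hurwitz_letter.cases) auto

lemma hurwitz_word_length [simp]: "length (hurwitz_word G w g) = length g"
  by (induction w) (auto simp: hurwitz_word_def)

lemma hurwitz_letter_split:
  assumes "length xs = i"
  shows "hurwitz_letter G (i, True) (xs @ a # b # ys) = xs @ (a \<otimes>\<^bsub>G\<^esub> b \<otimes>\<^bsub>G\<^esub> inv\<^bsub>G\<^esub> a) # a # ys"
    and "hurwitz_letter G (i, False) (xs @ a # b # ys) = xs @ b # (inv\<^bsub>G\<^esub> b \<otimes>\<^bsub>G\<^esub> a \<otimes>\<^bsub>G\<^esub> b) # ys"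
  using assms by (auto simp: nth_append list_update_append)

lemma hurwitz_word_append_right:
  assumes "w \<in> braid_words (length g)"
  shows "hurwitz_word G w (g @ h) = hurwitz_word G w g @ h"
  using assms
proof (induction w)
  case (Cons a w)
  obtain i b where a: "a = (i, b)" by force
  have w: "w \<in> braid_words (length g)" and i: "Suc i < length (hurwitz_word G w g)"
    using Cons.prems by (auto simp: braid_words_def a)
  have "hurwitz_letter G (i, b) (k @ h) = hurwitz_letter G (i, b) k @ h" if "Suc i < length k" for k
    using that by (cases b) (auto simp: nth_append list_update_append)
  from this[OF i] Cons.IH[OF w] show ?case
    by (simp add: hurwitz_word_def a del: hurwitz_letter.simps)
qed (simp add: hurwitz_word_def)

lemma hurwitz_word_append_left:
  assumes "w \<in> braid_words (length g)"
  shows "hurwitz_word G (map (\<lambda>(i, b). (length h + i, b)) w) (h @ g) = h @ hurwitz_word G w g"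
  using assms
proof (induction w)
  case (Cons a w)
  obtain i b where a: "a = (i, b)" by force
  have w: "w \<in> braid_words (length g)" and i: "Suc i < length (hurwitz_word G w g)"
    using Cons.prems by (auto simp: braid_words_def a)
  have "hurwitz_letter G (length h + i, b) (h @ k) = h @ hurwitz_letter G (i, b) k"
    if "Suc i < length k" for k
    using that by (cases b) (auto simp: nth_append list_update_append)
  from this[OF i] Cons.IH[OF w] show ?case
    by (simp add: hurwitz_word_def a del: hurwitz_letter.simps)
qed (simp add: hurwitz_word_def)

lemma tuple_prod_Nil [simp]: "tuple_prod G [] = \<one>\<^bsub>G\<^esub>"
  and tuple_prod_Cons [simp]: "tuple_prod G (x # xs) = x \<otimes>\<^bsub>G\<^esub> tuple_prod G xs"
  by (simp_all add: tuple_prod_def)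

context Group.group
begin

lemma inv_cancel_left:
  assumes "a \<in> carrier G" "b \<in> carrier G"
  shows "a \<otimes> (inv a \<otimes> b) = b" and "inv a \<otimes> (a \<otimes> b) = b"
  using assms by (simp_all flip: m_assoc)

lemma tuple_prod_closed [simp]: "set xs \<subseteq> carrier G \<Longrightarrow> tuple_prod G xs \<in> carrier G"
  by (induction xs) auto

lemma tuple_prod_append:
  "set xs \<subseteq> carrier G \<Longrightarrow> set ys \<subseteq> carrier G \<Longrightarrow>
    tuple_prod G (xs @ ys) = tuple_prod G xs \<otimes> tuple_prod G ys"
  by (induction xs) (auto simp: m_assoc)

text \<open>All words representing a braid act alike, so orbits can be explored letter by letter
  instead of through classes of words.\<close>

lemma mem_hurwitz_orbit:
  assumes "set g \<subseteq> carrier G"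
  shows "h \<in> hurwitz_orbit G g \<longleftrightarrow> (\<exists>w\<in>braid_words (length g). h = hurwitz_word G w g)"
proof -
  have g: "g \<in> tuples G (length g)" using assms by (simp add: tuples_def)
  show ?thesis
  proof
    assume "h \<in> hurwitz_orbit G g"
    then obtain P where "P \<in> carrier (braid_group (length g))" "h = hurwitz_action G (length g) P g"
      by (auto simp: hurwitz_orbit_def orbit_def)
    then show "\<exists>w\<in>braid_words (length g). h = hurwitz_word G w g"
      using hurwitz_action_class[OF _ g] by (auto elim!: braid_carrierE)
  next
    assume "\<exists>w\<in>braid_words (length g). h = hurwitz_word G w g"
    then show "h \<in> hurwitz_orbit G g"
      using hurwitz_action_class[OF _ g] braid_carrierI
      unfolding hurwitz_orbit_def orbit_def by (metis (mono_tags, lifting) mem_Collect_eq)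
  qed
qed

lemma hurwitz_orbit_in_carrier:
  assumes "set g \<subseteq> carrier G" "h \<in> hurwitz_orbit G g"
  shows "set h \<subseteq> carrier G" "length h = length g"
  using assms hurwitz_word_tuples[of _ "length g" g]
  by (auto simp: mem_hurwitz_orbit tuples_def)

lemma hurwitz_orbit_refl:
  assumes "set g \<subseteq> carrier G"
  shows "g \<in> hurwitz_orbit G g"
  using assms
  by (auto simp: mem_hurwitz_orbit intro!: bexI[of _ "[]"]) (auto simp: hurwitz_word_def braid_words_def)

text \<open>The number of strands in \<open>hurwitz_orbit\<close> is taken from its argument, so
  symmetry and transitivity of orbits apply only once the lengths of g and h are known to
  agree.\<close>

lemma hurwitz_orbit_eq:
  assumes g: "set g \<subseteq> carrier G" and h: "h \<in> hurwitz_orbit G g"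
  shows "hurwitz_orbit G h = hurwitz_orbit G g"
proof -
  let ?n = "length g"
  interpret A: group_action "braid_group ?n" "tuples G ?n" "hurwitz_action G ?n"
    by (rule group_action_hurwitz)
  note hc = hurwitz_orbit_in_carrier[OF g h]
  have gh: "g \<in> tuples G ?n" "h \<in> tuples G ?n"
    using g hc by (simp_all add: tuples_def)
  have h': "h \<in> orbit (braid_group ?n) (hurwitz_action G ?n) g"
    using h by (simp add: hurwitz_orbit_def)
  have g': "g \<in> orbit (braid_group ?n) (hurwitz_action G ?n) h"
    using A.orbit_sym[OF gh h'] .
  have tup: "k \<in> tuples G ?n" if "k \<in> hurwitz_orbit G g \<or> k \<in> hurwitz_orbit G h" for k
    using that hurwitz_orbit_in_carrier[OF g] hurwitz_orbit_in_carrier[OF hc(1)] hc(2)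
    by (auto simp: tuples_def)
  show ?thesis
    using A.orbit_trans[OF gh _ h'] A.orbit_trans[OF gh(2,1) _ g'] tup hc(2)
    unfolding hurwitz_orbit_def by auto
qed

lemma hurwitz_orbit_trans:
  assumes "set f \<subseteq> carrier G" "g \<in> hurwitz_orbit G f" "h \<in> hurwitz_orbit G g"
  shows "h \<in> hurwitz_orbit G f"
  using hurwitz_orbit_eq[OF assms(1,2)] assms(3) by simp

text \<open>Braids on the first and on the second block of strands are braids on all strands, the
  latter with letters shifted by the length of the first block; the two blocks are treated one after
  the other.\<close>

lemma hurwitz_orbit_append:
  assumes "set g \<subseteq> carrier G" "set h \<subseteq> carrier G"
    "g' \<in> hurwitz_orbit G g" "h' \<in> hurwitz_orbit G h"
  shows "g' @ h' \<in> hurwitz_orbit G (g @ h)"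
proof -
  have bw: "braid_words n \<subseteq> braid_words (n + m)" for n m
    by (auto simp: braid_words_def lists_eq_set)
  have gc: "set g' \<subseteq> carrier G" using hurwitz_orbit_in_carrier assms by blast
  obtain v where v: "v \<in> braid_words (length g)" "g' = hurwitz_word G v g"
    using assms mem_hurwitz_orbit by blast
  have 1: "g' @ h \<in> hurwitz_orbit G (g @ h)"
    using assms v bw[of "length g" "length h"]
    by (auto simp: mem_hurwitz_orbit hurwitz_word_append_right[OF v(1)] intro!: bexI[of _ v])
  obtain w where w: "w \<in> braid_words (length h)" "h' = hurwitz_word G w h"
    using assms mem_hurwitz_orbit by blast
  have "map (\<lambda>(i, b). (length g' + i, b)) w \<in> braid_words (length g' + length h)"
    using w(1) by (auto simp: braid_words_def lists_eq_set)
  then have "g' @ h' \<in> hurwitz_orbit G (g' @ h)"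
    using assms gc hurwitz_word_append_left[OF w(1), of G g']
    by (auto simp: mem_hurwitz_orbit w(2) intro!: bexI[of _ "map (\<lambda>(i, b). (length g' + i, b)) w"])
  then show ?thesis
    using 1 hurwitz_orbit_trans assms by simp
qed

text \<open>A letter touches two neighbouring entries only, so an invariant of the action has to be
  checked on \<open>xs @ a # b # ys\<close> for a generator and for its inverse.\<close>

lemma hurwitz_orbit_induct [consumes 2, case_names base True False]:
  assumes "set g \<subseteq> carrier G" "h \<in> hurwitz_orbit G g" "P g"
    and "\<And>xs a b ys. \<lbrakk>set xs \<subseteq> carrier G; set ys \<subseteq> carrier G; a \<in> carrier G; b \<in> carrier G;
      P (xs @ a # b # ys)\<rbrakk> \<Longrightarrow> P (xs @ (a \<otimes> b \<otimes> inv a) # a # ys)"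
    and "\<And>xs a b ys. \<lbrakk>set xs \<subseteq> carrier G; set ys \<subseteq> carrier G; a \<in> carrier G; b \<in> carrier G;
      P (xs @ a # b # ys)\<rbrakk> \<Longrightarrow> P (xs @ b # (inv b \<otimes> a \<otimes> b) # ys)"
  shows "P h"
proof -
  obtain w where w: "w \<in> braid_words (length g)" "h = hurwitz_word G w g"
    using assms(1,2) mem_hurwitz_orbit by blast
  have "P (hurwitz_word G w g)"
    using w(1)
  proof (induction w)
    case Nil
    then show ?case using assms(3) by (simp add: hurwitz_word_def)
  next
    case (Cons c w)
    obtain i e where c: "c = (i, e)" by force
    let ?k = "hurwitz_word G w g"
    have w: "w \<in> braid_words (length g)" and i: "Suc i < length ?k"
      using Cons.prems by (auto simp: braid_words_def c)
    have kc: "set ?k \<subseteq> carrier G"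
      using hurwitz_word_tuples[OF w] assms(1) by (auto simp: tuples_def)
    have k: "?k = take i ?k @ ?k ! i # ?k ! Suc i # drop (Suc (Suc i)) ?k"
      using i by (simp add: Cons_nth_drop_Suc id_take_nth_drop[of i])
    then obtain xs a b ys where k: "?k = xs @ a # b # ys" and len: "length xs = i"
      using i by (metis Suc_lessD length_take min.absorb4)
    have "P (xs @ a # b # ys)" using Cons.IH[OF w] k by simp
    then have "P (hurwitz_letter G (i, e) ?k)"
      using kc assms(4,5) unfolding k by (cases e) (auto simp: hurwitz_letter_split[OF len] simp del: hurwitz_letter.simps)
    then show ?case by (simp add: hurwitz_word_def c del: hurwitz_letter.simps)
  qed
  then show ?thesis using w(2) by simp
qed

lemma generate_hurwitz_orbit:
  assumes "set g \<subseteq> carrier G" "h \<in> hurwitz_orbit G g"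
  shows "generate G (set h) = generate G (set g)"
proof -
  \<comment> \<open>One inclusion is enough: g lies in the orbit of h as well, so the roles can be
    exchanged.\<close>
  have sub: "generate G (set h) \<subseteq> generate G (set g)"
    if g: "set g \<subseteq> carrier G" and h: "h \<in> hurwitz_orbit G g" for g h
  proof -
    have "set h \<subseteq> generate G (set g)"
      using g h
    proof (induction rule: hurwitz_orbit_induct)
      case base
      then show ?case by (auto intro: generate.incl)
    qed (auto intro!: generate.eng generate_m_inv_closed[OF g])
    then show ?thesis
      by (rule generate_subgroup_incl[OF _ generate_is_subgroup[OF g]])
  qed
  have "g \<in> hurwitz_orbit G h"
    using hurwitz_orbit_eq[OF assms] hurwitz_orbit_refl[OF assms(1)] by simp
  then show ?thesis
    using sub[OF assms] sub[of h g] hurwitz_orbit_in_carrier[OF assms] by blast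
qed

section \<open>Conjugacy classes are invariant under conjugation and disjoint\<close>

lemma conj_class_conj:
  assumes "x \<in> carrier G" "y \<in> conj_class G x" "a \<in> carrier G"
  shows "a \<otimes> y \<otimes> inv a \<in> conj_class G x"
proof -
  obtain c where c: "c \<in> carrier G" "y = c \<otimes> x \<otimes> inv c"
    using assms(2) by (auto simp: conj_class_def)
  have "a \<otimes> y \<otimes> inv a = (a \<otimes> c) \<otimes> x \<otimes> inv (a \<otimes> c)"
    using assms(1,3) c by (simp add: m_assoc inv_mult_group)
  then show ?thesis using assms(3) c(1) unfolding conj_class_def by blast
qed

lemma conj_classes_conj_iff:
  assumes "\<gamma> \<in> conj_classes G" "y \<in> carrier G" "a \<in> carrier G"
  shows "a \<otimes> y \<otimes> inv a \<in> \<gamma> \<longleftrightarrow> y \<in> \<gamma>"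
proof
  obtain x where x: "x \<in> carrier G" "\<gamma> = conj_class G x"
    using assms(1) by (auto simp: conj_classes_def)
  show "a \<otimes> y \<otimes> inv a \<in> \<gamma>" if "y \<in> \<gamma>"
    using conj_class_conj x that assms(3) by simp
  assume "a \<otimes> y \<otimes> inv a \<in> \<gamma>"
  then have "inv a \<otimes> (a \<otimes> y \<otimes> inv a) \<otimes> inv (inv a) \<in> \<gamma>"
    using conj_class_conj[OF x(1), of _ "inv a"] assms(3) unfolding x(2) by blast
  then show "y \<in> \<gamma>" using assms by (simp add: m_assoc inv_cancel_left)
qed

lemma conj_classes_disjoint:
  assumes "\<gamma> \<in> conj_classes G" "\<gamma>' \<in> conj_classes G" "x \<in> \<gamma>" "x \<in> \<gamma>'"
  shows "\<gamma> = \<gamma>'"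
proof -
  have sub: "\<gamma> \<subseteq> \<gamma>'" if \<gamma>: "\<gamma> \<in> conj_classes G" "\<gamma>' \<in> conj_classes G" "x \<in> \<gamma>" "x \<in> \<gamma>'" for \<gamma> \<gamma>'
  proof
    fix z assume z: "z \<in> \<gamma>"
    obtain y where y: "y \<in> carrier G" "\<gamma> = conj_class G y"
      using \<gamma>(1) by (auto simp: conj_classes_def)
    obtain c d where c: "c \<in> carrier G" "x = c \<otimes> y \<otimes> inv c" and d: "d \<in> carrier G" "z = d \<otimes> y \<otimes> inv d"
      using z \<gamma>(3) y by (auto simp: conj_class_def)
    have "y \<in> \<gamma>'" using \<gamma>(2,4) conj_classes_conj_iff y c by blast
    then show "z \<in> \<gamma>'" using \<gamma>(2) conj_classes_conj_iff y d by blast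
  qed
  show ?thesis using sub[OF assms] sub[OF assms(2,1,4,3)] by blast
qed

section \<open>Moving one block of entries past another\<close>

lemma hurwitz_orbit_move_one:
  assumes "a \<in> carrier G" "set h \<subseteq> carrier G"
  shows "map (\<lambda>x. a \<otimes> x \<otimes> inv a) h @ [a] \<in> hurwitz_orbit G (a # h)"
  using assms(2)
proof (induction h)
  case Nil
  then show ?case using hurwitz_orbit_refl[of "[a]"] assms(1) by simp
next
  case (Cons b h)
  let ?c = "a \<otimes> b \<otimes> inv a"
  have c: "?c \<in> carrier G" using Cons.prems assms(1) by simp
  have "?c # a # h \<in> hurwitz_orbit G (a # b # h)"
    using Cons.prems assms(1) hurwitz_letter_split(1)[of "[]" 0 G a b h]
    by (auto simp: mem_hurwitz_orbit hurwitz_word_def braid_words_def intro!: bexI[of _ "[(0, True)]"])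
  moreover have "[?c] @ (map (\<lambda>x. a \<otimes> x \<otimes> inv a) h @ [a]) \<in> hurwitz_orbit G ([?c] @ (a # h))"
    using Cons assms(1) c by (intro hurwitz_orbit_append hurwitz_orbit_refl) auto
  ultimately show ?case
    using hurwitz_orbit_trans[of "a # b # h"] Cons.prems assms(1) by auto
qed

text \<open>The entries of g cross h one at a time, the last one first, and their conjugations
  accumulate to conjugation by the product of g. When that product is \<one>, the block h is
  unchanged, which is why concatenation of components is commutative.\<close>

lemma hurwitz_orbit_move:
  assumes "set g \<subseteq> carrier G" "set h \<subseteq> carrier G"
  shows "map (\<lambda>x. tuple_prod G g \<otimes> x \<otimes> inv (tuple_prod G g)) h @ g \<in> hurwitz_orbit G (g @ h)"
  using assms(1)
proof (induction g)
  case Nil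
  have "map (\<lambda>x. \<one> \<otimes> x \<otimes> inv \<one>) h = h"
    using assms(2) by (intro map_idI) auto
  then show ?case using hurwitz_orbit_refl[OF assms(2)] by simp
next
  case (Cons a g)
  let ?p = "tuple_prod G g"
  let ?h = "map (\<lambda>x. ?p \<otimes> x \<otimes> inv ?p) h"
  have c: "a \<in> carrier G" "set g \<subseteq> carrier G" "?p \<in> carrier G" "set ?h \<subseteq> carrier G"
    using Cons.prems assms(2) by auto
  have 1: "[a] @ (?h @ g) \<in> hurwitz_orbit G ([a] @ (g @ h))"
    using Cons assms(2) c by (intro hurwitz_orbit_append[of "[a]"] hurwitz_orbit_refl) auto
  have 2: "(map (\<lambda>x. a \<otimes> x \<otimes> inv a) ?h @ [a]) @ g \<in> hurwitz_orbit G ((a # ?h) @ g)"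
    using c by (intro hurwitz_orbit_append hurwitz_orbit_refl hurwitz_orbit_move_one) simp_all
  have 3: "map (\<lambda>x. a \<otimes> x \<otimes> inv a) ?h = map (\<lambda>x. (a \<otimes> ?p) \<otimes> x \<otimes> inv (a \<otimes> ?p)) h"
    unfolding map_map comp_def
  proof (rule map_cong[OF HOL.refl])
    fix x assume "x \<in> set h"
    then have "x \<in> carrier G" using assms(2) by blast
    then show "a \<otimes> (?p \<otimes> x \<otimes> inv ?p) \<otimes> inv a = a \<otimes> ?p \<otimes> x \<otimes> inv (a \<otimes> ?p)"
      using c(1,3) by (simp add: m_assoc inv_mult_group)
  qed
  have "(map (\<lambda>x. a \<otimes> x \<otimes> inv a) ?h @ [a]) @ g \<in> hurwitz_orbit G ([a] @ (g @ h))"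
    by (rule hurwitz_orbit_trans[OF _ 1]) (use c assms(2) 2 in simp_all)
  then show ?case unfolding 3 by simp
qed

lemma hurwitz_orbit_swap:
  assumes "set g \<subseteq> carrier G" "set h \<subseteq> carrier G" "tuple_prod G g = \<one>"
  shows "hurwitz_orbit G (h @ g) = hurwitz_orbit G (g @ h)"
proof -
  have "map (\<lambda>x. \<one> \<otimes> x \<otimes> inv \<one>) h = h"
    using assms(2) by (intro map_idI) auto
  then have "h @ g \<in> hurwitz_orbit G (g @ h)"
    using hurwitz_orbit_move[OF assms(1,2)] assms(3) by simp
  then show ?thesis using assms by (intro hurwitz_orbit_eq) simp_all
qed

section \<open>The monoid of components\<close>

lemma comp_tuples_carrier: "g \<in> comp_tuples G D \<xi> n \<Longrightarrow> set g \<subseteq> carrier G"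
  by (simp add: comp_tuples_def tuples_def)

lemma carrier_Comp: "carrier (Comp G D \<xi>) = (\<Union>n. components G D \<xi> n)"
  by (simp add: Comp_def)

lemma components_in_Comp: "m \<in> components G D \<xi> n \<Longrightarrow> m \<in> carrier (Comp G D \<xi>)"
  by (auto simp: carrier_Comp)

lemma componentsE:
  assumes "m \<in> components G D \<xi> n"
  obtains g where "g \<in> comp_tuples G D \<xi> n" "set g \<subseteq> carrier G" "m = hurwitz_orbit G g"
  using assms comp_tuples_carrier by (auto simp: components_def)

lemma Comp_mult:
  assumes "set g \<subseteq> carrier G" "set h \<subseteq> carrier G"
  shows "hurwitz_orbit G g \<otimes>\<^bsub>Comp G D \<xi>\<^esub> hurwitz_orbit G h = hurwitz_orbit G (g @ h)"
proof -
  have "hurwitz_orbit G (g' @ h') = hurwitz_orbit G (g @ h)"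
    if "g' \<in> hurwitz_orbit G g" "h' \<in> hurwitz_orbit G h" for g' h'
    using assms that by (intro hurwitz_orbit_eq hurwitz_orbit_append) auto
  then have "(\<Union>g'\<in>hurwitz_orbit G g. \<Union>h'\<in>hurwitz_orbit G h. hurwitz_orbit G (g' @ h'))
      = (\<Union>g'\<in>hurwitz_orbit G g. \<Union>h'\<in>hurwitz_orbit G h. hurwitz_orbit G (g @ h))"
    by (intro SUP_cong HOL.refl)
  moreover have "hurwitz_orbit G g \<noteq> {}" "hurwitz_orbit G h \<noteq> {}"
    using hurwitz_orbit_refl[OF assms(1)] hurwitz_orbit_refl[OF assms(2)] by blast+
  ultimately show ?thesis by (simp add: Comp_def)
qed

lemma Comp_one: "\<one>\<^bsub>Comp G D \<xi>\<^esub> = hurwitz_orbit G []"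
  by (simp add: Comp_def)

lemma comp_group_orbit:
  assumes "set g \<subseteq> carrier G"
  shows "comp_group G (hurwitz_orbit G g) = generate G (set g)"
  using generate_hurwitz_orbit[OF assms] hurwitz_orbit_refl[OF assms]
  unfolding comp_group_def by blast

lemma comp_tuples_append:
  assumes "g \<in> comp_tuples G D \<xi> n" "h \<in> comp_tuples G D \<xi> n'"
  shows "g @ h \<in> comp_tuples G D \<xi> (n + n')"
  using assms tuple_prod_append[of g h]
  by (auto simp: comp_tuples_def tuples_def distrib_right)

lemma components_mult:
  assumes "m \<in> components G D \<xi> n" "m' \<in> components G D \<xi> n'"
  shows "m \<otimes>\<^bsub>Comp G D \<xi>\<^esub> m' \<in> components G D \<xi> (n + n')"
  using assms comp_tuples_append
  by (auto elim!: componentsE simp: Comp_mult) (auto simp: components_def)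

lemma components_one: "\<one>\<^bsub>Comp G D \<xi>\<^esub> \<in> components G D \<xi> 0"
  unfolding Comp_one components_def
  by (intro imageI) (auto simp: comp_tuples_def tuples_def)

lemma comm_monoid_Comp: "comm_monoid (Comp G D \<xi>)"
proof (rule comm_monoidI)
  show "\<one>\<^bsub>Comp G D \<xi>\<^esub> \<in> carrier (Comp G D \<xi>)"
    using components_one components_in_Comp by blast
  fix x y z
  assume "x \<in> carrier (Comp G D \<xi>)" "y \<in> carrier (Comp G D \<xi>)" "z \<in> carrier (Comp G D \<xi>)"
  then obtain i j k where ijk: "x \<in> components G D \<xi> i" "y \<in> components G D \<xi> j" "z \<in> components G D \<xi> k"
    unfolding carrier_Comp by blast
  show "x \<otimes>\<^bsub>Comp G D \<xi>\<^esub> y \<in> carrier (Comp G D \<xi>)"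
    using components_mult[OF ijk(1,2)] components_in_Comp by blast
  obtain f where f: "f \<in> comp_tuples G D \<xi> i" "set f \<subseteq> carrier G" "x = hurwitz_orbit G f"
    using ijk(1) by (rule componentsE)
  obtain g where g: "set g \<subseteq> carrier G" "y = hurwitz_orbit G g"
    using ijk(2) by (rule componentsE)
  obtain h where h: "set h \<subseteq> carrier G" "z = hurwitz_orbit G h"
    using ijk(3) by (rule componentsE)
  show "x \<otimes>\<^bsub>Comp G D \<xi>\<^esub> y \<otimes>\<^bsub>Comp G D \<xi>\<^esub> z = x \<otimes>\<^bsub>Comp G D \<xi>\<^esub> (y \<otimes>\<^bsub>Comp G D \<xi>\<^esub> z)"
    using f g h by (simp add: Comp_mult)
  show "x \<otimes>\<^bsub>Comp G D \<xi>\<^esub> y = y \<otimes>\<^bsub>Comp G D \<xi>\<^esub> x"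
    using f g hurwitz_orbit_swap[of f g] by (simp add: Comp_mult comp_tuples_def)
  show "\<one>\<^bsub>Comp G D \<xi>\<^esub> \<otimes>\<^bsub>Comp G D \<xi>\<^esub> x = x"
    using f by (simp add: Comp_mult Comp_one)
qed

lemma subgroup_comp_group:
  assumes "m \<in> carrier (Comp G D \<xi>)"
  shows "subgroup (comp_group G m) G"
  using assms by (auto simp: carrier_Comp comp_group_orbit generate_is_subgroup elim!: componentsE)

lemma generate_Un_generate:
  assumes "A \<subseteq> carrier G" "B \<subseteq> carrier G"
  shows "generate G (generate G A \<union> generate G B) = generate G (A \<union> B)"
proof
  show "generate G (generate G A \<union> generate G B) \<subseteq> generate G (A \<union> B)"
    using assms mono_generate[of A "A \<union> B"] mono_generate[of B "A \<union> B"]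
    by (intro generate_subgroup_incl generate_is_subgroup) auto
  show "generate G (A \<union> B) \<subseteq> generate G (generate G A \<union> generate G B)"
    by (rule mono_generate) (auto intro: generate.incl)
qed

lemma comp_group_mult:
  assumes "m \<in> carrier (Comp G D \<xi>)" "m' \<in> carrier (Comp G D \<xi>)"
  shows "comp_group G (m \<otimes>\<^bsub>Comp G D \<xi>\<^esub> m') = generate G (comp_group G m \<union> comp_group G m')"
  using assms
  by (auto simp: carrier_Comp comp_group_orbit Comp_mult generate_Un_generate elim!: componentsE)

lemma comp_group_one: "comp_group G (\<one>\<^bsub>Comp G D \<xi>\<^esub>) = {\<one>}"
  by (simp add: Comp_one comp_group_orbit generate_empty)

text \<open>It follows that the components with group inside H form a face of the monoid, so that
  restriction to them is a ring homomorphism.\<close>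

lemma comp_group_mult_subset_iff:
  assumes "m \<in> carrier (Comp G D \<xi>)" "m' \<in> carrier (Comp G D \<xi>)" "subgroup H G"
  shows "comp_group G (m \<otimes>\<^bsub>Comp G D \<xi>\<^esub> m') \<subseteq> H \<longleftrightarrow> comp_group G m \<subseteq> H \<and> comp_group G m' \<subseteq> H"
proof -
  have "K \<union> L \<subseteq> H \<longleftrightarrow> generate G (K \<union> L) \<subseteq> H" for K L
    using generate_subgroup_incl[OF _ assms(3), of "K \<union> L"] generate.incl[of _ "K \<union> L" G] by blast
  then show ?thesis
    unfolding comp_group_mult[OF assms(1,2)] by blast
qed

lemma comp_group_pow:
  assumes "m \<in> carrier (Comp G D \<xi>)" "n > 0"
  shows "comp_group G (m [^]\<^bsub>Comp G D \<xi>\<^esub> (n::nat)) = comp_group G m"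
proof -
  interpret C: comm_monoid "Comp G D \<xi>" by (rule comm_monoid_Comp)
  show ?thesis
    using assms(2)
  proof (induction n rule: nat_induct_non_zero)
    case 1
    then show ?case using assms(1) by simp
  next
    case (Suc n)
    have "generate G (comp_group G m) = comp_group G m"
      using generate_subgroup_incl[OF subset_refl subgroup_comp_group[OF assms(1)]]
      by (intro subset_antisym subsetI generate.incl) auto
    then show ?case using Suc assms(1) by (simp add: comp_group_mult)
  qed
qed

lemma components_pow:
  assumes "m \<in> components G D \<xi> d"
  shows "m [^]\<^bsub>Comp G D \<xi>\<^esub> (n::nat) \<in> components G D \<xi> (n * d)"
proof -
  interpret C: comm_monoid "Comp G D \<xi>" by (rule comm_monoid_Comp)
  show ?thesis
    by (induction n) (use assms components_one components_mult in \<open>auto simp: add.commute[of d]\<close>)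
qed

end

section \<open>Free families of subgroups\<close>

text \<open>A recursive form of \<open>free_family\<close>, made for induction on the list: each
  member commutes with the later ones and meets the subgroup they generate trivially. The
  equivalence is \<open>free_family_iff_independent\<close>.\<close>

primrec independent_family :: "('a, 'b) monoid_scheme \<Rightarrow> 'a set list \<Rightarrow> bool"
  where
    "independent_family G [] \<longleftrightarrow> True"
  | "independent_family G (K # Ks) \<longleftrightarrow> subgroup K G \<and>
      (\<forall>x\<in>K. \<forall>L\<in>set Ks. \<forall>y\<in>L. x \<otimes>\<^bsub>G\<^esub> y = y \<otimes>\<^bsub>G\<^esub> x) \<and>
      K \<inter> generate G (\<Union>(set Ks)) = {\<one>\<^bsub>G\<^esub>} \<and> independent_family G Ks"

context Group.group
begin

lemma generate_subgroup_eq: "subgroup H G \<Longrightarrow> generate G H = H"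
  using generate_subgroup_incl[of H H] by (auto intro: generate.incl)

lemma commute_generate_right:
  assumes "x \<in> carrier G" "B \<subseteq> carrier G" "\<And>y. y \<in> B \<Longrightarrow> x \<otimes> y = y \<otimes> x" "y \<in> generate G B"
  shows "x \<otimes> y = y \<otimes> x"
  using assms(4)
proof induction
  case (inv h)
  then have h: "h \<in> carrier G" "x \<otimes> h = h \<otimes> x" using assms by auto
  then have "inv h \<otimes> (x \<otimes> h) \<otimes> inv h = inv h \<otimes> (h \<otimes> x) \<otimes> inv h" by simp
  then have "inv h \<otimes> x \<otimes> (h \<otimes> inv h) = (inv h \<otimes> h) \<otimes> x \<otimes> inv h"
    using h(1) assms(1) by (simp only: m_assoc inv_closed m_closed)
  then show ?case using h(1) assms(1) by simp
next
  case (eng a b)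
  then have "a \<in> carrier G" "b \<in> carrier G" using assms(2) generate_in_carrier by auto
  then show ?case using eng.IH assms(1) by (metis m_assoc)
qed (use assms in auto)

lemma commute_generate:
  assumes "A \<subseteq> carrier G" "B \<subseteq> carrier G" "\<And>x y. x \<in> A \<Longrightarrow> y \<in> B \<Longrightarrow> x \<otimes> y = y \<otimes> x"
    "x \<in> generate G A" "y \<in> generate G B"
  shows "x \<otimes> y = y \<otimes> x"
proof -
  have "z \<otimes> y = y \<otimes> z" if "z \<in> A" for z
    using that assms(1,3) by (intro commute_generate_right[OF _ assms(2) _ assms(5)]) auto
  then have "y \<otimes> x = x \<otimes> y"
    using generate_in_carrier[OF assms(2,5)]
    by (intro commute_generate_right[OF _ assms(1) _ assms(4)]) auto
  then show ?thesis by simp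
qed

text \<open>Because A and B commute elementwise, so do the subgroups they generate, and the products
  of one element from each are closed under multiplication.\<close>

lemma generate_Un_commuting:
  assumes "A \<subseteq> carrier G" "B \<subseteq> carrier G" "\<And>x y. x \<in> A \<Longrightarrow> y \<in> B \<Longrightarrow> x \<otimes> y = y \<otimes> x"
    "x \<in> generate G (A \<union> B)"
  obtains a b where "a \<in> generate G A" "b \<in> generate G B" "x = a \<otimes> b"
proof -
  have car: "z \<in> carrier G" if "z \<in> generate G A \<or> z \<in> generate G B" for z
    using that assms(1,2) generate_in_carrier by blast
  have "\<exists>a\<in>generate G A. \<exists>b\<in>generate G B. x = a \<otimes> b"
    using assms(4)
  proof induction
    case one
    show ?case by (intro bexI[of _ \<one>]) (auto intro: generate.one)
  next
    case (incl h)
    then show ?case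
    proof
      assume "h \<in> A"
      then show ?thesis using assms(1,2) by - (rule bexI[of _ h], rule bexI[of _ \<one>], auto intro: generate.intros)
    next
      assume "h \<in> B"
      then show ?thesis using assms(1,2) by - (rule bexI[of _ \<one>], rule bexI[of _ h], auto intro: generate.intros)
    qed
  next
    case (inv h)
    then show ?case
    proof
      assume "h \<in> A"
      then show ?thesis using assms(1) by - (rule bexI[of _ "inv h"], rule bexI[of _ \<one>], auto intro: generate.intros)
    next
      assume "h \<in> B"
      then show ?thesis using assms(2) by - (rule bexI[of _ \<one>], rule bexI[of _ "inv h"], auto intro: generate.intros)
    qed
  next
    case (eng x y)
    then obtain a b c d where *: "a \<in> generate G A" "b \<in> generate G B" "x = a \<otimes> b"
      "c \<in> generate G A" "d \<in> generate G B" "y = c \<otimes> d" by blast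
    have "b \<otimes> c = c \<otimes> b" using commute_generate[OF assms(1-3)] * by simp
    then have "x \<otimes> y = (a \<otimes> c) \<otimes> (b \<otimes> d)"
      using * car by (simp add: m_assoc) (metis m_assoc)
    then show ?case using generate.eng[OF *(1,4)] generate.eng[OF *(2,5)] by blast
  qed
  then show ?thesis using that by blast
qed

lemma independent_carrier: "independent_family G Ks \<Longrightarrow> \<Union>(set Ks) \<subseteq> carrier G"
  by (induction Ks) (auto dest: subgroup.subset)

lemma free_family_independent: "free_family G Hs \<Longrightarrow> independent_family G Hs"
proof (induction Hs)
  case (Cons K Ks)
  let ?n = "length Ks"
  note free = Cons.prems[unfolded free_family_def]
  have disj: "generate G (\<Union>i\<in>A. (K # Ks) ! i) \<inter> generate G (\<Union>j\<in>B. (K # Ks) ! j) = {\<one>}"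
    if "A \<subseteq> {..<Suc ?n}" "B \<subseteq> {..<Suc ?n}" "A \<inter> B = {}" for A B
    using free that by simp
  have "free_family G Ks"
    unfolding free_family_def
  proof (intro conjI allI impI ballI)
    fix A B :: "nat set" assume "A \<subseteq> {..<?n}" "B \<subseteq> {..<?n}" "A \<inter> B = {}"
    then show "generate G (\<Union>i\<in>A. Ks ! i) \<inter> generate G (\<Union>j\<in>B. Ks ! j) = {\<one>}"
      using disj[of "Suc ` A" "Suc ` B"] by auto
  next
    fix i j x y assume "i < ?n" "j < ?n" "i \<noteq> j" "x \<in> Ks ! i" "y \<in> Ks ! j"
    then show "x \<otimes> y = y \<otimes> x"
      using free by (metis Suc_less_eq length_Cons nat.inject nth_Cons_Suc)
  qed (use free in auto)
  moreover have "x \<otimes> y = y \<otimes> x" if xy: "x \<in> K" "L \<in> set Ks" "y \<in> L" for x y L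
  proof -
    obtain j where "j < ?n" "y \<in> Ks ! j" using xy(2,3) by (auto simp: in_set_conv_nth)
    then show ?thesis
      using free xy(1) by (metis Suc_less_eq length_Cons nat.distinct(1) nth_Cons_0 nth_Cons_Suc zero_less_Suc)
  qed
  moreover have "K \<inter> generate G (\<Union>(set Ks)) = {\<one>}"
  proof -
    have "(\<Union>j\<in>{..<?n}. Ks ! j) = \<Union>(set Ks)" by (auto simp: in_set_conv_nth set_conv_nth)
    moreover have "generate G K = K" using free by (intro generate_subgroup_eq) auto
    ultimately show ?thesis using disj[of "{0}" "Suc ` {..<?n}"] by auto
  qed
  ultimately show ?case using Cons.IH free unfolding independent_family.simps by (metis list.set_intros(1))
qed simp

text \<open>At most one of the two index sets contains 0; by symmetry let it be A. Then a common
  element is x = k a with k in K and a in the part of A in the tail. As x and a both come from the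
  tail, so does k, whence k = \<one>, and the induction hypothesis applies to x = a.\<close>

lemma independent_disjoint:
  assumes "independent_family G Hs" "A \<subseteq> {..<length Hs}" "B \<subseteq> {..<length Hs}" "A \<inter> B = {}"
  shows "generate G (\<Union>i\<in>A. Hs ! i) \<inter> generate G (\<Union>j\<in>B. Hs ! j) = {\<one>}"
  using assms
proof (induction Hs arbitrary: A B)
  case Nil
  then show ?case by (simp add: generate_empty)
next
  case (Cons K Ks)
  let ?n = "length Ks"
  \<comment> \<open>\<open>U A\<close> is the contribution of the tail to the union over A, with
    indices lowered by one; index 0, if present, contributes K.\<close>
  define U where "U A = (\<Union>i\<in>Suc -` A. Ks ! i)" for A
  have U: "(\<Union>i\<in>A. (K # Ks) ! i) = (if 0 \<in> A then K else {}) \<union> U A" for A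
  proof (intro subset_antisym subsetI)
    fix x assume "x \<in> (\<Union>i\<in>A. (K # Ks) ! i)"
    then obtain i where "i \<in> A" "x \<in> (K # Ks) ! i" by blast
    then show "x \<in> (if 0 \<in> A then K else {}) \<union> U A" by (cases i) (auto simp: U_def)
  next
    fix x assume "x \<in> (if 0 \<in> A then K else {}) \<union> U A"
    then consider "0 \<in> A" "x \<in> K" | i where "Suc i \<in> A" "x \<in> Ks ! i"
      by (auto simp: U_def split: if_splits)
    then show "x \<in> (\<Union>i\<in>A. (K # Ks) ! i)"
    proof cases
      case 1
      then show ?thesis by (intro UN_I[of 0]) auto
    next
      case 2
      then show ?thesis by (intro UN_I[of "Suc i"]) auto
    qed
  qed
  have K: "subgroup K G" "K \<subseteq> carrier G" and com: "\<And>x y. x \<in> K \<Longrightarrow> y \<in> \<Union>(set Ks) \<Longrightarrow> x \<otimes> y = y \<otimes> x"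
    and int: "K \<inter> generate G (\<Union>(set Ks)) = {\<one>}" and ind: "independent_family G Ks"
    using Cons.prems(1) subgroup.subset by auto
  have Usub: "U A \<subseteq> \<Union>(set Ks)" if "A \<subseteq> {..<Suc ?n}" for A
  proof
    fix x assume "x \<in> U A"
    then obtain i where "Suc i \<in> A" "x \<in> Ks ! i" by (auto simp: U_def)
    moreover have "i < ?n" using that \<open>Suc i \<in> A\<close> by auto
    ultimately show "x \<in> \<Union>(set Ks)" using nth_mem by blast
  qed
  note Kc = independent_carrier[OF ind]
  have gsub: "generate G (U A) \<subseteq> generate G (\<Union>(set Ks))" if "A \<subseteq> {..<Suc ?n}" for A
    using Usub[OF that] by (rule mono_generate)
  have main: "x = \<one>" if AB: "A \<subseteq> {..<Suc ?n}" "B \<subseteq> {..<Suc ?n}" "A \<inter> B = {}" "0 \<notin> B"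
    and x: "x \<in> generate G (\<Union>i\<in>A. (K # Ks) ! i)" "x \<in> generate G (\<Union>i\<in>B. (K # Ks) ! i)" for A B x
  proof -
    have IH: "generate G (U A) \<inter> generate G (U B) = {\<one>}"
      unfolding U_def using AB by (intro Cons.IH[OF ind]) auto
    have xB: "x \<in> generate G (U B)" using x(2) AB(4) by (simp add: U)
    show ?thesis
    proof (cases "0 \<in> A")
      case True
      then have "x \<in> generate G (K \<union> U A)" using x(1) U[of A] by simp
      then obtain k a where ka: "k \<in> generate G K" "a \<in> generate G (U A)" "x = k \<otimes> a"
        by (rule generate_Un_commuting[rotated 3]) (use K Kc Usub[OF AB(1)] com in blast)+
      have k: "k \<in> K" using ka(1) generate_subgroup_eq[OF K(1)] by simp
      have ax: "a \<in> generate G (\<Union>(set Ks))" "x \<in> generate G (\<Union>(set Ks))"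
        using gsub AB ka(2) xB by blast+
      then have car: "a \<in> carrier G" "x \<in> carrier G" "k \<in> carrier G"
        using generate_in_carrier[OF Kc] k K by auto
      have "k = x \<otimes> inv a" using car ka(3) by (simp add: m_assoc)
      also have "\<dots> \<in> generate G (\<Union>(set Ks))"
        using ax by (intro generate.eng generate_m_inv_closed[OF Kc])
      finally have "k = \<one>" using int k by blast
      then show ?thesis using IH ka xB car by auto
    next
      case False
      then show ?thesis using x(1) IH xB U[of A] by auto
    qed
  qed
  show ?case
  proof
    show "generate G (\<Union>i\<in>A. (K # Ks) ! i) \<inter> generate G (\<Union>j\<in>B. (K # Ks) ! j) \<subseteq> {\<one>}"
      using main[of A B] main[of B A] Cons.prems by (cases "0 \<in> B") auto
  qed (auto intro: generate.one)
qed

lemma independent_commute: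
  assumes "independent_family G Hs" "i < length Hs" "j < length Hs" "i \<noteq> j" "x \<in> Hs ! i" "y \<in> Hs ! j"
  shows "x \<otimes> y = y \<otimes> x"
  using assms
proof (induction Hs arbitrary: i j x y)
  case (Cons K Ks)
  consider "i = 0" "j = 0" | j' where "i = 0" "j = Suc j'" | i' where "i = Suc i'" "j = 0"
    | i' j' where "i = Suc i'" "j = Suc j'"
    by (metis not0_implies_Suc)
  then show ?case
  proof cases
    case 3
    then show ?thesis using Cons.prems by (metis independent_family.simps(2) length_Cons nth_Cons_0 nth_Cons_Suc nth_mem Suc_less_eq)
  next
    case 2
    then show ?thesis using Cons.prems by (metis independent_family.simps(2) length_Cons nth_Cons_0 nth_Cons_Suc nth_mem Suc_less_eq)
  qed (use Cons in auto)
qed simp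

lemma free_family_iff_independent: "free_family G Hs \<longleftrightarrow> independent_family G Hs"
proof
  assume ind: "independent_family G Hs"
  have "\<forall>K\<in>set Hs. subgroup K G" using ind by (induction Hs) auto
  then show "free_family G Hs"
    unfolding free_family_def using independent_disjoint[OF ind] independent_commute[OF ind] by simp
qed (rule free_family_independent)

text \<open>The point is that the head K meets the subgroup generated by all later members
  trivially. An element of this intersection is a product a b with a from the rest of the first list
  and b from the second; solving for b puts it into both generated subgroups, so b = \<one>.\<close>

lemma independent_append:
  assumes "independent_family G Ks" "independent_family G Ls"
    "\<And>x y. x \<in> \<Union>(set Ks) \<Longrightarrow> y \<in> \<Union>(set Ls) \<Longrightarrow> x \<otimes> y = y \<otimes> x"
    "generate G (\<Union>(set Ks)) \<inter> generate G (\<Union>(set Ls)) = {\<one>}"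
  shows "independent_family G (Ks @ Ls)"
  using assms
proof (induction Ks)
  case (Cons K Ks)
  let ?A = "\<Union>(set Ks)" and ?B = "\<Union>(set Ls)"
  have car: "?A \<subseteq> carrier G" "?B \<subseteq> carrier G" "\<Union>(set (K # Ks)) \<subseteq> carrier G"
    using independent_carrier[OF Cons.prems(1)] independent_carrier[OF Cons.prems(2)] by auto
  have sub: "generate G ?A \<subseteq> generate G (\<Union>(set (K # Ks)))" "K \<subseteq> generate G (\<Union>(set (K # Ks)))"
    by (rule mono_generate) (auto intro: generate.incl)
  have "independent_family G (Ks @ Ls)"
    using Cons.prems sub by (intro Cons.IH) (auto intro: generate.one)
  moreover have "K \<inter> generate G (?A \<union> ?B) \<subseteq> {\<one>}"
  proof
    fix x assume x: "x \<in> K \<inter> generate G (?A \<union> ?B)"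
    then have "x \<in> generate G (?A \<union> ?B)" by blast
    then obtain a b where ab: "a \<in> generate G ?A" "b \<in> generate G ?B" "x = a \<otimes> b"
    proof (rule generate_Un_commuting[OF car(1,2), rotated])
      fix u v assume "u \<in> ?A" "v \<in> ?B"
      then show "u \<otimes> v = v \<otimes> u" using Cons.prems(3)[of u v] by auto
    qed
    have c: "a \<in> carrier G" "b \<in> carrier G" "x \<in> carrier G"
      using ab car generate_in_carrier x Cons.prems(1) by auto
    have "b = inv a \<otimes> x" using ab(3) c by (simp flip: m_assoc)
    also have "\<dots> \<in> generate G (\<Union>(set (K # Ks)))"
      using ab(1) x sub by (intro generate.eng generate_m_inv_closed[OF car(3)]) auto
    finally have "b = \<one>" using ab(2) Cons.prems(4) by blast
    then have "x \<in> K \<inter> generate G ?A" using x ab c by simp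
    then show "x \<in> {\<one>}" using Cons.prems(1) by auto
  qed
  ultimately show ?case
    using Cons.prems subgroup.one_closed[of K G] by (auto intro: generate.one)
qed simp

text \<open>Refined pieces stay inside the member they refine, so they inherit commutation and
  trivial intersection from the members. This is used when the members of a free factor family are
  split further.\<close>

lemma independent_concat:
  assumes "independent_family G Hs" "\<And>K. K \<in> set Hs \<Longrightarrow> independent_family G (f K) \<and> \<Union>(set (f K)) \<subseteq> K"
  shows "independent_family G (concat (map f Hs))"
  using assms
proof (induction Hs)
  case (Cons K Ks)
  let ?C = "\<Union>(set (concat (map f Ks)))"
  have C: "?C \<subseteq> \<Union>(set Ks)" 
  proof
    fix x assume "x \<in> ?C"
    then obtain L where "L \<in> set Ks" "x \<in> \<Union>(set (f L))" by auto
    then show "x \<in> \<Union>(set Ks)" using Cons.prems(2)[of L] by auto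
  qed
  have fK: "\<Union>(set (f K)) \<subseteq> K" using Cons.prems(2) by simp
  have "generate G (\<Union>(set (f K))) \<subseteq> K"
    using generate_subgroup_incl[OF fK] Cons.prems(1) by simp
  moreover have "generate G ?C \<subseteq> generate G (\<Union>(set Ks))"
    using C by (rule mono_generate)
  ultimately have "generate G (\<Union>(set (f K))) \<inter> generate G ?C \<subseteq> {\<one>}"
    using Cons.prems(1) by auto
  then have "independent_family G (f K @ concat (map f Ks))"
  proof (intro independent_append)
    show "x \<otimes> y = y \<otimes> x" if "x \<in> \<Union>(set (f K))" "y \<in> ?C" for x y
    proof -
      have "x \<in> K" "y \<in> \<Union>(set Ks)" using that C fK by blast+
      then show ?thesis using Cons.prems(1) by auto
    qed
  qed (use Cons in \<open>auto intro: generate.one\<close>)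
  then show ?case by simp
qed simp

text \<open>The ingredients of the isomorphism in \<open>internal_direct_product\<close>: where the
  product map lands, that its kernel is trivial, and that it is multiplicative.\<close>

lemma tuple_prod_independent:
  assumes "independent_family G Hs" "list_all2 (\<in>) xs Hs"
  shows "tuple_prod G xs \<in> generate G (\<Union>(set Hs))"
    and "tuple_prod G xs = \<one> \<Longrightarrow> set xs \<subseteq> {\<one>}"
    and "list_all2 (\<in>) ys Hs \<Longrightarrow> tuple_prod G (map2 (\<otimes>) xs ys) = tuple_prod G xs \<otimes> tuple_prod G ys"
proof -
  have mem: "tuple_prod G xs \<in> generate G (\<Union>(set Hs))" if "list_all2 (\<in>) xs Hs" for xs Hs
    using that
  proof (induction rule: list_all2_induct)
    case (Cons x xs K Ks)
    have "generate G (\<Union>(set Ks)) \<subseteq> generate G (\<Union>(set (K # Ks)))"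
      by (rule mono_generate) auto
    moreover have "x \<in> generate G (\<Union>(set (K # Ks)))"
      using Cons by (intro generate.incl) auto
    ultimately show ?case
      using Cons.IH generate.eng[of x G "\<Union>(set (K # Ks))" "tuple_prod G xs"] by auto
  qed (simp add: generate.one)
  show "tuple_prod G xs \<in> generate G (\<Union>(set Hs))"
    using mem assms(2) .
  show "set xs \<subseteq> {\<one>}" if "tuple_prod G xs = \<one>"
    using assms(2,1) that
  proof (induction rule: list_all2_induct)
    case (Cons x xs K Ks)
    have K: "subgroup K G" and int: "K \<inter> generate G (\<Union>(set Ks)) = {\<one>}" and ind: "independent_family G Ks"
      using Cons.prems by auto
    let ?p = "tuple_prod G xs"
    have p: "?p \<in> generate G (\<Union>(set Ks))" using Cons.hyps mem by simp
    have pc: "?p \<in> carrier G" using generate_in_carrier[OF independent_carrier[OF ind] p] .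
    have xc: "x \<in> carrier G" by (rule subgroup.mem_carrier[OF K Cons.hyps(1)])
    have eq: "x \<otimes> ?p = \<one>" using Cons.prems by simp
    \<comment> \<open>The product of the tail is thereby in K as well as in the subgroup generated
      by the tail, hence trivial.\<close>
    then have "?p = inv x" using xc pc by (metis inv_equality inv_inv)
    then have "?p \<in> K" using K Cons.hyps(1) by (simp add: subgroup.m_inv_closed)
    then have "?p = \<one>" using p int by blast
    then show ?case using eq xc Cons.IH ind by simp
  qed simp
  show "tuple_prod G (map2 (\<otimes>) xs ys) = tuple_prod G xs \<otimes> tuple_prod G ys" if "list_all2 (\<in>) ys Hs"
    using assms(2,1) that
  proof (induction arbitrary: ys rule: list_all2_induct)
    case (Cons x xs K Ks)
    then obtain y ys' where ys: "ys = y # ys'" "y \<in> K" "list_all2 (\<in>) ys' Ks"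
      by (auto simp: list_all2_Cons2)
    have K: "subgroup K G" and com: "\<And>x y. x \<in> K \<Longrightarrow> y \<in> \<Union>(set Ks) \<Longrightarrow> x \<otimes> y = y \<otimes> x"
      and ind: "independent_family G Ks"
      using Cons.prems by auto
    note Kc = independent_carrier[OF ind]
    have p: "tuple_prod G xs \<in> generate G (\<Union>(set Ks))" "tuple_prod G ys' \<in> generate G (\<Union>(set Ks))"
      using mem Cons.hyps(2) ys(3) by auto
    have c: "x \<in> carrier G" "y \<in> carrier G" "tuple_prod G xs \<in> carrier G" "tuple_prod G ys' \<in> carrier G"
      using p generate_in_carrier[OF Kc] subgroup.mem_carrier[OF K] Cons.hyps(1) ys(2) by simp_all
    have "y \<otimes> tuple_prod G xs = tuple_prod G xs \<otimes> y"
      using com ys(2) by (intro commute_generate_right[OF c(2) Kc _ p(1)]) auto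
    then have "(x \<otimes> y) \<otimes> (tuple_prod G xs \<otimes> tuple_prod G ys')
        = (x \<otimes> tuple_prod G xs) \<otimes> (y \<otimes> tuple_prod G ys')"
      using c by (simp add: m_assoc) (metis m_assoc)
    then show ?case using Cons.IH[OF ind ys(3)] by (simp add: ys(1))
  qed simp
qed

lemma internal_direct_product_independent:
  assumes ind: "independent_family G Hs" and H: "generate G (\<Union>(set Hs)) = H"
  shows "internal_direct_product G H Hs"
proof -
  let ?n = "length Hs"
  let ?P = "product_group {..<?n} (\<lambda>i. G\<lparr>carrier := Hs ! i\<rparr>)"
  let ?f = "\<lambda>h. tuple_prod G (map h [0..<?n])"
  have sub: "\<forall>K\<in>set Hs. subgroup K G"
    using ind[folded free_family_iff_independent] by (simp add: free_family_def)
  have HG: "subgroup H G"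
    unfolding H[symmetric] by (rule generate_is_subgroup[OF independent_carrier[OF ind]])
  interpret P: Group.group ?P
    using sub by (intro product_group) (auto intro!: subgroup_imp_group)
  have all2: "list_all2 (\<in>) (map h [0..<?n]) Hs" if "h \<in> carrier ?P" for h
    using that by (auto simp: list_all2_conv_all_nth PiE_iff)
  have fH: "?f h \<in> H" if "h \<in> carrier ?P" for h
    using tuple_prod_independent(1)[OF ind all2[OF that]] H by simp
  have mult: "?f (h \<otimes>\<^bsub>?P\<^esub> k) = ?f h \<otimes> ?f k" if "h \<in> carrier ?P" "k \<in> carrier ?P" for h k
  proof -
    have "map (h \<otimes>\<^bsub>?P\<^esub> k) [0..<?n] = map2 (\<otimes>) (map h [0..<?n]) (map k [0..<?n])"
      by (auto intro!: nth_equalityI)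
    then show ?thesis
      using tuple_prod_independent(3)[OF ind all2[OF that(1)] all2[OF that(2)]] by simp
  qed
  interpret f: group_hom ?P G ?f
    using fH mult subgroup.mem_carrier[OF HG] by unfold_locales (auto simp: hom_def)
  have "x = \<one>\<^bsub>?P\<^esub>" if x: "x \<in> carrier ?P" "?f x = \<one>" for x
  proof -
    have "set (map x [0..<?n]) \<subseteq> {\<one>}" by (rule tuple_prod_independent(2)[OF ind all2[OF x(1)] x(2)])
    then have "x i = \<one>\<^bsub>?P\<^esub> i" if "i \<in> {..<?n}" for i
      using that by (auto simp: image_subset_iff)
    then show ?thesis
      by (rule PiE_ext[OF x(1)[unfolded carrier_product_group] P.one_closed[unfolded carrier_product_group]])
  qed
  then have "inj_on ?f (carrier ?P)" unfolding f.inj_on_one_iff by blast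
  moreover have "?f ` carrier ?P = H"
  proof
    \<comment> \<open>The image is a subgroup, so for surjectivity it suffices to reach each member;
      an element of the i-th member is the image of the family having it at i and \<one>
      elsewhere.\<close>
    have "K \<subseteq> ?f ` carrier ?P" if K: "K \<in> set Hs" for K
    proof
      fix x assume "x \<in> K"
      obtain i where i: "i < ?n" "Hs ! i = K" using K by (auto simp: in_set_conv_nth)
      have xc: "x \<in> carrier G" by (rule subgroup.mem_carrier[OF bspec[OF sub K] \<open>x \<in> K\<close>])
      let ?h = "\<lambda>j\<in>{..<?n}. if j = i then x else \<one>"
      have h: "?h \<in> carrier ?P"
        unfolding carrier_product_group
      proof (rule restrict_PiE_iff[THEN iffD2], rule ballI)
        fix j assume "j \<in> {..<?n}"
        then have "\<one> \<in> Hs ! j" using sub by (intro subgroup.one_closed) simp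
        then show "(if j = i then x else \<one>) \<in> carrier (G\<lparr>carrier := Hs ! j\<rparr>)"
          using i \<open>x \<in> K\<close> by simp
      qed
      have single: "tuple_prod G (map (\<lambda>j. if j = i then x else \<one>) js) = (if i \<in> set js then x else \<one>)"
        if "distinct js" for js
        using that xc by (induction js) auto
      have map_h: "map ?h [0..<?n] = map (\<lambda>j. if j = i then x else \<one>) [0..<?n]"
        by simp
      have "?f ?h = x" unfolding map_h using single[of "[0..<?n]"] i(1) by simp
      then show "x \<in> ?f ` carrier ?P" using h by (metis (no_types, lifting) image_eqI)
    qed
    then show "H \<subseteq> ?f ` carrier ?P"
      unfolding H[symmetric] by (intro generate_subgroup_incl f.img_is_subgroup) auto
  qed (use fH in auto)
  ultimately have "?f \<in> iso ?P (G\<lparr>carrier := H\<rparr>)"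
    using fH mult by (auto simp: iso_def bij_betw_def hom_def)
  then show ?thesis using sub HG by (simp add: internal_direct_product_def)
qed

end

section \<open>Components with a given group\<close>

text \<open>A duplicate-free list is padded with copies of one element. This lets classes of
  different sizes be listed with lengths prescribed by \<xi>.\<close>

lemma ex_list_set_length:
  assumes "finite S" "S \<noteq> {}" "card S \<le> n"
  shows "\<exists>xs. set xs = S \<and> length xs = n"
proof -
  obtain xs where xs: "set xs = S" "distinct xs" using finite_distinct_list[OF assms(1)] by blast
  obtain x where "x \<in> S" using assms(2) by blast
  moreover have "length xs \<le> n" using xs assms(3) distinct_card by fastforce
  ultimately show ?thesis
    using xs(1) by (intro exI[of _ "xs @ replicate (n - length xs) x"]) auto
qed

locale hurwitz_data = Group.group G for G (structure) +
  fixes D :: "'a set set" and \<xi> :: "'a set \<Rightarrow> nat"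
  assumes finite_carrier: "finite (carrier G)"
    and D_nonempty: "D \<noteq> {}"
    and D_classes: "D \<subseteq> conj_classes G - {{\<one>}}"
    and \<xi>_pos: "\<gamma> \<in> D \<Longrightarrow> \<xi> \<gamma> > 0"
begin

abbreviation "\<M> \<equiv> Comp G D \<xi>"

abbreviation R :: "('a list set \<Rightarrow> 'k::field) ring"
  where "R \<equiv> comp_ring G D \<xi>"

sublocale M: comm_monoid \<M>
  by (rule comm_monoid_Comp)

lemma D_conj_classes: "\<gamma> \<in> D \<Longrightarrow> \<gamma> \<in> conj_classes G"
  using D_classes by blast

lemma finite_D: "finite D"
  using finite_subset[of D "conj_classes G"] finite_carrier D_classes by (auto simp: conj_classes_def)

lemma one_notin_class:
  assumes "\<gamma> \<in> D"
  shows "\<one> \<notin> \<gamma>"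
proof
  assume "\<one> \<in> \<gamma>"
  moreover have "{\<one>} = conj_class G \<one>" by (auto simp: conj_class_def intro!: exI[of _ \<one>])
  then have "{\<one>} \<in> conj_classes G" unfolding conj_classes_def by blast
  ultimately have "\<gamma> = {\<one>}"
    using conj_classes_disjoint[OF D_conj_classes[OF assms]] by blast
  then show False using assms D_classes by blast
qed

lemma D_generated_subgroup: "D_generated G D H \<Longrightarrow> subgroup H G"
  by (simp add: D_generated_def)

lemma D_generated_nontrivial: "D_generated G D H \<Longrightarrow> H \<noteq> {\<one>}"
  using D_nonempty one_notin_class by (auto simp: D_generated_def)

text \<open>The action preserves lengths, and a tuple of degree n has length n times the sum of
  \<xi> over D, which is positive.\<close>

lemma degree_unique:
  assumes "m \<in> components G D \<xi> n" "m \<in> components G D \<xi> n'"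
  shows "n = n'"
proof -
  have "(\<Sum>\<gamma>\<in>D. \<xi> \<gamma>) > 0"
    using finite_D D_nonempty \<xi>_pos by (auto intro!: sum_pos)
  obtain g where g: "g \<in> comp_tuples G D \<xi> n" "set g \<subseteq> carrier G" "m = hurwitz_orbit G g"
    using assms(1) by (rule componentsE)
  obtain h where h: "h \<in> comp_tuples G D \<xi> n'" "set h \<subseteq> carrier G" "m = hurwitz_orbit G h"
    using assms(2) by (rule componentsE)
  show ?thesis
    using \<open>(\<Sum>\<gamma>\<in>D. \<xi> \<gamma>) > 0\<close> g(1) h(1)
    using hurwitz_orbit_in_carrier(2)[OF h(2), of g] hurwitz_orbit_refl[OF g(2)] g(3) h(3)
    by (simp add: comp_tuples_def tuples_def)
qed

lemma degree_zero: "m \<in> components G D \<xi> 0 \<Longrightarrow> m = \<one>\<^bsub>\<M>\<^esub>"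
  by (auto elim!: componentsE simp: Comp_one comp_tuples_def tuples_def)

lemma components_one_iff: "m \<in> components G D \<xi> n \<Longrightarrow> m = \<one>\<^bsub>\<M>\<^esub> \<longleftrightarrow> n = 0"
  using degree_zero degree_unique[OF components_one] by auto

text \<open>If all entries are \<one>, then none lies in a class from D, while
  \<open>n * \<xi> \<gamma>\<close> of them must; hence n = 0.\<close>

lemma comp_group_trivial_iff:
  assumes "m \<in> carrier \<M>"
  shows "comp_group G m \<subseteq> {\<one>} \<longleftrightarrow> m = \<one>\<^bsub>\<M>\<^esub>"
proof
  assume triv: "comp_group G m \<subseteq> {\<one>}"
  obtain n where n: "m \<in> components G D \<xi> n" using assms by (auto simp: carrier_Comp)
  then obtain g where g: "g \<in> comp_tuples G D \<xi> n" "set g \<subseteq> carrier G" "m = hurwitz_orbit G g"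
    by (rule componentsE)
  obtain \<gamma> where \<gamma>: "\<gamma> \<in> D" using D_nonempty by blast
  have "set g \<subseteq> {\<one>}"
    using triv generate.incl[of _ "set g" G] by (auto simp: g(3) comp_group_orbit[OF g(2)])
  then have "filter (\<lambda>x. x \<in> \<gamma>) g = []"
    using one_notin_class[OF \<gamma>] by (auto simp: filter_empty_conv)
  moreover have "length (filter (\<lambda>x. x \<in> \<gamma>) g) = n * \<xi> \<gamma>"
    using g(1) \<gamma> by (simp add: comp_tuples_def)
  ultimately have "n = 0" using \<xi>_pos[OF \<gamma>] by simp
  then show "m = \<one>\<^bsub>\<M>\<^esub>" using n degree_zero by simp
qed (simp add: comp_group_one)

text \<open>Degrees add up and vanish only at the trivial component, so both factors in a nontrivial
  factorization have smaller degree.\<close>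

lemma comp_induct [consumes 1, case_names one nonfactorizable mult]:
  assumes "m \<in> carrier \<M>" "P \<one>\<^bsub>\<M>\<^esub>" "\<And>m. nonfactorizable \<M> m \<Longrightarrow> P m"
    "\<And>a b. \<lbrakk>a \<in> carrier \<M>; b \<in> carrier \<M>; P a; P b\<rbrakk> \<Longrightarrow> P (a \<otimes>\<^bsub>\<M>\<^esub> b)"
  shows "P m"
proof -
  have "P m" if "m \<in> components G D \<xi> n" for n
    using that
  proof (induction n arbitrary: m rule: less_induct)
    case (less n)
    have m: "m \<in> carrier \<M>" using less.prems components_in_Comp by blast
    show ?case
    proof (cases "m = \<one>\<^bsub>\<M>\<^esub> \<or> nonfactorizable \<M> m")
      case True
      then show ?thesis using assms(2,3) by blast
    next
      case False
      then obtain a b where ab: "a \<in> carrier \<M>" "a \<noteq> \<one>\<^bsub>\<M>\<^esub>" "b \<in> carrier \<M>" "b \<noteq> \<one>\<^bsub>\<M>\<^esub>" "m = a \<otimes>\<^bsub>\<M>\<^esub> b"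
        using m unfolding nonfactorizable_def by blast
      obtain i j where ij: "a \<in> components G D \<xi> i" "b \<in> components G D \<xi> j"
        using ab by (auto simp: carrier_Comp)
      then have "i \<noteq> 0" "j \<noteq> 0" using ab components_one_iff by blast+
      moreover have "i + j = n"
        using components_mult[OF ij] less.prems degree_unique by (simp add: ab(5))
      ultimately show ?thesis
        unfolding ab(5) using less.IH[OF _ ij(1)] less.IH[OF _ ij(2)] by (intro assms(4)[OF ab(1,3)]) auto
    qed
  qed
  then show ?thesis using assms(1) by (auto simp: carrier_Comp)
qed

text \<open>The tuple runs through the elements of H in the classes from D and repeats each entry as
  often as the order of G. Repetition makes every block have product \<one>, and the padded lists
  give each class the proportion prescribed by \<xi>.\<close>

lemma ex_component_with_group:
  assumes H: "D_generated G D H"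
  shows "\<exists>n>0. \<exists>m\<in>components G D \<xi> n. comp_group G m = H"
proof -
  \<comment> \<open>Both are the order of G, in different roles: \<open>?e\<close> is an exponent
    killing every element, \<open>?c\<close> bounds the number of elements of any class in H. The
    degree obtained is \<open>?e * ?c\<close>.\<close>
  let ?e = "order G" and ?c = "card (carrier G)"
  have HG: "subgroup H G" and Hc: "H \<subseteq> carrier G"
    using D_generated_subgroup[OF H] subgroup.subset by auto
  have "\<exists>xs. set xs = \<gamma> \<inter> H \<and> length xs = ?c * \<xi> \<gamma>" if \<gamma>: "\<gamma> \<in> D" for \<gamma>
  proof (rule ex_list_set_length)
    have "card (\<gamma> \<inter> H) \<le> ?c" using Hc finite_carrier by (intro card_mono) auto
    then show "card (\<gamma> \<inter> H) \<le> ?c * \<xi> \<gamma>" using \<xi>_pos[OF \<gamma>] by (metis One_nat_def Suc_leI le_trans mult.right_neutral mult_le_mono2)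
    show "finite (\<gamma> \<inter> H)" using Hc finite_carrier finite_subset by blast
    show "\<gamma> \<inter> H \<noteq> {}" using H \<gamma> by (simp add: D_generated_def)
  qed
  then obtain z where z: "\<And>\<gamma>. \<gamma> \<in> D \<Longrightarrow> set (z \<gamma>) = \<gamma> \<inter> H \<and> length (z \<gamma>) = ?c * \<xi> \<gamma>" by metis
  define L where "L \<gamma> = concat (map (replicate ?e) (z \<gamma>))" for \<gamma>
  have e: "?e > 0" using finite_carrier order_gt_0_iff_finite by blast
  have lenL: "length (L \<gamma>) = ?e * ?c * \<xi> \<gamma>" if "\<gamma> \<in> D" for \<gamma>
    using z[OF that] by (simp add: L_def length_concat comp_def sum_list_triv)
  have setL: "set (L \<gamma>) = \<gamma> \<inter> H" if "\<gamma> \<in> D" for \<gamma>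
    using z[OF that] e by (auto simp: L_def)
  have prod_rep: "tuple_prod G (replicate n x) = x [^] n" if "x \<in> carrier G" for x and n :: nat
    using that by (induction n) (auto simp: nat_pow_comm[of x 1, simplified])
  have prod_one: "tuple_prod G (concat xss) = \<one>"
    if "\<And>xs. xs \<in> set xss \<Longrightarrow> set xs \<subseteq> carrier G \<and> tuple_prod G xs = \<one>" for xss
    using that
  proof (induction xss)
    case (Cons xs xss)
    have "set (concat xss) \<subseteq> carrier G" using Cons.prems by fastforce
    then show ?case using Cons by (simp add: tuple_prod_append)
  qed simp
  have prodL: "tuple_prod G (L \<gamma>) = \<one>" if "\<gamma> \<in> D" for \<gamma>
    unfolding L_def
  proof (rule prod_one)
    fix xs assume "xs \<in> set (map (replicate ?e) (z \<gamma>))"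
    then obtain x where "x \<in> set (z \<gamma>)" "xs = replicate ?e x" by auto
    moreover from this have "x \<in> carrier G" using z[OF \<open>\<gamma> \<in> D\<close>] Hc by auto
    ultimately show "set xs \<subseteq> carrier G \<and> tuple_prod G xs = \<one>" by (auto simp: prod_rep pow_order_eq_1)
  qed
  obtain ds where ds: "set ds = D" "distinct ds" using finite_distinct_list[OF finite_D] by blast
  define g where "g = concat (map L ds)"
  have setg: "set g = (\<Union>\<gamma>\<in>D. \<gamma> \<inter> H)"
    using setL by (simp add: g_def ds(1))
  have gc: "set g \<subseteq> carrier G" using setg Hc by auto
  have grp: "generate G (set g) = H" using H by (simp add: setg D_generated_def)
  have "tuple_prod G g = \<one>"
    unfolding g_def using prodL setL Hc by (intro prod_one) (auto simp: ds(1))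
  moreover have "length g = ?e * ?c * (\<Sum>\<gamma>\<in>D. \<xi> \<gamma>)"
    using ds lenL by (simp add: g_def length_concat comp_def sum_list_distinct_conv_sum_set sum_distrib_left)
  moreover have "length (filter (\<lambda>x. x \<in> \<gamma>) g) = ?e * ?c * \<xi> \<gamma>" if \<gamma>: "\<gamma> \<in> D" for \<gamma>
  proof -
    \<comment> \<open>Distinct classes are disjoint, so entries in a given class come only from the
      block built for it.\<close>
    have "length (filter (\<lambda>x. x \<in> \<gamma>) (L \<delta>)) = (if \<delta> = \<gamma> then ?e * ?c * \<xi> \<gamma> else 0)" if \<delta>: "\<delta> \<in> D" for \<delta>
    proof (cases "\<delta> = \<gamma>")
      case True
      then have "filter (\<lambda>x. x \<in> \<gamma>) (L \<delta>) = L \<delta>" using setL[OF \<delta>] by (simp add: filter_id_conv)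
      then show ?thesis using lenL[OF \<delta>] True by simp
    next
      case False
      then have "filter (\<lambda>x. x \<in> \<gamma>) (L \<delta>) = []"
        using setL[OF \<delta>] conj_classes_disjoint[OF D_conj_classes[OF \<gamma>] D_conj_classes[OF \<delta>]]
        by (auto simp: filter_empty_conv)
      then show ?thesis using False by simp
    qed
    then have "length (filter (\<lambda>x. x \<in> \<gamma>) g) = (\<Sum>\<delta>\<in>D. if \<delta> = \<gamma> then ?e * ?c * \<xi> \<gamma> else 0)"
      using ds by (simp add: g_def filter_concat length_concat comp_def sum_list_distinct_conv_sum_set)
    then show ?thesis using finite_D \<gamma> by simp
  qed
  ultimately have "g \<in> comp_tuples G D \<xi> (?e * ?c)"
    using gc by (simp add: comp_tuples_def tuples_def)
  moreover have "comp_group G (hurwitz_orbit G g) = H"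
    using comp_group_orbit[OF gc] grp by simp
  moreover have "?e * ?c > 0" using e by (simp add: order_def)
  ultimately show ?thesis unfolding components_def by blast
qed

section \<open>Factor families\<close>

text \<open>Every component with group inside H has its group inside the subgroup generated by the
  family, because this holds for its non-factorizable factors. Some component has group exactly
  H.\<close>

lemma factor_family_generate:
  assumes H: "D_generated G D H" and fac: "factor_family G D \<xi> H Hs"
  shows "generate G (\<Union>(set Hs)) = H"
proof
  note HG = D_generated_subgroup[OF H]
  have KH: "\<Union>(set Hs) \<subseteq> H" using fac by (auto simp: factor_family_def)
  then show "generate G (\<Union>(set Hs)) \<subseteq> H" by (rule generate_subgroup_incl[OF _ HG])
  have KG: "subgroup (generate G (\<Union>(set Hs))) G"
    using KH subgroup.subset[OF HG] by (intro generate_is_subgroup) blast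
  have "comp_group G m \<subseteq> H \<longrightarrow> comp_group G m \<subseteq> generate G (\<Union>(set Hs))" if "m \<in> carrier \<M>" for m
    using that
  proof (induction rule: comp_induct)
    case one
    then show ?case by (simp add: comp_group_one generate.one)
  next
    case (nonfactorizable m)
    then show ?case using fac generate.incl[of _ "\<Union>(set Hs)" G] unfolding factor_family_def by blast
  next
    case (mult a b)
    then show ?case using comp_group_mult_subset_iff HG KG by simp
  qed
  then show "H \<subseteq> generate G (\<Union>(set Hs))"
    using ex_component_with_group[OF H] components_in_Comp by blast
qed

text \<open>Each non-factorizable factor of m has its group in some member of the family.
  Commutativity allows the factors assigned to the i-th member to be collected in a and all others
  in b.\<close>

lemma factor_family_split:
  assumes HG: "subgroup H G" and fac: "factor_family G D \<xi> H Hs" and i: "i < length Hs"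
    and m: "m \<in> carrier \<M>" "comp_group G m \<subseteq> H"
  obtains a b where "a \<in> carrier \<M>" "b \<in> carrier \<M>" "m = a \<otimes>\<^bsub>\<M>\<^esub> b"
    "comp_group G a \<subseteq> Hs ! i" "comp_group G b \<subseteq> generate G (\<Union>j\<in>{..<length Hs} - {i}. Hs ! j)"
proof -
  let ?L = "generate G (\<Union>j\<in>{..<length Hs} - {i}. Hs ! j)"
  have sub: "subgroup (Hs ! j) G" if "j < length Hs" for j
    using fac that D_generated_subgroup by (simp add: factor_family_def)
  have "(\<Union>j\<in>{..<length Hs} - {i}. Hs ! j) \<subseteq> carrier G"
    using sub subgroup.subset by fastforce
  then have LG: "subgroup ?L G" by (rule generate_is_subgroup)
  have "comp_group G m \<subseteq> H \<longrightarrow> (\<exists>a\<in>carrier \<M>. \<exists>b\<in>carrier \<M>. m = a \<otimes>\<^bsub>\<M>\<^esub> b \<and>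
      comp_group G a \<subseteq> Hs ! i \<and> comp_group G b \<subseteq> ?L)"
    using m(1)
  proof (induction rule: comp_induct)
    case one
    have "\<one> \<in> Hs ! i" using sub[OF i] by (rule subgroup.one_closed)
    then show ?case
      by - (rule impI, rule bexI[of _ "\<one>\<^bsub>\<M>\<^esub>"], rule bexI[of _ "\<one>\<^bsub>\<M>\<^esub>"], auto simp: comp_group_one generate.one)
  next
    case (nonfactorizable m)
    show ?case
    proof
      assume "comp_group G m \<subseteq> H"
      then obtain K where "K \<in> set Hs" "comp_group G m \<subseteq> K"
        using fac nonfactorizable unfolding factor_family_def by blast
      then obtain j where j: "j < length Hs" "comp_group G m \<subseteq> Hs ! j"
        by (auto simp: in_set_conv_nth)
      have mc: "m \<in> carrier \<M>" using nonfactorizable by (simp add: nonfactorizable_def)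
      show "\<exists>a\<in>carrier \<M>. \<exists>b\<in>carrier \<M>. m = a \<otimes>\<^bsub>\<M>\<^esub> b \<and>
          comp_group G a \<subseteq> Hs ! i \<and> comp_group G b \<subseteq> ?L"
      proof (cases "j = i")
        case True
        then show ?thesis using mc j(2)
          by - (rule bexI[of _ m], rule bexI[of _ "\<one>\<^bsub>\<M>\<^esub>"], auto simp: comp_group_one generate.one)
      next
        case False
        then have "Hs ! j \<subseteq> ?L" using j(1) by (auto intro!: generate.incl)
        moreover have "\<one> \<in> Hs ! i" using sub[OF i] by (rule subgroup.one_closed)
        ultimately show ?thesis using mc j(2)
          by - (rule bexI[of _ "\<one>\<^bsub>\<M>\<^esub>"], rule bexI[of _ m], auto simp: comp_group_one)
      qed
    qed
  next
    case (mult x y)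
    show ?case
    proof
      assume "comp_group G (x \<otimes>\<^bsub>\<M>\<^esub> y) \<subseteq> H"
      then have "comp_group G x \<subseteq> H" "comp_group G y \<subseteq> H"
        using comp_group_mult_subset_iff[OF mult(1,2) HG] by auto
      then obtain a b a' b' where ab: "a \<in> carrier \<M>" "b \<in> carrier \<M>" "x = a \<otimes>\<^bsub>\<M>\<^esub> b"
          "comp_group G a \<subseteq> Hs ! i" "comp_group G b \<subseteq> ?L"
        and ab': "a' \<in> carrier \<M>" "b' \<in> carrier \<M>" "y = a' \<otimes>\<^bsub>\<M>\<^esub> b'"
          "comp_group G a' \<subseteq> Hs ! i" "comp_group G b' \<subseteq> ?L"
        using mult(3,4) by blast
      have "x \<otimes>\<^bsub>\<M>\<^esub> y = (a \<otimes>\<^bsub>\<M>\<^esub> a') \<otimes>\<^bsub>\<M>\<^esub> (b \<otimes>\<^bsub>\<M>\<^esub> b')"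
        using ab(1-3) ab'(1-3) by (simp add: M.m_ac)
      moreover have "comp_group G (a \<otimes>\<^bsub>\<M>\<^esub> a') \<subseteq> Hs ! i"
        using comp_group_mult_subset_iff[OF ab(1) ab'(1) sub[OF i]] ab(4) ab'(4) by simp
      moreover have "comp_group G (b \<otimes>\<^bsub>\<M>\<^esub> b') \<subseteq> ?L"
        using comp_group_mult_subset_iff[OF ab(2) ab'(2) LG] ab(5) ab'(5) by simp
      ultimately show "\<exists>a\<in>carrier \<M>. \<exists>b\<in>carrier \<M>. x \<otimes>\<^bsub>\<M>\<^esub> y = a \<otimes>\<^bsub>\<M>\<^esub> b \<and>
          comp_group G a \<subseteq> Hs ! i \<and> comp_group G b \<subseteq> ?L"
        using M.m_closed[OF ab(1) ab'(1)] M.m_closed[OF ab(2) ab'(2)] by blast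
    qed
  qed
  then show ?thesis using that m(2) by blast
qed

text \<open>The group of a could be too small a priori. But an element x of the i-th member lies in
  H and so is u v with u from the group of a and v from that of b; then v =
  \<open>inv u \<otimes> x\<close> lies in the i-th member and in the subgroup generated by the
  others, so v = \<one>.\<close>

lemma free_factor_family_split:
  assumes H: "D_generated G D H" and fac: "free_factor_family G D \<xi> H Hs" and i: "i < length Hs"
    and m: "m \<in> carrier \<M>" "comp_group G m = H"
  obtains a b where "a \<in> carrier \<M>" "b \<in> carrier \<M>" "m = a \<otimes>\<^bsub>\<M>\<^esub> b" "comp_group G a = Hs ! i"
proof -
  let ?U = "\<Union>j\<in>{..<length Hs} - {i}. Hs ! j"
  have fam: "factor_family G D \<xi> H Hs" and free: "free_family G Hs"
    using fac by (simp_all add: free_factor_family_def)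
  obtain a b where ab: "a \<in> carrier \<M>" "b \<in> carrier \<M>" "m = a \<otimes>\<^bsub>\<M>\<^esub> b"
    "comp_group G a \<subseteq> Hs ! i" "comp_group G b \<subseteq> generate G ?U"
    using factor_family_split[OF D_generated_subgroup[OF H] fam i m(1)] m(2) by blast
  have KG: "subgroup (Hs ! i) G" and KH: "Hs ! i \<subseteq> H"
    using fam i D_generated_subgroup by (auto simp: factor_family_def)
  have "generate G (\<Union>j\<in>{i}. Hs ! j) \<inter> generate G ?U = {\<one>}"
    using i by (intro independent_disjoint[OF free_family_independent[OF free]]) auto
  then have int: "Hs ! i \<inter> generate G ?U = {\<one>}" using generate_subgroup_eq[OF KG] by simp
  have Uc: "?U \<subseteq> carrier G"
  proof
    fix u assume "u \<in> ?U"
    then obtain j where "j < length Hs" "u \<in> Hs ! j" by blast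
    then show "u \<in> carrier G"
      using free by (auto simp: free_family_def dest: subgroup.mem_carrier)
  qed
  have aG: "subgroup (comp_group G a) G" and bG: "subgroup (comp_group G b) G"
    using subgroup_comp_group ab by auto
  have gab: "generate G (comp_group G a \<union> comp_group G b) = H"
    using comp_group_mult[OF ab(1,2)] ab(3) m(2) by simp
  have "Hs ! i \<subseteq> comp_group G a"
  proof
    fix x assume x: "x \<in> Hs ! i"
    then have "x \<in> generate G (comp_group G a \<union> comp_group G b)" using KH gab by blast
    then obtain u v where uv: "u \<in> generate G (comp_group G a)" "v \<in> generate G (comp_group G b)" "x = u \<otimes> v"
    proof (rule generate_Un_commuting[rotated 3])
      fix u v assume "u \<in> comp_group G a" "v \<in> comp_group G b"
      then have u: "u \<in> generate G (Hs ! i)" and v: "v \<in> generate G ?U"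
        using ab(4,5) by (auto intro: generate.incl)
      show "u \<otimes> v = v \<otimes> u"
      proof (rule commute_generate[OF subgroup.subset[OF KG] Uc _ u v])
        fix k l assume "k \<in> Hs ! i" "l \<in> ?U"
        then obtain j where "j < length Hs" "j \<noteq> i" "l \<in> Hs ! j" by blast
        then show "k \<otimes> l = l \<otimes> k"
          using independent_commute[OF free_family_independent[OF free] i] \<open>k \<in> Hs ! i\<close> by blast
      qed
    qed (use subgroup.subset[OF aG] subgroup.subset[OF bG] in auto)
    then have u: "u \<in> comp_group G a" and v: "v \<in> comp_group G b"
      using generate_subgroup_eq[OF aG] generate_subgroup_eq[OF bG] by auto
    have c: "u \<in> carrier G" "v \<in> carrier G"
      using subgroup.mem_carrier[OF aG u] subgroup.mem_carrier[OF bG v] .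
    have "v = inv u \<otimes> x" using c uv(3) by (simp add: inv_cancel_left)
    also have "\<dots> \<in> Hs ! i"
      using u ab(4) x by (intro subgroup.m_closed[OF KG] subgroup.m_inv_closed[OF KG]) auto
    finally have "v = \<one>" using v ab(5) int by blast
    then show "x \<in> comp_group G a" using u uv(3) c by simp
  qed
  then show ?thesis using that ab by blast
qed

text \<open>Strong induction on the order of H. A non-splitter is its own family; otherwise the
  members of a free factor family of size at least 2 are strictly smaller, and the families found
  for them are concatenated.\<close>

lemma ex_free_factor_family_non_splitters:
  assumes split: "\<forall>H\<in>Sub_GD G D - {{\<one>}}. non_splitter G D H \<or> factored_splitter G D \<xi> H"
    and H: "D_generated G D H"
  shows "\<exists>Hs. free_factor_family G D \<xi> H Hs \<and> (\<forall>K\<in>set Hs. non_splitter G D K)"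
  using H
proof (induction "card H" arbitrary: H rule: less_induct)
  case less
  note HG = D_generated_subgroup[OF less.prems]
  have finH: "finite H" using finite_subset[OF subgroup.subset[OF HG] finite_carrier] .
  show ?case
  proof (cases "non_splitter G D H")
    case True
    have "factor_family G D \<xi> H [H]" using less.prems by (simp add: factor_family_def)
    moreover have "independent_family G [H]"
      using HG subgroup.one_closed[OF HG] by (simp add: generate_empty)
    ultimately show ?thesis
      using True by (intro exI[of _ "[H]"]) (simp add: free_factor_family_def free_family_iff_independent)
  next
    case False
    moreover have "H \<in> Sub_GD G D - {{\<one>}}"
      using less.prems D_generated_nontrivial[OF less.prems] by (simp add: Sub_GD_def)
    ultimately have "factored_splitter G D \<xi> H" using split by blast
    then obtain Hs where Hs: "free_factor_family G D \<xi> H Hs" "length Hs \<ge> 2"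
      by (auto simp: factored_splitter_def)
    have fam: "factor_family G D \<xi> H Hs" and free: "free_family G Hs"
      using Hs(1) by (simp_all add: free_factor_family_def)
    have gen: "D_generated G D K" "K \<subseteq> H" if "K \<in> set Hs" for K
      using fam that by (simp_all add: factor_family_def)
    have "\<exists>Ks. free_factor_family G D \<xi> K Ks \<and> (\<forall>L\<in>set Ks. non_splitter G D L)" if K: "K \<in> set Hs" for K
    proof (rule less.hyps[OF _ gen(1)[OF K]])
      obtain i where i: "i < length Hs" "K = Hs ! i" using K by (auto simp: in_set_conv_nth)
      \<comment> \<open>Any index other than i serves. The member at j is nontrivial, lies in H and
        meets K trivially, so K is a proper subgroup of H.\<close>
      define j :: nat where "j = (if i = 0 then 1 else 0)"
      have j: "j < length Hs" "j \<noteq> i" using Hs(2) by (auto simp: j_def)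
      have "generate G (\<Union>k\<in>{i}. Hs ! k) \<inter> generate G (\<Union>k\<in>{j}. Hs ! k) = {\<one>}"
        using i j by (intro independent_disjoint[OF free_family_independent[OF free]]) auto
      then have "Hs ! i \<inter> Hs ! j = {\<one>}"
        using i j gen D_generated_subgroup by (simp add: generate_subgroup_eq)
      moreover have "Hs ! j \<subseteq> H" "Hs ! j \<noteq> {\<one>}"
        using gen[OF nth_mem[OF j(1)]] D_generated_nontrivial by auto
      ultimately have "K \<noteq> H" using i(2) by blast
      then show "card K < card H" using gen(2)[OF K] finH by (intro psubset_card_mono) auto
    qed
    then obtain f where f: "\<And>K. K \<in> set Hs \<Longrightarrow> free_factor_family G D \<xi> K (f K) \<and> (\<forall>L\<in>set (f K). non_splitter G D L)"
      by metis
    let ?Ks = "concat (map f Hs)"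
    have ind: "independent_family G ?Ks"
    proof (rule independent_concat)
      fix K assume "K \<in> set Hs"
      then have "free_family G (f K)" "\<forall>L\<in>set (f K). L \<subseteq> K"
        using f by (simp_all add: free_factor_family_def factor_family_def)
      then show "independent_family G (f K) \<and> \<Union>(set (f K)) \<subseteq> K"
        by (auto simp: free_family_iff_independent)
    qed (use free free_family_independent in blast)
    have "factor_family G D \<xi> H ?Ks"
      unfolding factor_family_def
    proof (intro conjI allI impI)
      show "\<forall>L\<in>set ?Ks. D_generated G D L \<and> L \<subseteq> H"
        using f gen by (fastforce simp: free_factor_family_def factor_family_def)
      fix m assume m: "nonfactorizable \<M> m" "comp_group G m \<subseteq> H"
      then obtain K where K: "K \<in> set Hs" "comp_group G m \<subseteq> K"
        using fam unfolding factor_family_def by blast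
      then obtain L where "L \<in> set (f K)" "comp_group G m \<subseteq> L"
        using f m(1) unfolding factor_family_def free_factor_family_def by blast
      then show "\<exists>L\<in>set ?Ks. comp_group G m \<subseteq> L" using K(1) by auto
    qed
    then show ?thesis
      using ind f
      by (intro exI[of _ ?Ks]) (auto simp: free_factor_family_def free_family_iff_independent)
  qed
qed

end

section \<open>Strata\<close>

lemma (in comm_monoid) monoid_ring_minus:
  assumes "f \<in> carrier (monoid_ring G :: ('a \<Rightarrow> 'k::field) ring)" "g \<in> carrier (monoid_ring G)"
  shows "f \<ominus>\<^bsub>monoid_ring G\<^esub> g = (\<lambda>x. f x - g x)"
proof
  let ?R = "monoid_ring G :: ('a \<Rightarrow> 'k) ring"
  interpret R: cring ?R by (rule cring_monoid_ring)
  fix x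
  have "f \<ominus>\<^bsub>?R\<^esub> g \<oplus>\<^bsub>?R\<^esub> g = f"
    using assms by (simp add: R.minus_eq R.a_assoc R.l_neg)
  then have "(f \<ominus>\<^bsub>?R\<^esub> g) x + g x = f x"
    by (metis monoid_ring_simps(3))
  then show "(f \<ominus>\<^bsub>?R\<^esub> g) x = f x - g x" by (simp add: eq_diff_eq)
qed

lemma restr_ident: "f \<in> lin_span N \<Longrightarrow> restr N f = f"
  by (rule ext) (auto simp: lin_span_eq restr_def)

lemma restr_delta: "restr N (delta m) = (if m \<in> N then delta m else (\<lambda>x. 0))"
  by (auto simp: restr_def delta_def)

context hurwitz_data
begin

lemma R_eq: "R = monoid_ring \<M>"
  by (simp add: comp_ring_def)

lemma delta_R [simp]: "m \<in> carrier \<M> \<Longrightarrow> delta m \<in> carrier R"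
  by (simp add: R_eq)

lemma delta_mult_R:
  "m \<in> carrier \<M> \<Longrightarrow> m' \<in> carrier \<M> \<Longrightarrow> delta m \<otimes>\<^bsub>R\<^esub> delta m' = delta (m \<otimes>\<^bsub>\<M>\<^esub> m')"
  by (simp add: R_eq M.delta_mult)

lemma face_comp_group:
  assumes "subgroup H G"
  shows "face \<M> {m \<in> carrier \<M>. comp_group G m \<subseteq> H}"
  using assms comp_group_mult_subset_iff[OF _ _ assms] subgroup.one_closed[OF assms]
  by (auto simp: face_def comp_group_one)

lemma face_one: "face \<M> {\<one>\<^bsub>\<M>\<^esub>}"
proof -
  have "{m \<in> carrier \<M>. comp_group G m \<subseteq> {\<one>}} = {\<one>\<^bsub>\<M>\<^esub>}"
    using comp_group_trivial_iff by auto
  then show ?thesis using face_comp_group[OF triv_subgroup] by simp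
qed

lemma varpi_eq: "varpi G D \<xi> = Idl\<^bsub>R\<^esub> (delta ` (carrier \<M> - {\<one>\<^bsub>\<M>\<^esub>}))"
proof -
  have "(\<Union>n\<in>{0<..}. components G D \<xi> n) = carrier \<M> - {\<one>\<^bsub>\<M>\<^esub>}"
  proof (intro subset_antisym subsetI)
    fix m assume "m \<in> (\<Union>n\<in>{0<..}. components G D \<xi> n)"
    then obtain n where "n > 0" "m \<in> components G D \<xi> n" by blast
    then show "m \<in> carrier \<M> - {\<one>\<^bsub>\<M>\<^esub>}"
      using components_one_iff[of m n] components_in_Comp by auto
  next
    fix m assume m: "m \<in> carrier \<M> - {\<one>\<^bsub>\<M>\<^esub>}"
    then obtain n where "m \<in> components G D \<xi> n" by (auto simp: carrier_Comp)
    then show "m \<in> (\<Union>n\<in>{0<..}. components G D \<xi> n)"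
      using components_one_iff[of m n] m by blast
  qed
  then show ?thesis by (simp add: varpi_def)
qed

lemma primeideal_varpi: "primeideal (varpi G D \<xi>) R"
  unfolding varpi_eq unfolding R_eq M.augmentation_ideal(1)[OF face_one]
  by (rule M.augmentation_ideal(2)[OF face_one])

lemma delta_in_varpi_iff:
  assumes "m \<in> carrier \<M>"
  shows "delta m \<in> (varpi G D \<xi> :: ('a list set \<Rightarrow> 'k::field) set) \<longleftrightarrow> m \<noteq> \<one>\<^bsub>\<M>\<^esub>"
  unfolding varpi_eq unfolding R_eq M.augmentation_ideal(1)[OF face_one]
  using assms by simp (simp add: delta_def)

lemma eq_varpiI:
  assumes "primeideal p R" "\<And>m. m \<in> carrier \<M> \<Longrightarrow> m \<noteq> \<one>\<^bsub>\<M>\<^esub> \<Longrightarrow> delta m \<in> p"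
  shows "p = varpi G D \<xi>"
  unfolding varpi_eq unfolding R_eq M.augmentation_ideal(1)[OF face_one]
  using assms unfolding R_eq by (intro M.augmentation_ideal(3)[OF face_one]) auto

section \<open>Primes studied through the components they contain\<close>

context
  fixes p :: "('a list set \<Rightarrow> 'k::field) set"
  assumes p: "primeideal p R"
begin

interpretation p: primeideal p R
  by (rule p)

lemma delta_one_notin_prime: "delta \<one>\<^bsub>\<M>\<^esub> \<notin> p"
  using p.one_imp_carrier p.I_notcarr by (auto simp: R_eq monoid_ring_simps)

lemma delta_mult_in_prime_iff:
  assumes "m \<in> carrier \<M>" "m' \<in> carrier \<M>"
  shows "delta (m \<otimes>\<^bsub>\<M>\<^esub> m') \<in> p \<longleftrightarrow> delta m \<in> p \<or> delta m' \<in> p"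
  using p.I_prime[of "delta m" "delta m'"] p.I_l_closed[of "delta m'" "delta m"]
    p.I_r_closed[of "delta m" "delta m'"] assms
  by (auto simp: delta_mult_R)

lemma delta_pow_in_prime:
  assumes "m \<in> carrier \<M>" "n > 0"
  shows "delta (m [^]\<^bsub>\<M>\<^esub> (n::nat)) \<in> p \<longleftrightarrow> delta m \<in> p"
  using assms(2) by (induction n rule: nat_induct_non_zero) (use assms(1) in \<open>auto simp: delta_mult_in_prime_iff\<close>)

lemma delta_diff_in_prime:
  assumes "m \<in> carrier \<M>" "m' \<in> carrier \<M>" "m\<^sub>0 \<in> carrier \<M>" "delta m\<^sub>0 \<notin> p"
    "m\<^sub>0 \<otimes>\<^bsub>\<M>\<^esub> m = m\<^sub>0 \<otimes>\<^bsub>\<M>\<^esub> m'"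
  shows "delta m \<ominus>\<^bsub>R\<^esub> delta m' \<in> p"
proof -
  have "(delta m\<^sub>0 :: 'a list set \<Rightarrow> 'k) \<otimes>\<^bsub>R\<^esub> (delta m \<ominus>\<^bsub>R\<^esub> delta m') = delta m\<^sub>0 \<otimes>\<^bsub>R\<^esub> delta m \<ominus>\<^bsub>R\<^esub> delta m\<^sub>0 \<otimes>\<^bsub>R\<^esub> delta m'"
    using assms(1-3) by (simp add: p.minus_eq p.r_distr p.r_minus)
  also have "\<dots> = (\<zero>\<^bsub>R\<^esub> :: 'a list set \<Rightarrow> 'k)"
    using assms(1-3,5) by (simp add: delta_mult_R p.minus_eq p.r_neg)
  finally have "delta m\<^sub>0 \<otimes>\<^bsub>R\<^esub> (delta m \<ominus>\<^bsub>R\<^esub> delta m') \<in> p"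
    using additive_subgroup.zero_closed[OF p.additive_subgroup_axioms] by simp
  then show ?thesis
    using p.I_prime[of "delta m\<^sub>0" "delta m \<ominus>\<^bsub>R\<^esub> delta m'"] assms by simp
qed

lemma delta_in_prime_of_diff:
  assumes "m \<in> carrier \<M>" "m' \<in> carrier \<M>" "delta m \<ominus>\<^bsub>R\<^esub> delta m' \<in> p" "delta m' \<in> p"
  shows "delta m \<in> p"
proof -
  have "delta m \<ominus>\<^bsub>R\<^esub> delta m' \<oplus>\<^bsub>R\<^esub> delta m' \<in> p"
    using additive_subgroup.a_closed[OF p.additive_subgroup_axioms assms(3,4)] .
  then show ?thesis using assms(1,2) by (simp add: p.minus_eq p.a_assoc p.l_neg)
qed

lemma lin_span_subset_prime_iff:
  "S \<subseteq> carrier \<M> \<Longrightarrow> lin_span S \<subseteq> p \<longleftrightarrow> (\<forall>m\<in>S. delta m \<in> p)"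
  using p.is_ideal unfolding R_eq by (intro M.lin_span_subset_ideal_iff)

text \<open>A prime contains a sum of ideals when it contains both summands. For the first the
  generators suffice, for the second the basis elements spanning it.\<close>

lemma A_ideal_subset_prime_iff:
  "A_ideal G D \<xi> H \<subseteq> p \<longleftrightarrow>
    (\<forall>m\<in>carrier \<M>. \<not> comp_group G m \<subseteq> H \<longrightarrow> delta m \<in> p) \<and>
    (\<forall>n. \<forall>m\<in>components G D \<xi> n. \<forall>m'\<in>components G D \<xi> n.
      comp_group G m \<subseteq> H \<longrightarrow> comp_group G m' \<subseteq> H \<longrightarrow> delta m \<ominus>\<^bsub>R\<^esub> delta m' \<in> p)"
proof -
  let ?S = "{delta m \<ominus>\<^bsub>R\<^esub> delta m' | m m' n. m \<in> components G D \<xi> n \<and> m' \<in> components G D \<xi> n \<and>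
      comp_group G m \<subseteq> H \<and> comp_group G m' \<subseteq> H} :: ('a list set \<Rightarrow> 'k) set"
  let ?A = "A_circ G D \<xi> H :: ('a list set \<Rightarrow> 'k) set" and ?J = "J_star G D \<xi> H :: ('a list set \<Rightarrow> 'k) set"
  have S: "?S \<subseteq> carrier R"
    by (auto intro!: p.minus_closed delta_R dest: components_in_Comp)
  interpret A: ideal ?A R unfolding A_circ_def by (rule p.genideal_ideal[OF S])
  \<comment> \<open>Adding the zero of one summand embeds the other one in the sum.\<close>
  have zA: "\<zero>\<^bsub>R\<^esub> \<in> ?A" using additive_subgroup.zero_closed[OF A.additive_subgroup_axioms] .
  have zJ: "\<zero>\<^bsub>R\<^esub> \<in> ?J" by (simp add: J_star_def R_eq monoid_ring_simps)
  have Jc: "?J \<subseteq> carrier R"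
    by (auto simp: J_star_def R_eq monoid_ring_eq_lin_span lin_span_eq)
  have "A_ideal G D \<xi> H \<subseteq> p \<longleftrightarrow> ?A \<subseteq> p \<and> ?J \<subseteq> p"
  proof
    assume sub: "A_ideal G D \<xi> H \<subseteq> p"
    have "a \<in> p" if "a \<in> ?A" for a
    proof -
      have "a \<oplus>\<^bsub>R\<^esub> \<zero>\<^bsub>R\<^esub> \<in> A_ideal G D \<xi> H" 
        unfolding A_ideal_def set_add_def' using that zJ by blast
      then show ?thesis using sub that A.a_subset by (metis p.r_zero subsetD)
    qed
    moreover have "a \<in> p" if "a \<in> ?J" for a
    proof -
      have "\<zero>\<^bsub>R\<^esub> \<oplus>\<^bsub>R\<^esub> a \<in> A_ideal G D \<xi> H" 
        unfolding A_ideal_def set_add_def' using that zA by blast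
      then show ?thesis using sub that Jc by (metis p.l_zero subsetD)
    qed
    ultimately show "?A \<subseteq> p \<and> ?J \<subseteq> p" by blast
  next
    assume "?A \<subseteq> p \<and> ?J \<subseteq> p"
    then show "A_ideal G D \<xi> H \<subseteq> p"
      using additive_subgroup.a_closed[OF p.additive_subgroup_axioms]
      by (fastforce simp: A_ideal_def set_add_def')
  qed
  moreover have "?A \<subseteq> p \<longleftrightarrow> ?S \<subseteq> p"
    using p.genideal_minimal[OF p.is_ideal] p.genideal_self[OF S] unfolding A_circ_def by blast
  moreover have "?J \<subseteq> p \<longleftrightarrow> (\<forall>m\<in>carrier \<M>. \<not> comp_group G m \<subseteq> H \<longrightarrow> delta m \<in> p)"
    unfolding J_star_def by (subst lin_span_subset_prime_iff) auto
  ultimately show ?thesis by blast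
qed

end

text \<open>A component outside p that shows \<open>I_ideal\<close> not to be contained in p has a
  group containing H; the containment cannot be strict, since \<open>I_star\<close> lies in
  p.\<close>

lemma mem_stratum:
  fixes p :: "('a list set \<Rightarrow> 'k::field) set"
  shows "p \<in> stratum G D \<xi> H \<longleftrightarrow> primeideal p R \<and>
    (\<forall>m\<in>carrier \<M>. H \<subset> comp_group G m \<longrightarrow> delta m \<in> p) \<and>
    (\<exists>m\<in>carrier \<M>. comp_group G m = H \<and> delta m \<notin> p)"
proof (cases "primeideal p R")
  case True
  have "I_star G D \<xi> H \<subseteq> p \<longleftrightarrow> (\<forall>m\<in>carrier \<M>. H \<subset> comp_group G m \<longrightarrow> delta m \<in> p)"
    unfolding I_star_def by (subst lin_span_subset_prime_iff[OF True]) auto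
  moreover have "I_ideal G D \<xi> H \<subseteq> p \<longleftrightarrow> (\<forall>m\<in>carrier \<M>. H \<subseteq> comp_group G m \<longrightarrow> delta m \<in> p)"
    unfolding I_ideal_def by (subst lin_span_subset_prime_iff[OF True]) auto
  ultimately show ?thesis
    using True unfolding stratum_def V_def Spec_def by blast
qed (simp add: stratum_def V_def Spec_def)

lemma mem_V_J_star:
  fixes p :: "('a list set \<Rightarrow> 'k::field) set"
  shows "p \<in> V R (J_star G D \<xi> H) \<longleftrightarrow> primeideal p R \<and>
    (\<forall>m\<in>carrier \<M>. \<not> comp_group G m \<subseteq> H \<longrightarrow> delta m \<in> p)"
proof (cases "primeideal p R")
  case True
  have "J_star G D \<xi> H \<subseteq> p \<longleftrightarrow> (\<forall>m\<in>carrier \<M>. \<not> comp_group G m \<subseteq> H \<longrightarrow> delta m \<in> p)"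
    unfolding J_star_def by (subst lin_span_subset_prime_iff[OF True]) auto
  then show ?thesis using True by (simp add: V_def Spec_def)
qed (simp add: V_def Spec_def)

lemma stratum_subset_V_J_star:
  assumes "subgroup H G"
  shows "stratum G D \<xi> H \<subseteq> V R (J_star G D \<xi> H :: ('a list set \<Rightarrow> 'k::field) set)"
proof
  fix p :: "('a list set \<Rightarrow> 'k) set" assume "p \<in> stratum G D \<xi> H"
  then have p: "primeideal p R" and star: "\<And>m. m \<in> carrier \<M> \<Longrightarrow> H \<subset> comp_group G m \<Longrightarrow> delta m \<in> p"
    and "\<exists>m\<in>carrier \<M>. comp_group G m = H \<and> delta m \<notin> p"
    unfolding mem_stratum by blast+
  then obtain m\<^sub>0 where m\<^sub>0: "m\<^sub>0 \<in> carrier \<M>" "comp_group G m\<^sub>0 = H" "delta m\<^sub>0 \<notin> p" by blast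
  have "delta m \<in> p" if m: "m \<in> carrier \<M>" "\<not> comp_group G m \<subseteq> H" for m
  proof -
    have "H \<union> comp_group G m \<subseteq> comp_group G (m\<^sub>0 \<otimes>\<^bsub>\<M>\<^esub> m)"
      using comp_group_mult[OF m\<^sub>0(1) m(1)] m\<^sub>0(2) by (auto intro: generate.incl)
    then have "delta (m\<^sub>0 \<otimes>\<^bsub>\<M>\<^esub> m) \<in> p" using m m\<^sub>0(1) by (intro star) auto
    then show ?thesis using delta_mult_in_prime_iff[OF p m\<^sub>0(1) m(1)] m\<^sub>0(3) by blast
  qed
  then show "p \<in> V R (J_star G D \<xi> H)" using p by (simp add: mem_V_J_star)
qed

text \<open>Uniqueness is a premise about a single subgroup, because the lemma serves both a
  non-splitter H itself and each member of a free factor family.\<close>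

lemma delta_diff_in_prime_unique:
  fixes p :: "('a list set \<Rightarrow> 'k::field) set"
  assumes p: "primeideal p R" and HG: "subgroup H G"
    and unique: "\<And>n m m'. \<lbrakk>m \<in> components G D \<xi> n; m' \<in> components G D \<xi> n;
      comp_group G m = H; comp_group G m' = H\<rbrakk> \<Longrightarrow> m = m'"
    and m\<^sub>0: "m\<^sub>0 \<in> carrier \<M>" "comp_group G m\<^sub>0 = H" "delta m\<^sub>0 \<notin> p"
    and m: "m \<in> components G D \<xi> n" "m' \<in> components G D \<xi> n" "comp_group G m \<subseteq> H" "comp_group G m' \<subseteq> H"
  shows "delta m \<ominus>\<^bsub>R\<^esub> delta m' \<in> p"
proof -
  obtain n\<^sub>0 where n\<^sub>0: "m\<^sub>0 \<in> components G D \<xi> n\<^sub>0" using m\<^sub>0(1) by (auto simp: carrier_Comp)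
  have mc: "m \<in> carrier \<M>" "m' \<in> carrier \<M>" using m components_in_Comp by auto
  have grp: "comp_group G (m\<^sub>0 \<otimes>\<^bsub>\<M>\<^esub> x) = H" if "x \<in> carrier \<M>" "comp_group G x \<subseteq> H" for x
    using comp_group_mult[OF m\<^sub>0(1) that(1)] m\<^sub>0(2) that(2) generate_subgroup_eq[OF HG]
    by (simp add: Un_absorb2)
  have "m\<^sub>0 \<otimes>\<^bsub>\<M>\<^esub> m = m\<^sub>0 \<otimes>\<^bsub>\<M>\<^esub> m'"
    using m mc grp components_mult[OF n\<^sub>0] by (intro unique) auto
  then show ?thesis by (rule delta_diff_in_prime[OF p mc m\<^sub>0(1,3)])
qed

lemma stratum_trivial: "stratum G D \<xi> {\<one>} = {varpi G D \<xi> :: ('a list set \<Rightarrow> 'k::field) set}"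
proof (intro subset_antisym subsetI)
  fix p :: "('a list set \<Rightarrow> 'k) set" assume "p \<in> stratum G D \<xi> {\<one>}"
  then have p: "primeideal p R" and star: "\<And>m. m \<in> carrier \<M> \<Longrightarrow> {\<one>} \<subset> comp_group G m \<Longrightarrow> delta m \<in> p"
    unfolding mem_stratum by blast+
  have "p = varpi G D \<xi>"
  proof (rule eq_varpiI[OF p])
    fix m assume m: "m \<in> carrier \<M>" "m \<noteq> \<one>\<^bsub>\<M>\<^esub>"
    then have "{\<one>} \<subset> comp_group G m"
      using comp_group_trivial_iff subgroup.one_closed[OF subgroup_comp_group[OF m(1)]] by blast
    then show "delta m \<in> p" using star m(1) by blast
  qed
  then show "p \<in> {varpi G D \<xi>}" by simp
next
  fix p :: "('a list set \<Rightarrow> 'k) set" assume "p \<in> {varpi G D \<xi>}"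
  moreover have "(varpi G D \<xi> :: ('a list set \<Rightarrow> 'k) set) \<in> stratum G D \<xi> {\<one>}"
    unfolding mem_stratum
    using primeideal_varpi delta_in_varpi_iff comp_group_one M.one_closed by blast
  ultimately show "p \<in> stratum G D \<xi> {\<one>}" by simp
qed

lemma stratum_non_splitter:
  assumes H: "D_generated G D H"
    and unique: "\<And>n m m'. \<lbrakk>m \<in> components G D \<xi> n; m' \<in> components G D \<xi> n;
      comp_group G m = H; comp_group G m' = H\<rbrakk> \<Longrightarrow> m = m'"
  shows "stratum G D \<xi> H = V R (A_ideal G D \<xi> H) - {varpi G D \<xi> :: ('a list set \<Rightarrow> 'k::field) set}"
proof (intro subset_antisym subsetI)
  note HG = D_generated_subgroup[OF H]
  fix p :: "('a list set \<Rightarrow> 'k) set" assume st: "p \<in> stratum G D \<xi> H"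
  then have p: "primeideal p R" and "\<exists>m\<in>carrier \<M>. comp_group G m = H \<and> delta m \<notin> p"
    unfolding mem_stratum by blast+
  then obtain m\<^sub>0 where m\<^sub>0: "m\<^sub>0 \<in> carrier \<M>" "comp_group G m\<^sub>0 = H" "delta m\<^sub>0 \<notin> p" by blast
  have "m\<^sub>0 \<noteq> \<one>\<^bsub>\<M>\<^esub>" using m\<^sub>0(2) D_generated_nontrivial[OF H] comp_group_one by blast
  then have ne: "p \<noteq> varpi G D \<xi>" using delta_in_varpi_iff[OF m\<^sub>0(1)] m\<^sub>0(3) by blast
  have diff: "delta m \<ominus>\<^bsub>R\<^esub> delta m' \<in> p"
    if "m \<in> components G D \<xi> n" "m' \<in> components G D \<xi> n" "comp_group G m \<subseteq> H" "comp_group G m' \<subseteq> H"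
    for n m m'
    by (rule delta_diff_in_prime_unique[OF p HG _ m\<^sub>0 that]) (rule unique)
  have "\<forall>m\<in>carrier \<M>. \<not> comp_group G m \<subseteq> H \<longrightarrow> delta m \<in> p"
    using subsetD[OF stratum_subset_V_J_star[OF HG] st] unfolding mem_V_J_star by blast
  then have "A_ideal G D \<xi> H \<subseteq> p"
    unfolding A_ideal_subset_prime_iff[OF p] using diff by blast
  then show "p \<in> V R (A_ideal G D \<xi> H) - {varpi G D \<xi>}"
    using p ne by (simp add: V_def Spec_def)
next
  note HG = D_generated_subgroup[OF H]
  fix p :: "('a list set \<Rightarrow> 'k) set" assume "p \<in> V R (A_ideal G D \<xi> H) - {varpi G D \<xi>}"
  then have p: "primeideal p R" and A: "A_ideal G D \<xi> H \<subseteq> p" and ne: "p \<noteq> varpi G D \<xi>"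
    by (auto simp: V_def Spec_def)
  note A' = A[unfolded A_ideal_subset_prime_iff[OF p]]
  \<comment> \<open>Only \<open>varpi\<close> contains all nontrivial components; the group of the
    one found outside p lies in H because p contains \<open>J_star\<close>.\<close>
  obtain m where m: "m \<in> carrier \<M>" "m \<noteq> \<one>\<^bsub>\<M>\<^esub>" "delta m \<notin> p"
    using eq_varpiI[OF p] ne by blast
  have mH: "comp_group G m \<subseteq> H" using A' m by blast
  obtain d where d: "m \<in> components G D \<xi> d" using m(1) by (auto simp: carrier_Comp)
  have "d > 0" using components_one_iff[OF d] m(2) by simp
  obtain n m\<^sub>0 where n: "n > 0" "m\<^sub>0 \<in> components G D \<xi> n" "comp_group G m\<^sub>0 = H"
    using ex_component_with_group[OF H] by blast
  have m\<^sub>0: "m\<^sub>0 \<in> carrier \<M>" using n(2) components_in_Comp by blast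
  \<comment> \<open>The degrees d of \<open>m\<close> and n of \<open>m\<^sub>0\<close> are
    exchanged as exponents. Both are positive, so the powers keep the groups, and such a power lies
    in p only if its base does.\<close>
  let ?a = "m [^]\<^bsub>\<M>\<^esub> n" and ?b = "m\<^sub>0 [^]\<^bsub>\<M>\<^esub> d"
  have "?a \<in> components G D \<xi> (n * d)" "?b \<in> components G D \<xi> (n * d)"
    using components_pow[OF d, of n] components_pow[OF n(2), of d] by (simp_all add: mult.commute)
  moreover have "comp_group G ?a \<subseteq> H" "comp_group G ?b \<subseteq> H"
    using comp_group_pow[OF m(1) n(1)] comp_group_pow[OF m\<^sub>0 \<open>d > 0\<close>] mH n(3) by simp_all
  ultimately have "delta ?a \<ominus>\<^bsub>R\<^esub> delta ?b \<in> p" using A' by blast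
  then have "delta m\<^sub>0 \<notin> p"
    using delta_in_prime_of_diff[OF p, of ?a ?b] m(1,3) m\<^sub>0
      delta_pow_in_prime[OF p m(1) n(1)] delta_pow_in_prime[OF p m\<^sub>0 \<open>d > 0\<close>]
    by auto
  then show "p \<in> stratum G D \<xi> H"
    unfolding mem_stratum using p A' m\<^sub>0 n(3) by blast
qed

lemma delta_in_R_sub: "m \<in> carrier \<M> \<Longrightarrow> delta m \<in> R_sub G D \<xi> H \<longleftrightarrow> comp_group G m \<subseteq> H"
  by (simp add: R_sub_def)

lemma contract_delta_iff:
  assumes "contract G D \<xi> H p = contract G D \<xi> H q" "m \<in> carrier \<M>" "comp_group G m \<subseteq> H"
  shows "delta m \<in> p \<longleftrightarrow> delta m \<in> q"
  using assms delta_in_R_sub by (auto simp: contract_def)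

text \<open>Restriction of functions to the components with group in \<open>K\<close> is a retraction of the ring
  onto \<open>R\<^sup>K\<close> with kernel \<open>J\<^sub>K\<^sup>*\<close>, so primes of \<open>R\<^sup>K\<close> lift to primes containing \<open>J\<^sub>K\<^sup>*\<close>.\<close>

lemma ex_prime_with_contraction:
  fixes p :: "('a list set \<Rightarrow> 'k::field) set"
  assumes p: "primeideal p R" and KG: "subgroup K G"
    and diff: "\<And>n m m'. \<lbrakk>m \<in> components G D \<xi> n; m' \<in> components G D \<xi> n;
      comp_group G m \<subseteq> K; comp_group G m' \<subseteq> K\<rbrakk> \<Longrightarrow> delta m \<ominus>\<^bsub>R\<^esub> delta m' \<in> p"
    and a: "a \<in> carrier \<M>" "comp_group G a \<subseteq> K" "a \<noteq> \<one>\<^bsub>\<M>\<^esub>" "delta a \<notin> p"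
  shows "\<exists>q\<in>V R (A_ideal G D \<xi> K) - {varpi G D \<xi>}. contract G D \<xi> K p = contract G D \<xi> K q"
proof -
  define N where "N = {m \<in> carrier \<M>. comp_group G m \<subseteq> K}"
  \<comment> \<open>The preimage of p under restriction to the components with group in K: it agrees
    with p on R^K and also contains the components outside K, which p itself may fail to do.\<close>
  define q where "q = {f \<in> carrier R. restr N f \<in> p}"
  have q: "primeideal q R"
    using M.primeideal_restr[OF face_comp_group[OF KG]] p unfolding q_def N_def R_eq by blast
  have p0: "(\<lambda>x. 0) \<in> p"
    using additive_subgroup.zero_closed[OF ideal.axioms(1)[OF primeideal.axioms(1)[OF p]]]
    by (simp add: R_eq monoid_ring_simps)
  have span: "lin_span N \<subseteq> carrier R"
    by (auto simp: N_def R_eq lin_span_eq monoid_ring_carrier)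
  then have mem: "f \<in> q \<longleftrightarrow> f \<in> p" if "f \<in> lin_span N" for f
    using that by (auto simp: q_def restr_ident)
  have "A_ideal G D \<xi> K \<subseteq> q"
    unfolding A_ideal_subset_prime_iff[OF q]
  proof (intro conjI ballI allI impI)
    fix m assume "m \<in> carrier \<M>" "\<not> comp_group G m \<subseteq> K"
    then show "delta m \<in> q" using p0 by (simp add: q_def restr_delta N_def)
  next
    fix n m m' assume m: "m \<in> components G D \<xi> n" "m' \<in> components G D \<xi> n"
      "comp_group G m \<subseteq> K" "comp_group G m' \<subseteq> K"
    have mc: "m \<in> carrier \<M>" "m' \<in> carrier \<M>" using m components_in_Comp by auto
    then have "delta m \<ominus>\<^bsub>R\<^esub> delta m' = (\<lambda>x. delta m x - delta m' x :: 'k)"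
      unfolding R_eq by (intro M.monoid_ring_minus) auto
    moreover have "{x. delta m x - delta m' x \<noteq> (0::'k)} \<subseteq> {m, m'}" by (auto simp: delta_def)
    ultimately have "delta m \<ominus>\<^bsub>R\<^esub> delta m' \<in> (lin_span N :: ('a list set \<Rightarrow> 'k) set)"
      using m(3,4) mc finite_subset[of _ "{m, m'}"] by (auto simp: lin_span_eq N_def)
    then show "delta m \<ominus>\<^bsub>R\<^esub> delta m' \<in> q" using mem diff[OF m] by blast
  qed
  \<comment> \<open>The component a is what separates q from \<open>varpi\<close>, which contains
    every nontrivial component.\<close>
  moreover have "delta a \<notin> q" using a mem[of "delta a"] by (simp add: N_def)
  then have "q \<noteq> varpi G D \<xi>" using delta_in_varpi_iff[OF a(1)] a(3) by blast
  moreover have "contract G D \<xi> K p = contract G D \<xi> K q"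
    using mem by (auto simp: contract_def R_sub_def N_def)
  ultimately show ?thesis using q by (auto simp: V_def Spec_def)
qed

text \<open>Membership in the preimage for K means that p and some q containing
  \<open>A_ideal\<close> of K, other than \<open>varpi\<close>, contain the same elements of R^K.
  Each inclusion turns on the existence of a component of group K outside p, for every member
  K.\<close>

lemma stratum_free_factor_family:
  assumes H: "D_generated G D H" and fac: "free_factor_family G D \<xi> H Hs"
    and unique: "\<And>K n m m'. \<lbrakk>K \<in> set Hs; m \<in> components G D \<xi> n; m' \<in> components G D \<xi> n;
      comp_group G m = K; comp_group G m' = K\<rbrakk> \<Longrightarrow> m = m'"
  shows "(stratum G D \<xi> H :: ('a list set \<Rightarrow> 'k::field) set set) =
    V R (J_star G D \<xi> H) \<inter>
    (\<Inter>K\<in>set Hs. {p \<in> Spec R. contract G D \<xi> K p \<in>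
      contract G D \<xi> K ` (V R (A_ideal G D \<xi> K) - {varpi G D \<xi>})})"
    (is "_ = ?V \<inter> (\<Inter>K\<in>set Hs. ?W K)")
proof (intro subset_antisym subsetI)
  have gen: "D_generated G D K" if "K \<in> set Hs" for K
    using fac that by (simp add: free_factor_family_def factor_family_def)
  fix p :: "('a list set \<Rightarrow> 'k) set" assume st: "p \<in> stratum G D \<xi> H"
  then have p: "primeideal p R" and "\<exists>m\<in>carrier \<M>. comp_group G m = H \<and> delta m \<notin> p"
    unfolding mem_stratum by blast+
  then obtain m\<^sub>0 where m\<^sub>0: "m\<^sub>0 \<in> carrier \<M>" "comp_group G m\<^sub>0 = H" "delta m\<^sub>0 \<notin> p" by blast
  have "p \<in> ?W K" if K: "K \<in> set Hs" for K
  proof -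
    obtain i where i: "i < length Hs" "K = Hs ! i" using K by (auto simp: in_set_conv_nth)
    \<comment> \<open>A factor of a component outside p is outside p, so the part of
      \<open>m\<^sub>0\<close> belonging to K plays for K the role that \<open>m\<^sub>0\<close>
      plays for H.\<close>
    obtain a b where ab: "a \<in> carrier \<M>" "b \<in> carrier \<M>" "m\<^sub>0 = a \<otimes>\<^bsub>\<M>\<^esub> b" "comp_group G a = K"
      using free_factor_family_split[OF H fac i(1) m\<^sub>0(1,2)] i(2) by blast
    have a: "delta a \<notin> p" using delta_mult_in_prime_iff[OF p ab(1,2)] m\<^sub>0(3) ab(3) by simp
    have a1: "a \<noteq> \<one>\<^bsub>\<M>\<^esub>" using ab(4) D_generated_nontrivial[OF gen[OF K]] comp_group_one by blast
    note KG = D_generated_subgroup[OF gen[OF K]]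
    have diff: "delta m \<ominus>\<^bsub>R\<^esub> delta m' \<in> p"
      if "m \<in> components G D \<xi> n" "m' \<in> components G D \<xi> n" "comp_group G m \<subseteq> K" "comp_group G m' \<subseteq> K"
      for n m m'
      by (rule delta_diff_in_prime_unique[OF p KG _ ab(1,4) a that]) (rule unique[OF K])
    have "\<exists>q\<in>V R (A_ideal G D \<xi> K) - {varpi G D \<xi>}. contract G D \<xi> K p = contract G D \<xi> K q"
      by (rule ex_prime_with_contraction[OF p KG diff ab(1) _ a1 a]) (use ab(4) in auto)
    then show ?thesis using p by (auto simp: Spec_def)
  qed
  then show "p \<in> ?V \<inter> (\<Inter>K\<in>set Hs. ?W K)"
    using stratum_subset_V_J_star[OF D_generated_subgroup[OF H]] st by blast
next
  have gen: "D_generated G D K" if "K \<in> set Hs" for K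
    using fac that by (simp add: free_factor_family_def factor_family_def)
  fix p :: "('a list set \<Rightarrow> 'k) set" assume pV: "p \<in> ?V \<inter> (\<Inter>K\<in>set Hs. ?W K)"
  then have p: "primeideal p R" and J: "\<And>m. m \<in> carrier \<M> \<Longrightarrow> \<not> comp_group G m \<subseteq> H \<Longrightarrow> delta m \<in> p"
    unfolding mem_V_J_star Int_iff by blast+
  \<comment> \<open>The description for a single member, applied to q, yields a component of group K
    outside q. It lies in R^K, where p and q agree.\<close>
  have ex: "\<exists>m\<in>carrier \<M>. comp_group G m = K \<and> delta m \<notin> p" if K: "K \<in> set Hs" for K
  proof -
    obtain q :: "('a list set \<Rightarrow> 'k) set" where q: "q \<in> V R (A_ideal G D \<xi> K) - {varpi G D \<xi>}"
        "contract G D \<xi> K p = contract G D \<xi> K q"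
      using pV K by blast
    have "stratum G D \<xi> K = V R (A_ideal G D \<xi> K) - {varpi G D \<xi> :: ('a list set \<Rightarrow> 'k) set}"
      by (rule stratum_non_splitter[OF gen[OF K]]) (rule unique[OF K])
    then have "q \<in> stratum G D \<xi> K" using q(1) by blast
    then obtain m where "m \<in> carrier \<M>" "comp_group G m = K" "delta m \<notin> q"
      unfolding mem_stratum by blast
    then show ?thesis using contract_delta_iff[OF q(2)] by blast
  qed
  \<comment> \<open>The components found for the members are multiplied together; primality keeps
    the product outside p, and the groups generate H. The empty list corresponds to the trivial
    component.\<close>
  have "\<exists>m\<in>carrier \<M>. comp_group G m = generate G (\<Union>(set Ks)) \<and> delta m \<notin> p" if "set Ks \<subseteq> set Hs" for Ks
    using that
  proof (induction Ks)
    case Nil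
    then show ?case
      using delta_one_notin_prime[OF p] by (auto simp: comp_group_one generate_empty intro!: bexI[of _ "\<one>\<^bsub>\<M>\<^esub>"])
  next
    case (Cons K Ks)
    have KG: "subgroup K G" using gen D_generated_subgroup Cons.prems by simp
    have "L \<subseteq> carrier G" if "L \<in> set Ks" for L
      using that gen D_generated_subgroup subgroup.subset Cons.prems by (metis list.set_intros(2) subsetD)
    then have Ksc: "\<Union>(set Ks) \<subseteq> carrier G" by blast
    obtain a where a: "a \<in> carrier \<M>" "comp_group G a = K" "delta a \<notin> p"
      using ex Cons.prems by auto
    obtain b where b: "b \<in> carrier \<M>" "comp_group G b = generate G (\<Union>(set Ks))" "delta b \<notin> p"
      using Cons by auto
    have "comp_group G (a \<otimes>\<^bsub>\<M>\<^esub> b) = generate G (generate G K \<union> generate G (\<Union>(set Ks)))"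
      using comp_group_mult[OF a(1) b(1)] a(2) b(2) generate_subgroup_eq[OF KG] by simp
    also have "\<dots> = generate G (\<Union>(set (K # Ks)))"
      using generate_Un_generate[OF subgroup.subset[OF KG] Ksc] by simp
    finally show ?case
      using a b delta_mult_in_prime_iff[OF p a(1) b(1)] M.m_closed[OF a(1) b(1)] by blast
  qed
  from this[of Hs] have "\<exists>m\<in>carrier \<M>. comp_group G m = H \<and> delta m \<notin> p"
    using factor_family_generate[OF H] fac by (simp add: free_factor_family_def)
  then show "p \<in> stratum G D \<xi> H"
    unfolding mem_stratum using p J by blast
qed

end

theorem theorem6p16:
  fixes G (structure) and D :: "'a set set" and \<xi> :: "'a set \<Rightarrow> nat"
  assumes "group G" and "finite (carrier G)"
    and "D \<noteq> {}" and "D \<subseteq> conj_classes G - {{\<one>}}"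
    and "\<forall>\<gamma>\<in>D. \<xi> \<gamma> > 0"
    and char: "\<not> CHAR('k::field) dvd order G"
    and split: "\<forall>H\<in>Sub_GD G D - {{\<one>}}. non_splitter G D H \<or> factored_splitter G D \<xi> H"
    and unique: "\<forall>H\<in>Sub_GD G D. non_splitter G D H \<longrightarrow>
      (\<forall>n. \<forall>m\<in>components G D \<xi> n. \<forall>m'\<in>components G D \<xi> n.
        comp_group G m = H \<longrightarrow> comp_group G m' = H \<longrightarrow> m = m')"
  shows
    "(stratum G D \<xi> {\<one>} :: ('a list set \<Rightarrow> 'k) set set) = {varpi G D \<xi>} \<and>
     (\<forall>H\<in>Sub_GD G D. non_splitter G D H \<longrightarrow>
       (stratum G D \<xi> H :: ('a list set \<Rightarrow> 'k) set set) =
         V (comp_ring G D \<xi>) (A_ideal G D \<xi> H) - {varpi G D \<xi>}) \<and>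
     (\<forall>H\<in>Sub_GD G D. H \<noteq> {\<one>} \<and> \<not> non_splitter G D H \<longrightarrow>
       factored_splitter G D \<xi> H \<and>
       (\<exists>Hs. internal_direct_product G H Hs \<and> free_factor_family G D \<xi> H Hs \<and>
         (\<forall>K\<in>set Hs. non_splitter G D K)) \<and>
       (\<forall>Hs. internal_direct_product G H Hs \<and> free_factor_family G D \<xi> H Hs \<and>
         (\<forall>K\<in>set Hs. non_splitter G D K) \<longrightarrow>
         (stratum G D \<xi> H :: ('a list set \<Rightarrow> 'k) set set) =
           V (comp_ring G D \<xi>) (J_star G D \<xi> H) \<inter>
           (\<Inter>K\<in>set Hs. {p \<in> Spec (comp_ring G D \<xi>).
             contract G D \<xi> K p \<in>
               contract G D \<xi> K ` (V (comp_ring G D \<xi>) (A_ideal G D \<xi> K) - {varpi G D \<xi>})})))"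
proof (intro conjI ballI impI allI)
  interpret hurwitz_data G D \<xi>
    using assms(1-5) by (intro hurwitz_data.intro hurwitz_data_axioms.intro) auto
  have gen: "D_generated G D K" if "non_splitter G D K" for K
    using that by (simp add: non_splitter_def)
  have uniq: "m = m'" if "non_splitter G D K" "m \<in> components G D \<xi> n" "m' \<in> components G D \<xi> n"
    "comp_group G m = K" "comp_group G m' = K" for K n m m'
    using unique that gen unfolding Sub_GD_def by blast
  show "(stratum G D \<xi> {\<one>} :: ('a list set \<Rightarrow> 'k) set set) = {varpi G D \<xi>}"
    by (rule stratum_trivial)
  show "(stratum G D \<xi> H :: ('a list set \<Rightarrow> 'k) set set) =
      V (comp_ring G D \<xi>) (A_ideal G D \<xi> H) - {varpi G D \<xi>}" if "non_splitter G D H" for H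
    using uniq[OF that] by (intro stratum_non_splitter gen that)
  fix H assume HS: "H \<in> Sub_GD G D" and H1: "H \<noteq> {\<one>} \<and> \<not> non_splitter G D H"
  then have H: "D_generated G D H" by (simp add: Sub_GD_def)
  show "factored_splitter G D \<xi> H" using split HS H1 by blast
  obtain Hs where Hs: "free_factor_family G D \<xi> H Hs" "\<forall>K\<in>set Hs. non_splitter G D K"
    using ex_free_factor_family_non_splitters[OF split H] by blast
  have "internal_direct_product G H Hs"
    using Hs(1) factor_family_generate[OF H] free_family_independent
    by (intro internal_direct_product_independent) (auto simp: free_factor_family_def)
  then show "\<exists>Hs. internal_direct_product G H Hs \<and> free_factor_family G D \<xi> H Hs \<and>
      (\<forall>K\<in>set Hs. non_splitter G D K)"
    using Hs by blast
  \<comment> \<open>The formula is required for every such family, not just for the one constructed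
    above, so the list is taken arbitrary again.\<close>
  fix Hs assume "internal_direct_product G H Hs \<and> free_factor_family G D \<xi> H Hs \<and>
      (\<forall>K\<in>set Hs. non_splitter G D K)"
  then show "(stratum G D \<xi> H :: ('a list set \<Rightarrow> 'k) set set) =
      V (comp_ring G D \<xi>) (J_star G D \<xi> H) \<inter>
      (\<Inter>K\<in>set Hs. {p \<in> Spec (comp_ring G D \<xi>).
        contract G D \<xi> K p \<in>
          contract G D \<xi> K ` (V (comp_ring G D \<xi>) (A_ideal G D \<xi> K) - {varpi G D \<xi>})})"
    using uniq by (intro stratum_free_factor_family[OF H]) blast+
qed

end
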